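(* Let $\mathcal{I}$ be the class of idempotent rings, let $\mathcal{C}$ be any class of rings included in $\mathcal{I}$ (possibly $\mathcal{C}=\mathcal{I}$), and let $P$ be a property of rings. If $P$ is stable by local algebras at von Neumann regular elements in $\mathcal{C}$ and stable under taking matrices in $\mathcal{C}$, then $P$ is Morita invariant in $\mathcal{C}$. Equivalently, if $P$ is stable by corners in $\mathcal{C}$ and stable under taking matrices in $\mathcal{C}$, then $P$ is Morita invariant in $\mathcal{C}$.
   Context: Rings are associative, not necessarily with identity. Properties of rings are understood to be invariant under ring isomorphism. A ring $R$ is idempotent if $R^2=R$. For an idempotent ring $R$, $R$-Mod denotes the full subcategory of the category of all left $R$-modules whose objects are the modules $M$ that are unital ($M=RM$) and nondegenerate (for $m\in M$, $Rm=0$ implies $m=0$). Two idempotent rings $R$ and $S$ are Morita equivalent if the categories $R$-Mod and $S$-Mod are equivalent. For $a\in R$, the local ring (local algebra) of $R$ at $a$ is $R_a:=aRa$ with the sum inherited from $R$ and product $axa\cdot aya=axaya$; for an idempotent $e$, $R_e$ is the corner $eRe$. An element $a\in R$ is von Neumann regular if $a=aba$ for some $b\in R$. Let $\mathcal{C}$ be a class of rings and $P$ a property of rings. - $P$ is stable by corners in $\mathcal{C}$ if for any ring $R$ in $\mathcal{C}$: $R$ satisfies $P$ if and only if every corner $R_e$, with $e=e^2\in R$, satisfies $P$. - $P$ is stable by local algebras at von Neumann regular elements in $\mathcal{C}$ if for every ring $R$ in $\mathcal{C}$: $R$ satisfies $P$ if and only if every local algebra $R_a$ at a von Neumann regular element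 $a\in R$ satisfies $P$. - $P$ is stable under taking matrices in $\mathcal{C}$ if for every ring $R$ in $\mathcal{C}$: $R$ satisfies $P$ if and only if every matrix ring $\mathbb{M}_n(R)$, for any $n\in\mathbb{N}$, satisfies $P$. - $P$ is Morita invariant in $\mathcal{C}$ if whenever a ring of $\mathcal{C}$ satisfies $P$, every ring in $\mathcal{C}$ Morita equivalent to it also satisfies $P$.
   Formalization: The class C is also assumed to contain, up to isomorphism, every matrix ring M_n(R), n ≥ 1, of each R in C (automatic for all idempotent rings). Without this the claim fails: C = {k×k, k×M_2(k)}, P = "isomorphic to 0, k or M_n(k)×M_n(k)", k a field. *)

theory Defs
  imports "HOL-Algebra.Module" "HOL-Algebra.Generated_Groups"
begin

section \<open>Rings without identity\<close>

text \<open>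
  Rings are represented by the library record \<^typ>\<open>'a ring\<close>, whose field \<^const>\<open>one\<close> carries no
  meaning here: no axiom mentions it and isomorphisms ignore it.
\<close>

locale rng = abelian_group R for R (structure) +
  assumes rng_m_closed: "\<lbrakk>x \<in> carrier R; y \<in> carrier R\<rbrakk> \<Longrightarrow> x \<otimes> y \<in> carrier R"
    and rng_m_assoc: "\<lbrakk>x \<in> carrier R; y \<in> carrier R; z \<in> carrier R\<rbrakk>
          \<Longrightarrow> (x \<otimes> y) \<otimes> z = x \<otimes> (y \<otimes> z)"
    and rng_l_distr: "\<lbrakk>x \<in> carrier R; y \<in> carrier R; z \<in> carrier R\<rbrakk>
          \<Longrightarrow> (x \<oplus> y) \<otimes> z = x \<otimes> z \<oplus> y \<otimes> z"
    and rng_r_distr: "\<lbrakk>x \<in> carrier R; y \<in> carrier R; z \<in> carrier R\<rbrakk>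
          \<Longrightarrow> z \<otimes> (x \<oplus> y) = z \<otimes> x \<oplus> z \<otimes> y"

definition rng_iso :: "('a, 'k) ring_scheme \<Rightarrow> ('b, 'l) ring_scheme \<Rightarrow> ('a \<Rightarrow> 'b) set" where
  "rng_iso R S = {h. bij_betw h (carrier R) (carrier S) \<and>
     (\<forall>x\<in>carrier R. \<forall>y\<in>carrier R.
        h (x \<oplus>\<^bsub>R\<^esub> y) = h x \<oplus>\<^bsub>S\<^esub> h y \<and> h (x \<otimes>\<^bsub>R\<^esub> y) = h x \<otimes>\<^bsub>S\<^esub> h y)}"

definition rng_isomorphic :: "('a, 'k) ring_scheme \<Rightarrow> ('b, 'l) ring_scheme \<Rightarrow> bool" where
  "rng_isomorphic R S \<longleftrightarrow> rng_iso R S \<noteq> {}"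

text \<open>\<open>R\<^sup>2\<close> is the additive subgroup generated by the products.\<close>

definition idempotent_rng :: "('a, 'k) ring_scheme \<Rightarrow> bool" where
  "idempotent_rng R \<longleftrightarrow> rng R \<and>
     generate (add_monoid R) {x \<otimes>\<^bsub>R\<^esub> y | x y. x \<in> carrier R \<and> y \<in> carrier R} = carrier R"

definition corner :: "('a, 'k) ring_scheme \<Rightarrow> 'a \<Rightarrow> ('a, 'k) ring_scheme" where
  "corner R e = R\<lparr>carrier := {e \<otimes>\<^bsub>R\<^esub> x \<otimes>\<^bsub>R\<^esub> e | x. x \<in> carrier R}\<rparr>"

text \<open>
  The product \<open>axa \<cdot> aya = axaya\<close> does not depend on the choice of \<open>x\<close> and \<open>y\<close>, since
  \<open>axaya = (axa)ya = ax(aya)\<close>.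
\<close>

definition local_algebra :: "('a, 'k) ring_scheme \<Rightarrow> 'a \<Rightarrow> ('a, 'k) ring_scheme" where
  "local_algebra R a = R\<lparr>
     carrier := {a \<otimes>\<^bsub>R\<^esub> x \<otimes>\<^bsub>R\<^esub> a | x. x \<in> carrier R},
     monoid.mult := (\<lambda>u v. THE w. \<exists>x\<in>carrier R. \<exists>y\<in>carrier R.
       u = a \<otimes>\<^bsub>R\<^esub> x \<otimes>\<^bsub>R\<^esub> a \<and> v = a \<otimes>\<^bsub>R\<^esub> y \<otimes>\<^bsub>R\<^esub> a \<and>
       w = a \<otimes>\<^bsub>R\<^esub> x \<otimes>\<^bsub>R\<^esub> a \<otimes>\<^bsub>R\<^esub> y \<otimes>\<^bsub>R\<^esub> a)\<rparr>"

definition von_neumann_regular :: "('a, 'k) ring_scheme \<Rightarrow> 'a \<Rightarrow> bool" where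
  "von_neumann_regular R a \<longleftrightarrow> a \<in> carrier R \<and> (\<exists>b\<in>carrier R. a = a \<otimes>\<^bsub>R\<^esub> b \<otimes>\<^bsub>R\<^esub> a)"

definition matrix_rng :: "nat \<Rightarrow> ('a, 'k) ring_scheme \<Rightarrow> (nat \<times> nat \<Rightarrow> 'a) ring" where
  "matrix_rng n R = \<lparr>
     carrier = {..<n} \<times> {..<n} \<rightarrow>\<^sub>E carrier R,
     monoid.mult = (\<lambda>A B. restrict (\<lambda>(i, j). \<Oplus>\<^bsub>R\<^esub>k\<in>{..<n}. A (i, k) \<otimes>\<^bsub>R\<^esub> B (k, j)) ({..<n} \<times> {..<n})),
     one = undefined,
     zero = restrict (\<lambda>ij. \<zero>\<^bsub>R\<^esub>) ({..<n} \<times> {..<n}),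
     add = (\<lambda>A B. restrict (\<lambda>ij. A ij \<oplus>\<^bsub>R\<^esub> B ij) ({..<n} \<times> {..<n}))\<rparr>"

section \<open>Categories of modules and Morita equivalence\<close>

record ('o, 'f) category =
  obj :: "'o set"
  mor :: "'o \<Rightarrow> 'o \<Rightarrow> 'f set"
  ident :: "'o \<Rightarrow> 'f"
  comp :: "'o \<Rightarrow> 'o \<Rightarrow> 'o \<Rightarrow> 'f \<Rightarrow> 'f \<Rightarrow> 'f"
    \<comment> \<open>\<open>comp \<C> X Y Z g f\<close> is \<open>g \<circ> f\<close> for \<open>f : X \<rightarrow> Y\<close> and \<open>g : Y \<rightarrow> Z\<close>\<close>

record ('o, 'f, 'p, 'g) functor_data =
  fobj :: "'o \<Rightarrow> 'p"
  fmor :: "'o \<Rightarrow> 'o \<Rightarrow> 'f \<Rightarrow> 'g"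

definition is_functor ::
  "('o, 'f) category \<Rightarrow> ('p, 'g) category \<Rightarrow> ('o, 'f, 'p, 'g) functor_data \<Rightarrow> bool" where
  "is_functor \<C> \<D> F \<longleftrightarrow>
     (\<forall>X\<in>obj \<C>. fobj F X \<in> obj \<D>) \<and>
     (\<forall>X\<in>obj \<C>. \<forall>Y\<in>obj \<C>. \<forall>f\<in>mor \<C> X Y. fmor F X Y f \<in> mor \<D> (fobj F X) (fobj F Y)) \<and>
     (\<forall>X\<in>obj \<C>. fmor F X X (ident \<C> X) = ident \<D> (fobj F X)) \<and>
     (\<forall>X\<in>obj \<C>. \<forall>Y\<in>obj \<C>. \<forall>Z\<in>obj \<C>. \<forall>f\<in>mor \<C> X Y. \<forall>g\<in>mor \<C> Y Z.
        fmor F X Z (comp \<C> X Y Z g f) =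
        comp \<D> (fobj F X) (fobj F Y) (fobj F Z) (fmor F Y Z g) (fmor F X Y f))"

definition id_functor :: "('o, 'f, 'o, 'f) functor_data" where
  "id_functor = \<lparr>fobj = (\<lambda>X. X), fmor = (\<lambda>X Y f. f)\<rparr>"

definition comp_functor :: "('p, 'g, 'q, 'h) functor_data \<Rightarrow> ('o, 'f, 'p, 'g) functor_data
    \<Rightarrow> ('o, 'f, 'q, 'h) functor_data" where
  "comp_functor G F = \<lparr>fobj = (\<lambda>X. fobj G (fobj F X)),
     fmor = (\<lambda>X Y f. fmor G (fobj F X) (fobj F Y) (fmor F X Y f))\<rparr>"

definition isomorphism_in :: "('o, 'f) category \<Rightarrow> 'o \<Rightarrow> 'o \<Rightarrow> 'f \<Rightarrow> bool" where
  "isomorphism_in \<C> X Y f \<longleftrightarrow> f \<in> mor \<C> X Y \<and>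
     (\<exists>g\<in>mor \<C> Y X. comp \<C> X Y X g f = ident \<C> X \<and> comp \<C> Y X Y f g = ident \<C> Y)"

definition naturally_isomorphic :: "('o, 'f) category \<Rightarrow> ('p, 'g) category
    \<Rightarrow> ('o, 'f, 'p, 'g) functor_data \<Rightarrow> ('o, 'f, 'p, 'g) functor_data \<Rightarrow> bool" where
  "naturally_isomorphic \<C> \<D> F G \<longleftrightarrow> (\<exists>\<eta>.
     (\<forall>X\<in>obj \<C>. isomorphism_in \<D> (fobj F X) (fobj G X) (\<eta> X)) \<and>
     (\<forall>X\<in>obj \<C>. \<forall>Y\<in>obj \<C>. \<forall>f\<in>mor \<C> X Y.
        comp \<D> (fobj F X) (fobj F Y) (fobj G Y) (\<eta> Y) (fmor F X Y f) =
        comp \<D> (fobj F X) (fobj G X) (fobj G Y) (fmor G X Y f) (\<eta> X)))"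

definition equivalent_categories :: "('o, 'f) category \<Rightarrow> ('p, 'g) category \<Rightarrow> bool" where
  "equivalent_categories \<C> \<D> \<longleftrightarrow> (\<exists>F G. is_functor \<C> \<D> F \<and> is_functor \<D> \<C> G \<and>
     naturally_isomorphic \<C> \<C> id_functor (comp_functor G F) \<and>
     naturally_isomorphic \<D> \<D> (comp_functor F G) id_functor)"

text \<open>
  Modules use the library record \<^typ>\<open>('a, 'm) module\<close>, of which only the additive structure and
  \<^const>\<open>smult\<close> are relevant. The library locale \<^locale>\<open>module\<close> is not applicable, as it requires
  a commutative base ring with identity.
\<close>

locale left_module = R?: rng R + M?: abelian_group M
  for R :: "('a, 'k) ring_scheme" (structure) and M :: "('a, 'm, 'l) module_scheme" (structure) +
  assumes lm_smult_closed: "\<lbrakk>r \<in> carrier R; m \<in> carrier M\<rbrakk> \<Longrightarrow> r \<odot>\<^bsub>M\<^esub> m \<in> carrier M"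
    and lm_smult_l_distr: "\<lbrakk>r \<in> carrier R; s \<in> carrier R; m \<in> carrier M\<rbrakk>
          \<Longrightarrow> (r \<oplus>\<^bsub>R\<^esub> s) \<odot>\<^bsub>M\<^esub> m = r \<odot>\<^bsub>M\<^esub> m \<oplus>\<^bsub>M\<^esub> s \<odot>\<^bsub>M\<^esub> m"
    and lm_smult_r_distr: "\<lbrakk>r \<in> carrier R; m \<in> carrier M; m' \<in> carrier M\<rbrakk>
          \<Longrightarrow> r \<odot>\<^bsub>M\<^esub> (m \<oplus>\<^bsub>M\<^esub> m') = r \<odot>\<^bsub>M\<^esub> m \<oplus>\<^bsub>M\<^esub> r \<odot>\<^bsub>M\<^esub> m'"
    and lm_smult_assoc: "\<lbrakk>r \<in> carrier R; s \<in> carrier R; m \<in> carrier M\<rbrakk>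
          \<Longrightarrow> (r \<otimes>\<^bsub>R\<^esub> s) \<odot>\<^bsub>M\<^esub> m = r \<odot>\<^bsub>M\<^esub> (s \<odot>\<^bsub>M\<^esub> m)"

definition unital_module :: "('a, 'k) ring_scheme \<Rightarrow> ('a, 'm, 'l) module_scheme \<Rightarrow> bool" where
  "unital_module R M \<longleftrightarrow>
     generate (add_monoid M) {r \<odot>\<^bsub>M\<^esub> m | r m. r \<in> carrier R \<and> m \<in> carrier M} = carrier M"

definition nondegenerate_module :: "('a, 'k) ring_scheme \<Rightarrow> ('a, 'm, 'l) module_scheme \<Rightarrow> bool" where
  "nondegenerate_module R M \<longleftrightarrow>
     (\<forall>m\<in>carrier M. (\<forall>r\<in>carrier R. r \<odot>\<^bsub>M\<^esub> m = \<zero>\<^bsub>M\<^esub>) \<longrightarrow> m = \<zero>\<^bsub>M\<^esub>)"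

text \<open>
  Module homomorphisms are extensional functions on the carrier of their domain, so that equality
  of morphisms is equality of functions.
\<close>

definition module_homs ::
  "('a, 'k) ring_scheme \<Rightarrow> ('a, 'm) module \<Rightarrow> ('a, 'm) module \<Rightarrow> ('m \<Rightarrow> 'm) set" where
  "module_homs R M N = {f \<in> carrier M \<rightarrow>\<^sub>E carrier N.
     (\<forall>x\<in>carrier M. \<forall>y\<in>carrier M. f (x \<oplus>\<^bsub>M\<^esub> y) = f x \<oplus>\<^bsub>N\<^esub> f y) \<and>
     (\<forall>r\<in>carrier R. \<forall>x\<in>carrier M. f (r \<odot>\<^bsub>M\<^esub> x) = r \<odot>\<^bsub>N\<^esub> f x)}"

definition module_category :: "'a ring \<Rightarrow> (('a, 'm) module, 'm \<Rightarrow> 'm) category" where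
  "module_category R = \<lparr>
     obj = {M. left_module R M \<and> unital_module R M \<and> nondegenerate_module R M},
     mor = module_homs R,
     ident = (\<lambda>M. restrict id (carrier M)),
     comp = (\<lambda>L M N g f. compose (carrier L) g f)\<rparr>"

text \<open>
  The parameter of type \<^typ>\<open>'m itself\<close> names the universe from which the carriers of the modules
  are taken.
\<close>

definition morita_equivalent :: "'m itself \<Rightarrow> 'a ring \<Rightarrow> 'a ring \<Rightarrow> bool" where
  "morita_equivalent U R S \<longleftrightarrow> equivalent_categories
     (module_category R :: (('a, 'm) module, 'm \<Rightarrow> 'm) category)
     (module_category S :: (('a, 'm) module, 'm \<Rightarrow> 'm) category)"

section \<open>Properties of rings\<close>

text \<open>
  A class of rings is a set of rings with carriers in a fixed type \<^typ>\<open>'a\<close>, and a property of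
  rings is an isomorphism-invariant predicate on such rings.
\<close>

definition ring_property :: "('a ring \<Rightarrow> bool) \<Rightarrow> bool" where
  "ring_property P \<longleftrightarrow>
     (\<forall>R S. rng R \<longrightarrow> rng S \<longrightarrow> rng_isomorphic R S \<longrightarrow> P R \<longrightarrow> P S)"

text \<open>
  A matrix ring over a ring on \<^typ>\<open>'a\<close> lives on a different type; it satisfies a property if a
  copy of it on \<^typ>\<open>'a\<close> does. Copies exist whenever \<^typ>\<open>'a\<close> is infinite, and by invariance
  under isomorphism it does not matter which one is taken.
\<close>

definition satisfies :: "('a ring \<Rightarrow> bool) \<Rightarrow> 'b ring \<Rightarrow> bool" where
  "satisfies P X \<longleftrightarrow> (\<exists>S. rng S \<and> rng_isomorphic S X \<and> P S)"

text \<open>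
  Transferring a property along \<open>\<C>\<close> from \<open>R\<close> to the corners of \<open>M\<^sub>n(R)\<close> applies
  stability by corners to \<open>M\<^sub>n(R)\<close>, which must therefore belong to \<open>\<C>\<close> up to isomorphism.
  The requirement cannot be dropped: for a field \<open>k\<close>, take \<open>\<C> = {k \<times> k, k \<times> M\<^sub>2(k)}\<close> and
  the property of being isomorphic to \<open>0\<close>, \<open>k\<close> or \<open>M\<^sub>n(k) \<times> M\<^sub>n(k)\<close> for some \<open>n \<ge> 1\<close>.
\<close>

definition closed_under_matrices :: "'a ring set \<Rightarrow> bool" where
  "closed_under_matrices \<C> \<longleftrightarrow>
     (\<forall>R\<in>\<C>. \<forall>n\<ge>1. \<exists>S\<in>\<C>. rng_isomorphic S (matrix_rng n R))"

definition stable_by_corners :: "'a ring set \<Rightarrow> ('a ring \<Rightarrow> bool) \<Rightarrow> bool" where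
  "stable_by_corners \<C> P \<longleftrightarrow>
     (\<forall>R\<in>\<C>. P R \<longleftrightarrow> (\<forall>e\<in>carrier R. e = e \<otimes>\<^bsub>R\<^esub> e \<longrightarrow> P (corner R e)))"

definition stable_by_local_algebras :: "'a ring set \<Rightarrow> ('a ring \<Rightarrow> bool) \<Rightarrow> bool" where
  "stable_by_local_algebras \<C> P \<longleftrightarrow>
     (\<forall>R\<in>\<C>. P R \<longleftrightarrow> (\<forall>a\<in>carrier R. von_neumann_regular R a \<longrightarrow> P (local_algebra R a)))"

definition stable_under_matrices :: "'a ring set \<Rightarrow> ('a ring \<Rightarrow> bool) \<Rightarrow> bool" where
  "stable_under_matrices \<C> P \<longleftrightarrow>
     (\<forall>R\<in>\<C>. P R \<longleftrightarrow> (\<forall>n\<ge>1. satisfies P (matrix_rng n R)))"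

definition morita_invariant :: "'m itself \<Rightarrow> 'a ring set \<Rightarrow> ('a ring \<Rightarrow> bool) \<Rightarrow> bool" where
  "morita_invariant U \<C> P \<longleftrightarrow>
     (\<forall>R\<in>\<C>. \<forall>S\<in>\<C>. P R \<longrightarrow> morita_equivalent U R S \<longrightarrow> P S)"

section \<open>Matrix rings over idempotent rings\<close>

text \<open>
  For the class of all idempotent rings, \<^const>\<open>closed_under_matrices\<close> holds automatically.
\<close>

context rng begin

lemma rng_l_null: "x \<in> carrier R \<Longrightarrow> \<zero> \<otimes> x = \<zero>"
  by (metis rng_l_distr rng_m_closed l_zero zero_closed add.l_cancel_one')

lemma rng_r_null: "x \<in> carrier R \<Longrightarrow> x \<otimes> \<zero> = \<zero>"
  by (metis rng_r_distr rng_m_closed l_zero zero_closed add.l_cancel_one')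

lemma rng_finsum_ldistr:
  assumes "finite A" "a \<in> carrier R" "f \<in> A \<rightarrow> carrier R"
  shows "finsum R f A \<otimes> a = finsum R (\<lambda>i. f i \<otimes> a) A"
  using assms by (induction A) (auto simp: rng_l_null rng_l_distr rng_m_closed Pi_def)

lemma rng_finsum_rdistr:
  assumes "finite A" "a \<in> carrier R" "f \<in> A \<rightarrow> carrier R"
  shows "a \<otimes> finsum R f A = finsum R (\<lambda>i. a \<otimes> f i) A"
  using assms by (induction A) (auto simp: rng_r_null rng_r_distr rng_m_closed Pi_def)

lemma rng_finsum_swap:
  assumes "finite A" "finite B" "\<And>i j. i \<in> A \<Longrightarrow> j \<in> B \<Longrightarrow> f i j \<in> carrier R"
  shows "finsum R (\<lambda>i. finsum R (f i) B) A = finsum R (\<lambda>j. finsum R (\<lambda>i. f i j) A) B"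
  using assms
proof (induction A)
  case (insert a A)
  then have "finsum R (\<lambda>i. finsum R (f i) B) (insert a A)
      = finsum R (f a) B \<oplus> finsum R (\<lambda>j. finsum R (\<lambda>i. f i j) A) B"
    by (subst finsum_insert) (auto simp: Pi_def intro!: finsum_closed)
  also have "\<dots> = finsum R (\<lambda>j. f a j \<oplus> finsum R (\<lambda>i. f i j) A) B"
    using insert by (subst finsum_addf) (auto simp: Pi_def intro!: finsum_closed)
  also have "\<dots> = finsum R (\<lambda>j. finsum R (\<lambda>i. f i j) (insert a A)) B"
    using insert by (intro finsum_cong') (auto simp: Pi_def intro!: finsum_closed)
  finally show ?case .
qed (simp add: finsum_zero)

lemma matrix_rng: "rng (matrix_rng n R)"
proof -
  let ?M = "matrix_rng n R" and ?I = "{..<n} \<times> {..<n}"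
  have c: "carrier ?M = ?I \<rightarrow>\<^sub>E carrier R" by (simp add: matrix_rng_def)
  have a: "(A \<oplus>\<^bsub>?M\<^esub> B) = restrict (\<lambda>ij. A ij \<oplus> B ij) ?I" for A B by (simp add: matrix_rng_def)
  have z: "\<zero>\<^bsub>?M\<^esub> = restrict (\<lambda>ij. \<zero>) ?I" by (simp add: matrix_rng_def)
  have m: "(A \<otimes>\<^bsub>?M\<^esub> B) = restrict (\<lambda>(i, j). \<Oplus>k\<in>{..<n}. A (i, k) \<otimes> B (k, j)) ?I" for A B
    by (simp add: matrix_rng_def)
  have cl: "A (i,j) \<in> carrier R" if "A \<in> carrier ?M" "i < n" "j < n" for A i j
    using that unfolding c by (auto simp: PiE_def Pi_def)
  have ext: "A = B" if "A \<in> carrier ?M" "B \<in> carrier ?M"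
      "\<And>i j. i < n \<Longrightarrow> j < n \<Longrightarrow> A (i,j) = B (i,j)" for A B
    using that unfolding c by (intro PiE_ext) auto
  have ac: "A \<oplus>\<^bsub>?M\<^esub> B \<in> carrier ?M" if "A \<in> carrier ?M" "B \<in> carrier ?M" for A B
    using cl that unfolding a c[of] by (auto simp: c)
  have zc: "\<zero>\<^bsub>?M\<^esub> \<in> carrier ?M" unfolding z c by auto
  have mc: "A \<otimes>\<^bsub>?M\<^esub> B \<in> carrier ?M" if "A \<in> carrier ?M" "B \<in> carrier ?M" for A B
  proof -
    have "restrict (\<lambda>(i, j). \<Oplus>k\<in>{..<n}. A (i, k) \<otimes> B (k, j)) ?I \<in> ?I \<rightarrow>\<^sub>E carrier R"
      using cl that by (auto intro!: finsum_closed rng_m_closed simp: Pi_def)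
    then show ?thesis by (simp add: m c)
  qed
  have ae: "(A \<oplus>\<^bsub>?M\<^esub> B) (i,j) = A (i,j) \<oplus> B (i,j)" if "i < n" "j < n" for A B i j
    using that by (simp add: a)
  have me: "(A \<otimes>\<^bsub>?M\<^esub> B) (i,j) = (\<Oplus>k\<in>{..<n}. A (i, k) \<otimes> B (k, j))" if "i < n" "j < n" for A B i j
    using that by (simp add: m)
  have ze: "\<zero>\<^bsub>?M\<^esub> (i,j) = \<zero>" if "i < n" "j < n" for i j
    using that by (simp add: z)
  have neg: "\<exists>B\<in>carrier ?M. B \<oplus>\<^bsub>?M\<^esub> A = \<zero>\<^bsub>?M\<^esub>" if A: "A \<in> carrier ?M" for A
  proof
    show B: "restrict (\<lambda>ij. \<ominus> A ij) ?I \<in> carrier ?M" using cl A by (auto simp: c)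
    show "restrict (\<lambda>ij. \<ominus> A ij) ?I \<oplus>\<^bsub>?M\<^esub> A = \<zero>\<^bsub>?M\<^esub>"
      using A B by (intro ext ac zc) (auto simp: ae ze cl l_neg)
  qed
  interpret ag: abelian_group ?M
  proof (rule abelian_groupI)
    fix A B C assume ABC: "A \<in> carrier ?M" "B \<in> carrier ?M" "C \<in> carrier ?M"
    show "A \<oplus>\<^bsub>?M\<^esub> B \<oplus>\<^bsub>?M\<^esub> C = A \<oplus>\<^bsub>?M\<^esub> (B \<oplus>\<^bsub>?M\<^esub> C)"
      using ABC by (intro ext ac) (simp_all add: ae cl a_assoc)
  next
    fix A B assume AB: "A \<in> carrier ?M" "B \<in> carrier ?M"
    show "A \<oplus>\<^bsub>?M\<^esub> B = B \<oplus>\<^bsub>?M\<^esub> A"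
      using AB by (intro ext ac) (simp_all add: ae cl a_comm)
  next
    fix A assume A: "A \<in> carrier ?M"
    show "\<zero>\<^bsub>?M\<^esub> \<oplus>\<^bsub>?M\<^esub> A = A"
      using A by (intro ext ac zc) (simp_all add: ae ze cl)
  qed (use ac zc neg in auto)
  show ?thesis
  proof
    fix A B C assume ABC: "A \<in> carrier ?M" "B \<in> carrier ?M" "C \<in> carrier ?M"
    show "A \<otimes>\<^bsub>?M\<^esub> B \<otimes>\<^bsub>?M\<^esub> C = A \<otimes>\<^bsub>?M\<^esub> (B \<otimes>\<^bsub>?M\<^esub> C)"
    proof (intro ext mc ABC)
      fix i j assume ij: "i < n" "j < n"
      have "(A \<otimes>\<^bsub>?M\<^esub> B \<otimes>\<^bsub>?M\<^esub> C) (i,j)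
          = (\<Oplus>k\<in>{..<n}. (\<Oplus>l\<in>{..<n}. A (i, l) \<otimes> B (l, k)) \<otimes> C (k, j))"
        unfolding me[OF ij] using ij ABC
        by (intro finsum_cong') (auto simp: me cl rng_m_closed Pi_def intro!: finsum_closed rng_m_closed)
      also have "\<dots> = (\<Oplus>k\<in>{..<n}. \<Oplus>l\<in>{..<n}. A (i, l) \<otimes> (B (l, k) \<otimes> C (k, j)))"
      proof (intro finsum_cong' refl)
        fix k assume "k \<in> {..<n}"
        then have k: "k < n" by simp
        have "(\<Oplus>l\<in>{..<n}. A (i, l) \<otimes> B (l, k)) \<otimes> C (k, j)
            = (\<Oplus>l\<in>{..<n}. A (i, l) \<otimes> B (l, k) \<otimes> C (k, j))"
          using ij ABC k by (intro rng_finsum_ldistr) (simp_all add: cl rng_m_closed Pi_def)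
        also have "\<dots> = (\<Oplus>l\<in>{..<n}. A (i, l) \<otimes> (B (l, k) \<otimes> C (k, j)))"
          using ij ABC k by (intro finsum_cong') (simp_all add: cl rng_m_assoc rng_m_closed Pi_def)
        finally show "(\<Oplus>l\<in>{..<n}. A (i, l) \<otimes> B (l, k)) \<otimes> C (k, j)
            = (\<Oplus>l\<in>{..<n}. A (i, l) \<otimes> (B (l, k) \<otimes> C (k, j)))" .
      qed (use ij ABC in \<open>auto simp: cl Pi_def intro!: finsum_closed rng_m_closed\<close>)
      also have "\<dots> = (\<Oplus>l\<in>{..<n}. \<Oplus>k\<in>{..<n}. A (i, l) \<otimes> (B (l, k) \<otimes> C (k, j)))"
        using ij ABC by (intro rng_finsum_swap) (simp_all add: cl rng_m_closed)
      also have "\<dots> = (\<Oplus>l\<in>{..<n}. A (i, l) \<otimes> (\<Oplus>k\<in>{..<n}. B (l, k) \<otimes> C (k, j)))"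
        using ij ABC by (intro finsum_cong')
          (simp_all add: rng_finsum_rdistr cl rng_m_closed Pi_def)
      also have "\<dots> = (A \<otimes>\<^bsub>?M\<^esub> (B \<otimes>\<^bsub>?M\<^esub> C)) (i,j)"
        unfolding me[OF ij] using ij ABC
        by (intro finsum_cong') (auto simp: me cl Pi_def intro!: finsum_closed rng_m_closed)
      finally show "(A \<otimes>\<^bsub>?M\<^esub> B \<otimes>\<^bsub>?M\<^esub> C) (i,j) = (A \<otimes>\<^bsub>?M\<^esub> (B \<otimes>\<^bsub>?M\<^esub> C)) (i,j)" .
    qed
    show "(A \<oplus>\<^bsub>?M\<^esub> B) \<otimes>\<^bsub>?M\<^esub> C = A \<otimes>\<^bsub>?M\<^esub> C \<oplus>\<^bsub>?M\<^esub> B \<otimes>\<^bsub>?M\<^esub> C"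
    proof (intro ext mc ac ABC)
      fix i j assume ij: "i < n" "j < n"
      have "((A \<oplus>\<^bsub>?M\<^esub> B) \<otimes>\<^bsub>?M\<^esub> C) (i,j) = (\<Oplus>k\<in>{..<n}. A (i, k) \<otimes> C (k, j) \<oplus> B (i, k) \<otimes> C (k, j))"
        unfolding me[OF ij] using ij ABC
        by (intro finsum_cong') (simp_all add: ae cl rng_l_distr rng_m_closed Pi_def)
      also have "\<dots> = (A \<otimes>\<^bsub>?M\<^esub> C \<oplus>\<^bsub>?M\<^esub> B \<otimes>\<^bsub>?M\<^esub> C) (i,j)"
        unfolding me[OF ij] ae[OF ij] using ij ABC
        by (intro finsum_addf) (simp_all add: cl rng_m_closed Pi_def)
      finally show "((A \<oplus>\<^bsub>?M\<^esub> B) \<otimes>\<^bsub>?M\<^esub> C) (i,j) = (A \<otimes>\<^bsub>?M\<^esub> C \<oplus>\<^bsub>?M\<^esub> B \<otimes>\<^bsub>?M\<^esub> C) (i,j)" .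
    qed
    show "C \<otimes>\<^bsub>?M\<^esub> (A \<oplus>\<^bsub>?M\<^esub> B) = C \<otimes>\<^bsub>?M\<^esub> A \<oplus>\<^bsub>?M\<^esub> C \<otimes>\<^bsub>?M\<^esub> B"
    proof (intro ext mc ac ABC)
      fix i j assume ij: "i < n" "j < n"
      have "(C \<otimes>\<^bsub>?M\<^esub> (A \<oplus>\<^bsub>?M\<^esub> B)) (i,j) = (\<Oplus>k\<in>{..<n}. C (i, k) \<otimes> A (k, j) \<oplus> C (i, k) \<otimes> B (k, j))"
        unfolding me[OF ij] using ij ABC
        by (intro finsum_cong') (simp_all add: ae cl rng_r_distr rng_m_closed Pi_def)
      also have "\<dots> = (C \<otimes>\<^bsub>?M\<^esub> A \<oplus>\<^bsub>?M\<^esub> C \<otimes>\<^bsub>?M\<^esub> B) (i,j)"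
        unfolding me[OF ij] ae[OF ij] using ij ABC
        by (intro finsum_addf) (simp_all add: cl rng_m_closed Pi_def)
      finally show "(C \<otimes>\<^bsub>?M\<^esub> (A \<oplus>\<^bsub>?M\<^esub> B)) (i,j) = (C \<otimes>\<^bsub>?M\<^esub> A \<oplus>\<^bsub>?M\<^esub> C \<otimes>\<^bsub>?M\<^esub> B) (i,j)" .
    qed
  qed (use mc in auto)
qed

end

lemma matrix_rng_idempotent:
  assumes "idempotent_rng R"
  shows "idempotent_rng (matrix_rng n R)"
proof -
  interpret rng R using assms by (simp add: idempotent_rng_def)
  have gen: "generate (add_monoid R) {x \<otimes>\<^bsub>R\<^esub> y | x y. x \<in> carrier R \<and> y \<in> carrier R} = carrier R"
    using assms by (simp add: idempotent_rng_def)
  let ?M = "matrix_rng n R" and ?I = "{..<n} \<times> {..<n}"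
  interpret M: rng ?M by (rule matrix_rng)
  let ?G = "{x \<otimes>\<^bsub>?M\<^esub> y | x y. x \<in> carrier ?M \<and> y \<in> carrier ?M}"
  let ?H = "generate (add_monoid ?M) ?G"
  define E where "E i j r = restrict (\<lambda>ij. if ij = (i,j) then r else \<zero>\<^bsub>R\<^esub>) ?I" for i j r
  have c: "carrier ?M = ?I \<rightarrow>\<^sub>E carrier R" by (simp add: matrix_rng_def)
  have add: "(A \<oplus>\<^bsub>?M\<^esub> B) = restrict (\<lambda>ij. A ij \<oplus>\<^bsub>R\<^esub> B ij) ?I" for A B by (simp add: matrix_rng_def)
  have zer: "\<zero>\<^bsub>?M\<^esub> = restrict (\<lambda>ij. \<zero>\<^bsub>R\<^esub>) ?I" by (simp add: matrix_rng_def)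
  have Ec: "E i j r \<in> carrier ?M" if "r \<in> carrier R" for i j r
    using that by (auto simp: E_def c)
  have Hadd: "A \<oplus>\<^bsub>?M\<^esub> B \<in> ?H" if "A \<in> ?H" "B \<in> ?H" for A B
    using generate.eng[OF that] by simp
  have HZ: "\<zero>\<^bsub>?M\<^esub> \<in> ?H" using generate.one[of "add_monoid ?M" ?G] by simp
  have Hsub: "?H \<subseteq> carrier ?M"
    using M.add.generate_incl[of ?G] M.rng_m_closed by auto
  have Hneg: "\<ominus>\<^bsub>?M\<^esub> A \<in> ?H" if "A \<in> ?H" for A
    using M.add.generate_m_inv_closed[OF _ that] M.rng_m_closed by (auto simp: a_inv_def)
  have Emult: "E i j (x \<otimes>\<^bsub>R\<^esub> y) = E i i x \<otimes>\<^bsub>?M\<^esub> E i j y"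
    if x: "x \<in> carrier R" and y: "y \<in> carrier R" and ij: "i < n" "j < n" for i j x y
  proof -
    have "(\<Oplus>\<^bsub>R\<^esub>k\<in>{..<n}. E i i x (p, k) \<otimes>\<^bsub>R\<^esub> E i j y (k, q)) = E i j (x \<otimes>\<^bsub>R\<^esub> y) (p, q)"
      if pq: "p < n" "q < n" for p q
    proof -
      have "(\<Oplus>\<^bsub>R\<^esub>k\<in>{..<n}. E i i x (p, k) \<otimes>\<^bsub>R\<^esub> E i j y (k, q))
          = (\<Oplus>\<^bsub>R\<^esub>k\<in>{..<n}. if i = k then E i j (x \<otimes>\<^bsub>R\<^esub> y) (p, q) else \<zero>\<^bsub>R\<^esub>)"
        using x y ij pq
        by (intro finsum_cong') (auto simp: E_def rng_l_null rng_r_null rng_m_closed)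
      also have "\<dots> = E i j (x \<otimes>\<^bsub>R\<^esub> y) (p, q)"
        using x y ij pq by (subst add.finprod_singleton) (auto simp: E_def rng_m_closed)
      finally show ?thesis .
    qed
    then show ?thesis by (auto simp: matrix_rng_def E_def intro!: restrict_ext)
  qed
  have EH: "E i j r \<in> ?H" if "r \<in> carrier R" "i < n" "j < n" for i j r
  proof -
    have prod: "E i j h \<in> ?H" if h: "h \<in> {x \<otimes>\<^bsub>R\<^esub> y | x y. x \<in> carrier R \<and> y \<in> carrier R}" for h
      using h \<open>i < n\<close> \<open>j < n\<close> Emult Ec by (blast intro: generate.incl)
    have "r \<in> generate (add_monoid R) {x \<otimes>\<^bsub>R\<^esub> y | x y. x \<in> carrier R \<and> y \<in> carrier R}"
      using that gen by simp
    then show ?thesis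
    proof (induction rule: generate.induct)
      case one
      have "E i j \<zero>\<^bsub>R\<^esub> = \<zero>\<^bsub>?M\<^esub>" by (auto simp: E_def zer)
      then show ?case using HZ by simp
    next
      case (incl h) then show ?case by (rule prod)
    next
      case (inv h)
      then have h: "h \<in> carrier R" using rng_m_closed by auto
      have "E i j (\<ominus>\<^bsub>R\<^esub> h) \<oplus>\<^bsub>?M\<^esub> E i j h = \<zero>\<^bsub>?M\<^esub>"
        using h by (auto simp: E_def zer add l_neg intro!: restrict_ext)
      then have "E i j (\<ominus>\<^bsub>R\<^esub> h) = \<ominus>\<^bsub>?M\<^esub> E i j h"
        using h Ec by (simp add: M.minus_equality)
      then show ?case using Hneg[OF prod[OF inv]] by (simp add: a_inv_def)
    next
      case (eng h1 h2)
      have "E i j (h1 \<oplus>\<^bsub>R\<^esub> h2) = E i j h1 \<oplus>\<^bsub>?M\<^esub> E i j h2"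
        using eng gen by (auto simp: E_def add intro!: restrict_ext)
      then show ?case using eng Hadd by simp
    qed
  qed
  have "A \<in> ?H" if A: "A \<in> carrier ?M" for A
  proof -
    have "restrict (\<lambda>ij. if ij \<in> F then A ij else \<zero>\<^bsub>R\<^esub>) ?I \<in> ?H" if "finite F" "F \<subseteq> ?I" for F
      using that
    proof (induction F)
      case empty
      have "restrict (\<lambda>ij. if ij \<in> {} then A ij else \<zero>\<^bsub>R\<^esub>) ?I = \<zero>\<^bsub>?M\<^esub>" by (simp add: zer)
      then show ?case using HZ by (simp only:)
    next
      case (insert ij F)
      obtain i j where ij: "ij = (i, j)" "i < n" "j < n" using insert by auto
      have cl: "A pq \<in> carrier R" if "pq \<in> ?I" for pq
        using A that unfolding c by (rule PiE_mem)
      have "restrict (\<lambda>pq. if pq \<in> insert ij F then A pq else \<zero>\<^bsub>R\<^esub>) ?I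
          = E i j (A ij) \<oplus>\<^bsub>?M\<^esub> restrict (\<lambda>pq. if pq \<in> F then A pq else \<zero>\<^bsub>R\<^esub>) ?I"
        using insert cl by (auto simp: E_def add ij(1) intro!: restrict_ext)
      moreover have "restrict (\<lambda>pq. if pq \<in> F then A pq else \<zero>\<^bsub>R\<^esub>) ?I \<in> ?H" using insert by blast
      moreover have "E i j (A ij) \<in> ?H" using EH cl ij by auto
      ultimately show ?case using Hadd by presburger
    qed
    from this[of ?I] have "restrict A ?I \<in> ?H" by (simp cong: restrict_cong)
    then show ?thesis using A by (simp add: c PiE_restrict)
  qed
  then show ?thesis using Hsub M.rng_axioms unfolding idempotent_rng_def by blast
qed


lemma inj_on_extensional_functions:
  assumes "infinite (UNIV :: 'a set)" "finite I"
  shows "\<exists>g :: ('i \<Rightarrow> 'a) \<Rightarrow> 'a. inj_on g (I \<rightarrow>\<^sub>E UNIV)"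
proof -
  obtain p :: "'a \<times> 'a \<Rightarrow> 'a" where p: "inj p"
    using ordIso_imp_ordLeq[OF card_of_Times_same_infinite[OF assms(1)]]
    by (auto simp: card_of_ordLeq[symmetric])
  show ?thesis
    using assms(2)
  proof (induction I)
    case empty
    then show ?case by simp
  next
    case (insert i I)
    then obtain g :: "('i \<Rightarrow> 'a) \<Rightarrow> 'a" where g: "inj_on g (I \<rightarrow>\<^sub>E UNIV)" by blast
    have "inj_on (\<lambda>f. p (f i, g (restrict f I))) (insert i I \<rightarrow>\<^sub>E UNIV)"
    proof (rule inj_onI)
      fix f f' :: "'i \<Rightarrow> 'a"
      assume f: "f \<in> insert i I \<rightarrow>\<^sub>E UNIV" "f' \<in> insert i I \<rightarrow>\<^sub>E UNIV"
        and eq: "p (f i, g (restrict f I)) = p (f' i, g (restrict f' I))"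
      from eq p have 1: "f i = f' i" and "g (restrict f I) = g (restrict f' I)"
        by (auto dest: injD)
      with g have "restrict f I = restrict f' I" by (auto dest: inj_onD)
      then have "f j = f' j" if "j \<in> I" for j using that by (metis restrict_apply')
      then show "f = f'" using f 1 by (intro PiE_ext[OF f]) auto
    qed
    then show ?case by blast
  qed
qed

lemma generate_rng_iso:
  assumes "abelian_group R" "abelian_group S"
    and add: "\<And>x y. x \<in> carrier R \<Longrightarrow> y \<in> carrier R \<Longrightarrow> h (x \<oplus>\<^bsub>R\<^esub> y) = h x \<oplus>\<^bsub>S\<^esub> h y"
    and h: "h ` carrier R = carrier S" and A: "A \<subseteq> carrier R" and g: "generate (add_monoid R) A = carrier R"
  shows "generate (add_monoid S) (h ` A) = carrier S"
proof -
  interpret R: abelian_group R by fact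
  interpret S: abelian_group S by fact
  interpret H: group_hom "add_monoid R" "add_monoid S" h
    using add h by unfold_locales (auto simp: hom_def)
  show ?thesis using H.generate_img[of A] A g h by simp
qed

lemma idempotent_rngs_closed_under_matrices:
  assumes "infinite (UNIV :: 'a set)"
  shows "closed_under_matrices {R :: 'a ring. idempotent_rng R}"
  unfolding closed_under_matrices_def
proof (intro ballI allI impI)
  fix R :: "'a ring" and n :: nat
  assume "R \<in> {R. idempotent_rng R}"
  then have idem: "idempotent_rng (matrix_rng n R)" by (simp add: matrix_rng_idempotent)
  let ?M = "matrix_rng n R"
  interpret M: rng ?M using idem by (simp add: idempotent_rng_def)
  obtain g :: "(nat \<times> nat \<Rightarrow> 'a) \<Rightarrow> 'a" where "inj_on g (({..<n} \<times> {..<n}) \<rightarrow>\<^sub>E UNIV)"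
    using inj_on_extensional_functions[OF assms, of "{..<n} \<times> {..<n}"] by auto
  then have g: "inj_on g (carrier ?M)"
    by (rule inj_on_subset) (auto simp: matrix_rng_def PiE_def)
  define k where "k = the_inv_into (carrier ?M) g"
  have k: "k (g x) = x" if "x \<in> carrier ?M" for x
    using that g by (simp add: k_def the_inv_into_f_f)
  define S :: "'a ring" where "S = \<lparr>carrier = g ` carrier ?M, monoid.mult = (\<lambda>x y. g (k x \<otimes>\<^bsub>?M\<^esub> k y)),
    one = undefined, zero = g \<zero>\<^bsub>?M\<^esub>, add = (\<lambda>x y. g (k x \<oplus>\<^bsub>?M\<^esub> k y))\<rparr>"
  have Sc: "carrier S = g ` carrier ?M" by (simp add: S_def)
  have Sa: "g x \<oplus>\<^bsub>S\<^esub> g y = g (x \<oplus>\<^bsub>?M\<^esub> y)" if "x \<in> carrier ?M" "y \<in> carrier ?M" for x y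
    using that by (simp add: S_def k)
  have Sm: "g x \<otimes>\<^bsub>S\<^esub> g y = g (x \<otimes>\<^bsub>?M\<^esub> y)" if "x \<in> carrier ?M" "y \<in> carrier ?M" for x y
    using that by (simp add: S_def k)
  have Sz: "\<zero>\<^bsub>S\<^esub> = g \<zero>\<^bsub>?M\<^esub>" by (simp add: S_def)
  interpret S: abelian_group S
  proof (rule abelian_groupI)
    fix x assume "x \<in> carrier S"
    then obtain a where a: "x = g a" "a \<in> carrier ?M" by (auto simp: Sc)
    then show "\<exists>y\<in>carrier S. y \<oplus>\<^bsub>S\<^esub> x = \<zero>\<^bsub>S\<^esub>"
      by (intro bexI[of _ "g (\<ominus>\<^bsub>?M\<^esub> a)"]) (auto simp: Sc Sa Sz M.l_neg)
  next
    fix x y assume "x \<in> carrier S" "y \<in> carrier S"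
    then show "x \<oplus>\<^bsub>S\<^esub> y = y \<oplus>\<^bsub>S\<^esub> x" by (auto simp: Sc Sa M.a_comm)
  qed (auto simp: Sc Sa Sz M.a_assoc)
  have "rng S"
  proof
    fix x y assume "x \<in> carrier S" "y \<in> carrier S"
    then show "x \<otimes>\<^bsub>S\<^esub> y \<in> carrier S" by (auto simp: Sc Sm M.rng_m_closed)
  next
    fix x y z assume "x \<in> carrier S" "y \<in> carrier S" "z \<in> carrier S"
    then obtain a b c where "x = g a" "y = g b" "z = g c"
      and "a \<in> carrier ?M" "b \<in> carrier ?M" "c \<in> carrier ?M" by (auto simp: Sc)
    then show "x \<otimes>\<^bsub>S\<^esub> y \<otimes>\<^bsub>S\<^esub> z = x \<otimes>\<^bsub>S\<^esub> (y \<otimes>\<^bsub>S\<^esub> z)"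
      and "(x \<oplus>\<^bsub>S\<^esub> y) \<otimes>\<^bsub>S\<^esub> z = x \<otimes>\<^bsub>S\<^esub> z \<oplus>\<^bsub>S\<^esub> y \<otimes>\<^bsub>S\<^esub> z"
      and "z \<otimes>\<^bsub>S\<^esub> (x \<oplus>\<^bsub>S\<^esub> y) = z \<otimes>\<^bsub>S\<^esub> x \<oplus>\<^bsub>S\<^esub> z \<otimes>\<^bsub>S\<^esub> y"
      by (simp_all add: Sa Sm M.rng_m_closed M.rng_m_assoc M.rng_l_distr M.rng_r_distr)
  qed
  have gen: "generate (add_monoid S) (g ` {x \<otimes>\<^bsub>?M\<^esub> y | x y. x \<in> carrier ?M \<and> y \<in> carrier ?M}) = carrier S"
  proof (rule generate_rng_iso[OF M.abelian_group_axioms S.abelian_group_axioms])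
    show "g (x \<oplus>\<^bsub>?M\<^esub> y) = g x \<oplus>\<^bsub>S\<^esub> g y" if "x \<in> carrier ?M" "y \<in> carrier ?M" for x y
      using Sa[OF that] by (rule sym)
    show "{x \<otimes>\<^bsub>?M\<^esub> y | x y. x \<in> carrier ?M \<and> y \<in> carrier ?M} \<subseteq> carrier ?M"
      using M.rng_m_closed by blast
    show "generate (add_monoid ?M) {x \<otimes>\<^bsub>?M\<^esub> y | x y. x \<in> carrier ?M \<and> y \<in> carrier ?M} = carrier ?M"
      using idem unfolding idempotent_rng_def by blast
  qed (rule Sc[symmetric])
  have "g ` {x \<otimes>\<^bsub>?M\<^esub> y | x y. x \<in> carrier ?M \<and> y \<in> carrier ?M}
      = {x \<otimes>\<^bsub>S\<^esub> y | x y. x \<in> carrier S \<and> y \<in> carrier S}" (is "?L = ?R")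
  proof
    show "?L \<subseteq> ?R" by (auto simp: Sc) (metis Sm imageI)
    show "?R \<subseteq> ?L" by (auto simp: Sc Sm intro!: imageI) blast
  qed
  with gen \<open>rng S\<close> have "idempotent_rng S" by (simp add: idempotent_rng_def)
  moreover have "k \<in> rng_iso S ?M"
    unfolding rng_iso_def
  proof (intro CollectI conjI ballI)
    show "bij_betw k (carrier S) (carrier ?M)"
      unfolding Sc k_def using g by (intro bij_betw_the_inv_into bij_betw_imageI refl)
  next
    fix x y assume "x \<in> carrier S" "y \<in> carrier S"
    then obtain a b where "x = g a" "y = g b" "a \<in> carrier ?M" "b \<in> carrier ?M"
      by (auto simp: Sc)
    then show "k (x \<oplus>\<^bsub>S\<^esub> y) = k x \<oplus>\<^bsub>?M\<^esub> k y" and "k (x \<otimes>\<^bsub>S\<^esub> y) = k x \<otimes>\<^bsub>?M\<^esub> k y"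
      by (simp_all add: Sa Sm k M.rng_m_closed)
  qed
  ultimately show "\<exists>S\<in>{R :: 'a ring. idempotent_rng R}. rng_isomorphic S ?M"
    by (auto simp: rng_isomorphic_def)
qed

end

theory Submission
  imports Defs
begin

text \<open>
  Stability by local algebras at von Neumann regular elements amounts to stability by corners:
  for \<open>a = aba\<close> the local algebra at \<open>a\<close> is isomorphic to the corner at the idempotent \<open>ab\<close>
  (\<open>corner_isomorphic_local_algebra\<close>). So consider a property that is stable by corners and under
  taking matrices.

  Let \<open>R\<close> and \<open>S\<close> be idempotent rings with equivalent module categories. The key fact
  (\<open>corner_isomorphic_matrix_corner\<close>) is that for every idempotent \<open>e \<in> S\<close> there are \<open>n\<close> and an
  idempotent \<open>A\<close> in \<open>M\<^sub>n(R)\<close> with \<open>eSe \<cong> A M\<^sub>n(R) A\<close>. If \<open>R\<close> has the property, then so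
  have \<open>M\<^sub>n(R)\<close>, which belongs to the class up to isomorphism, its corner at
  \<open>A\<close>, hence all corners of \<open>S\<close>, and finally \<open>S\<close> itself.

  To find \<open>A\<close>, let \<open>Q\<close> be the quotient of \<open>Se\<close> by the elements annihilated by \<open>S\<close>. It represents
  the functor \<open>N \<mapsto> eN\<close> on the unital nondegenerate modules, and its endomorphism ring is opposite
  to \<open>eSe\<close> (\<open>idempotent_module\<close>). Let \<open>F\<close> be an equivalence from \<open>R\<close>-Mod to \<open>S\<close>-Mod and
  \<open>F(P) \<cong> Q\<close>. Since \<open>F\<close> is fully faithful and preserves biproducts, it is additive
  (\<open>fully_faithful_add\<close>), so \<open>P\<close> has the same endomorphism ring as \<open>Q\<close>.

  It remains to describe \<open>P\<close> in coordinates. Let \<open>U\<close> be the quotient of \<open>R\<close> by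
  \<open>t = {r. Rr = 0}\<close>. The maps \<open>r \<mapsto> rx\<close> from \<open>U\<close> to \<open>P\<close> are jointly epic, hence the images of the
  corresponding maps from \<open>F(U)\<close> to \<open>Q\<close> generate \<open>Q\<close>. Writing the generator of \<open>Q\<close> as a finite
  sum of elements of these images expresses the identity of \<open>Q\<close>, and therefore that of \<open>P\<close>,
  as a finite sum of morphisms that factor through \<open>F(U)\<close> and \<open>U\<close>, respectively. This is a dual
  basis \<open>p = \<Sum> c\<^sub>i(p) x\<^sub>i\<close> (\<open>dual_basis_exists\<close>), except that the \<open>c\<^sub>i\<close> are linear only
  modulo \<open>t\<close>. As \<open>Rt = 0\<close>, the failure disappears after multiplication by an element of \<open>R\<close> from
  the left: the matrix \<open>B = (c\<^sub>j(x\<^sub>i))\<close> need not be idempotent, but \<open>A = B\<^sup>2\<close> is, and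
  \<open>f \<mapsto> B (c\<^sub>j(f(x\<^sub>i)))\<close> is an isomorphism from the opposite of the endomorphism ring of \<open>P\<close> onto
  the corner at \<open>A\<close> (\<open>endomorphism_rng_isomorphic_corner\<close>).
\<close>

section \<open>Isomorphisms, corners and local algebras\<close>

lemma rng_isoD:
  assumes "h \<in> rng_iso R S"
  shows "bij_betw h (carrier R) (carrier S)"
    and "x \<in> carrier R \<Longrightarrow> h x \<in> carrier S"
    and "x \<in> carrier R \<Longrightarrow> y \<in> carrier R \<Longrightarrow> h (x \<oplus>\<^bsub>R\<^esub> y) = h x \<oplus>\<^bsub>S\<^esub> h y"
    and "x \<in> carrier R \<Longrightarrow> y \<in> carrier R \<Longrightarrow> h (x \<otimes>\<^bsub>R\<^esub> y) = h x \<otimes>\<^bsub>S\<^esub> h y"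
  using assms by (auto simp: rng_iso_def bij_betw_def)

lemma rng_isomorphic_trans:
  assumes "rng_isomorphic R S" "rng_isomorphic S T"
  shows "rng_isomorphic R T"
proof -
  obtain f g where f: "f \<in> rng_iso R S" and g: "g \<in> rng_iso S T"
    using assms by (auto simp: rng_isomorphic_def)
  have "g \<circ> f \<in> rng_iso R T"
    unfolding rng_iso_def
    using rng_isoD[OF f] rng_isoD[OF g] by (auto intro: bij_betw_trans)
  then show ?thesis by (auto simp: rng_isomorphic_def)
qed

lemma rng_isomorphic_sym:
  assumes "rng_isomorphic R S"
    and add: "\<And>x y. x \<in> carrier R \<Longrightarrow> y \<in> carrier R \<Longrightarrow> x \<oplus>\<^bsub>R\<^esub> y \<in> carrier R"
    and mult: "\<And>x y. x \<in> carrier R \<Longrightarrow> y \<in> carrier R \<Longrightarrow> x \<otimes>\<^bsub>R\<^esub> y \<in> carrier R"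
  shows "rng_isomorphic S R"
proof -
  obtain h where h: "h \<in> rng_iso R S"
    using assms by (auto simp: rng_isomorphic_def)
  define k where "k = the_inv_into (carrier R) h"
  have inj: "inj_on h (carrier R)" and im: "h ` carrier R = carrier S"
    using rng_isoD(1)[OF h] by (auto simp: bij_betw_def)
  have kh: "k (h x) = x" if "x \<in> carrier R" for x
    using inj that by (simp add: k_def the_inv_into_f_f)
  have "k \<in> rng_iso S R"
    unfolding rng_iso_def
  proof (intro CollectI conjI ballI)
    show "bij_betw k (carrier S) (carrier R)"
      unfolding k_def by (rule bij_betw_the_inv_into[OF rng_isoD(1)[OF h]])
  next
    fix x y assume "x \<in> carrier S" "y \<in> carrier S"
    then obtain a b where ab: "x = h a" "y = h b" "a \<in> carrier R" "b \<in> carrier R"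
      using im by blast
    then show "k (x \<oplus>\<^bsub>S\<^esub> y) = k x \<oplus>\<^bsub>R\<^esub> k y" "k (x \<otimes>\<^bsub>S\<^esub> y) = k x \<otimes>\<^bsub>R\<^esub> k y"
      by (simp_all add: rng_isoD(3,4)[OF h, symmetric] kh add mult)
  qed
  then show ?thesis by (auto simp: rng_isomorphic_def)
qed

context rng begin

lemma corner_closed:
  assumes "e \<in> carrier R" "x \<in> carrier (corner R e)"
  shows "x \<in> carrier R"
  using assms by (auto simp: corner_def rng_m_closed)

lemma corner_iff:
  assumes "e \<in> carrier R" "e = e \<otimes> e"
  shows "x \<in> carrier (corner R e) \<longleftrightarrow> x \<in> carrier R \<and> e \<otimes> x = x \<and> x \<otimes> e = x"
proof
  note ee = assms(2)[symmetric]
  assume "x \<in> carrier (corner R e)"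
  then obtain y where y: "y \<in> carrier R" "x = e \<otimes> y \<otimes> e" by (auto simp: corner_def)
  have "e \<otimes> (e \<otimes> y \<otimes> e) = (e \<otimes> e) \<otimes> y \<otimes> e" "e \<otimes> y \<otimes> e \<otimes> e = e \<otimes> y \<otimes> (e \<otimes> e)"
    using y assms(1) by (simp_all add: rng_m_assoc rng_m_closed)
  then show "x \<in> carrier R \<and> e \<otimes> x = x \<and> x \<otimes> e = x"
    using y assms(1) by (simp add: rng_m_closed ee)
next
  assume "x \<in> carrier R \<and> e \<otimes> x = x \<and> x \<otimes> e = x"
  then have "x \<in> carrier R" "x = e \<otimes> x \<otimes> e" by auto
  then show "x \<in> carrier (corner R e)" by (auto simp: corner_def)
qed

lemma rng_corner:
  assumes e: "e \<in> carrier R" "e = e \<otimes> e"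
  shows "rng (corner R e)"
proof -
  note iff = corner_iff[OF e]
  have ops: "\<zero>\<^bsub>corner R e\<^esub> = \<zero>" "x \<oplus>\<^bsub>corner R e\<^esub> y = x \<oplus> y" "x \<otimes>\<^bsub>corner R e\<^esub> y = x \<otimes> y" for x y
    by (simp_all add: corner_def)
  have neg: "e \<otimes> (\<ominus> x) = \<ominus> (e \<otimes> x)" "\<ominus> x \<otimes> e = \<ominus> (x \<otimes> e)" if x: "x \<in> carrier R" for x
  proof -
    have "e \<otimes> (\<ominus> x) \<oplus> e \<otimes> x = \<zero>" "\<ominus> x \<otimes> e \<oplus> x \<otimes> e = \<zero>"
      using x e(1) by (simp_all add: rng_r_distr[symmetric] rng_l_distr[symmetric] l_neg rng_l_null rng_r_null)
    then show "e \<otimes> (\<ominus> x) = \<ominus> (e \<otimes> x)" "\<ominus> x \<otimes> e = \<ominus> (x \<otimes> e)"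
      using x e(1) by (simp_all add: minus_equality rng_m_closed)
  qed
  interpret C: abelian_group "corner R e"
  proof (rule abelian_groupI)
    fix x assume x: "x \<in> carrier (corner R e)"
    show "\<exists>y\<in>carrier (corner R e). y \<oplus>\<^bsub>corner R e\<^esub> x = \<zero>\<^bsub>corner R e\<^esub>"
      using x by (intro bexI[of _ "\<ominus> x"]) (auto simp: iff ops l_neg neg)
  qed (use e(1) in \<open>auto simp: iff ops a_ac rng_l_distr rng_r_distr rng_l_null rng_r_null\<close>)
  show ?thesis
  proof
    fix x y assume x: "x \<in> carrier (corner R e)" and y: "y \<in> carrier (corner R e)"
    have "e \<otimes> (x \<otimes> y) = x \<otimes> y" "x \<otimes> y \<otimes> e = x \<otimes> y"
      using x y e(1) unfolding iff by (metis rng_m_assoc)+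
    then show "x \<otimes>\<^bsub>corner R e\<^esub> y \<in> carrier (corner R e)"
      using x y by (simp add: iff ops rng_m_closed)
  qed (auto simp: iff ops rng_m_assoc rng_l_distr rng_r_distr)
qed

lemma corner_isomorphic:
  assumes h: "h \<in> rng_iso R S" and e: "e \<in> carrier R"
  shows "rng_isomorphic (corner R e) (corner S (h e))"
proof -
  have sub: "carrier (corner R e) \<subseteq> carrier R" using corner_closed[OF e] by blast
  have "carrier (corner R e) = (\<lambda>x. e \<otimes> x \<otimes> e) ` carrier R"
    by (auto simp: corner_def)
  then have "h ` carrier (corner R e) = (\<lambda>x. h e \<otimes>\<^bsub>S\<^esub> h x \<otimes>\<^bsub>S\<^esub> h e) ` carrier R"
    using e by (simp add: image_image rng_isoD(4)[OF h] rng_m_closed)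
  also have "\<dots> = (\<lambda>y. h e \<otimes>\<^bsub>S\<^esub> y \<otimes>\<^bsub>S\<^esub> h e) ` carrier S"
    unfolding rng_isoD(1)[OF h, unfolded bij_betw_def, THEN conjunct2, symmetric] image_image ..
  also have "\<dots> = carrier (corner S (h e))" by (auto simp: corner_def)
  finally have "bij_betw h (carrier (corner R e)) (carrier (corner S (h e)))"
    using rng_isoD(1)[OF h] sub by (auto simp: bij_betw_def intro: inj_on_subset)
  then have "h \<in> rng_iso (corner R e) (corner S (h e))"
    using sub by (auto simp: rng_iso_def corner_def rng_isoD(3,4)[OF h] subset_eq)
  then show ?thesis by (auto simp: rng_isomorphic_def)
qed

end

lemma rng_transport:
  assumes "rng X" and h: "h \<in> rng_iso X Y" and zero: "h \<zero>\<^bsub>X\<^esub> = \<zero>\<^bsub>Y\<^esub>"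
  shows "rng Y"
proof -
  interpret X: rng X by fact
  note add = rng_isoD(3)[OF h, symmetric] and mult = rng_isoD(4)[OF h, symmetric]
  have c: "carrier Y = h ` carrier X" using rng_isoD(1)[OF h] by (simp add: bij_betw_def)
  interpret Y: abelian_group Y
  proof (rule abelian_groupI)
    fix x assume "x \<in> carrier Y"
    then obtain a where a: "x = h a" "a \<in> carrier X" by (auto simp: c)
    then show "\<exists>y\<in>carrier Y. y \<oplus>\<^bsub>Y\<^esub> x = \<zero>\<^bsub>Y\<^esub>"
      by (intro bexI[of _ "h (\<ominus>\<^bsub>X\<^esub> a)"]) (auto simp: c add zero[symmetric] X.l_neg)
  next
    fix x y assume "x \<in> carrier Y" "y \<in> carrier Y"
    then show "x \<oplus>\<^bsub>Y\<^esub> y = y \<oplus>\<^bsub>Y\<^esub> x" by (auto simp: c add X.a_comm)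
  qed (auto simp: c add zero[symmetric] X.a_assoc)
  show ?thesis
  proof
    fix x y assume "x \<in> carrier Y" "y \<in> carrier Y"
    then show "x \<otimes>\<^bsub>Y\<^esub> y \<in> carrier Y" by (auto simp: c mult X.rng_m_closed)
  qed (auto simp: c add mult X.rng_m_closed X.rng_m_assoc X.rng_l_distr X.rng_r_distr)
qed

context rng begin

lemma local_algebra_mult:
  assumes "a \<in> carrier R" "x \<in> carrier R" "y \<in> carrier R"
  shows "(a \<otimes> x \<otimes> a) \<otimes>\<^bsub>local_algebra R a\<^esub> (a \<otimes> y \<otimes> a) = a \<otimes> x \<otimes> a \<otimes> y \<otimes> a"
proof -
  have "w = a \<otimes> x \<otimes> a \<otimes> y \<otimes> a"
    if "x' \<in> carrier R" "y' \<in> carrier R" "a \<otimes> x \<otimes> a = a \<otimes> x' \<otimes> a" "a \<otimes> y \<otimes> a = a \<otimes> y' \<otimes> a"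
      "w = a \<otimes> x' \<otimes> a \<otimes> y' \<otimes> a" for x' y' w
  proof -
    have "w = (a \<otimes> x \<otimes> a) \<otimes> y' \<otimes> a" by (simp only: that(3,5))
    also have "\<dots> = a \<otimes> x \<otimes> (a \<otimes> y' \<otimes> a)" using assms that(2) by (simp add: rng_m_assoc rng_m_closed)
    also have "\<dots> = a \<otimes> x \<otimes> (a \<otimes> y \<otimes> a)" by (simp only: that(4))
    also have "\<dots> = a \<otimes> x \<otimes> a \<otimes> y \<otimes> a" using assms by (simp add: rng_m_assoc rng_m_closed)
    finally show ?thesis .
  qed
  then have "(THE w. \<exists>x'\<in>carrier R. \<exists>y'\<in>carrier R. a \<otimes> x \<otimes> a = a \<otimes> x' \<otimes> a \<and>
      a \<otimes> y \<otimes> a = a \<otimes> y' \<otimes> a \<and> w = a \<otimes> x' \<otimes> a \<otimes> y' \<otimes> a) = a \<otimes> x \<otimes> a \<otimes> y \<otimes> a"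
    using assms(2,3) by (intro the_equality) blast+
  then show ?thesis by (simp add: local_algebra_def)
qed

text \<open>
  If \<open>a = aba\<close>, then \<open>ab\<close> is idempotent, and right multiplication by \<open>b\<close> turns \<open>axa\<close> into
  \<open>axab\<close>, which lies in the corner at \<open>ab\<close>; right multiplication by \<open>a\<close> undoes it. The product
  \<open>axaya\<close> of the local algebra becomes \<open>axab \<cdot> ayab\<close>.
\<close>

lemma corner_isomorphic_local_algebra:
  assumes a: "a \<in> carrier R" and b: "b \<in> carrier R" and aba: "a = a \<otimes> b \<otimes> a"
  shows "rng_isomorphic (corner R (a \<otimes> b)) (local_algebra R a)" and "rng (local_algebra R a)"
proof -
  let ?e = "a \<otimes> b"
  note cl = a b rng_m_closed
  have ea: "?e \<otimes> a = a" by (rule aba[symmetric])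
  have "?e \<otimes> ?e = ?e \<otimes> a \<otimes> b" using a b by (simp add: rng_m_assoc cl)
  then have "?e \<otimes> ?e = ?e" by (simp only: ea)
  then have e: "?e \<in> carrier R" "?e = ?e \<otimes> ?e"
    using a b by (simp_all only: rng_m_closed)
  define h where "h = (\<lambda>w. w \<otimes> a)"
  have c: "carrier (local_algebra R a) = {a \<otimes> x \<otimes> a | x. x \<in> carrier R}"
    by (simp add: local_algebra_def)
  have h: "h w \<in> carrier (local_algebra R a)" "h w \<otimes> b = w" if w: "w \<in> carrier (corner R ?e)" for w
  proof -
    obtain x where x: "x \<in> carrier R" "w = ?e \<otimes> x \<otimes> ?e" using w by (auto simp: corner_def)
    have "h w = a \<otimes> (b \<otimes> x) \<otimes> (?e \<otimes> a)" using x by (simp add: h_def rng_m_assoc cl)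
    then show "h w \<in> carrier (local_algebra R a)" using x by (auto simp: c ea cl)
    have "w \<otimes> ?e = w" using w corner_iff[OF e] by blast
    then show "h w \<otimes> b = w" using x by (simp add: h_def rng_m_assoc cl)
  qed
  have k: "v \<otimes> b \<in> carrier (corner R ?e)" "h (v \<otimes> b) = v" if v: "v \<in> carrier (local_algebra R a)" for v
  proof -
    obtain x where x: "x \<in> carrier R" "v = a \<otimes> x \<otimes> a" using v by (auto simp: c)
    have "v \<otimes> b \<in> carrier R" using x by (simp add: cl)
    moreover have "?e \<otimes> (v \<otimes> b) = (?e \<otimes> a) \<otimes> x \<otimes> a \<otimes> b" using x by (simp add: rng_m_assoc cl)
    then have "?e \<otimes> (v \<otimes> b) = v \<otimes> b" using x ea by simp
    moreover have "v \<otimes> b \<otimes> ?e = a \<otimes> x \<otimes> (?e \<otimes> a) \<otimes> b" using x by (simp add: rng_m_assoc cl)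
    then have "v \<otimes> b \<otimes> ?e = v \<otimes> b" using x ea by simp
    ultimately show "v \<otimes> b \<in> carrier (corner R ?e)" using corner_iff[OF e] by blast
    have "h (v \<otimes> b) = a \<otimes> x \<otimes> (?e \<otimes> a)" using x by (simp add: h_def rng_m_assoc cl)
    then show "h (v \<otimes> b) = v" using x ea by simp
  qed
  have "h \<in> rng_iso (corner R ?e) (local_algebra R a)"
    unfolding rng_iso_def
  proof (intro CollectI conjI ballI)
    show "bij_betw h (carrier (corner R ?e)) (carrier (local_algebra R a))"
      using h k by (intro bij_betw_byWitness[where f' = "\<lambda>v. v \<otimes> b"]) auto
  next
    fix u v assume u: "u \<in> carrier (corner R ?e)" and v: "v \<in> carrier (corner R ?e)"
    note uv = corner_closed[OF e(1) u] corner_closed[OF e(1) v]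
    show "h (u \<oplus>\<^bsub>corner R ?e\<^esub> v) = h u \<oplus>\<^bsub>local_algebra R a\<^esub> h v"
      using uv a by (simp add: h_def corner_def local_algebra_def rng_l_distr)
    obtain x y where x: "x \<in> carrier R" "h u = a \<otimes> x \<otimes> a" and y: "y \<in> carrier R" "h v = a \<otimes> y \<otimes> a"
      using h(1)[OF u] h(1)[OF v] by (auto simp: c)
    have "u \<otimes> v = (a \<otimes> x \<otimes> a \<otimes> b) \<otimes> (a \<otimes> y \<otimes> a \<otimes> b)"
      by (simp only: h(2)[OF u] h(2)[OF v] x(2)[symmetric] y(2)[symmetric])
    then have "h (u \<otimes> v) = a \<otimes> x \<otimes> (?e \<otimes> a) \<otimes> y \<otimes> (?e \<otimes> a)"
      using x y by (simp add: h_def rng_m_assoc cl)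
    then show "h (u \<otimes>\<^bsub>corner R ?e\<^esub> v) = h u \<otimes>\<^bsub>local_algebra R a\<^esub> h v"
      using x y ea a by (simp add: local_algebra_mult corner_def)
  qed
  moreover have "h \<zero>\<^bsub>corner R ?e\<^esub> = \<zero>\<^bsub>local_algebra R a\<^esub>"
    using a by (simp add: h_def corner_def local_algebra_def rng_l_null)
  ultimately show "rng_isomorphic (corner R ?e) (local_algebra R a)" "rng (local_algebra R a)"
    unfolding rng_isomorphic_def by (blast, rule rng_transport[OF rng_corner[OF e]])
qed

end

lemma ring_propertyD:
  assumes "ring_property P" "rng R" "rng S" "rng_isomorphic R S"
  shows "P R \<longleftrightarrow> P S"
proof -
  interpret rng R by fact
  have "rng_isomorphic S R"
    using rng_isomorphic_sym[OF assms(4)] rng_m_closed by simp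
  then show ?thesis using assms unfolding ring_property_def by blast
qed

lemma stable_by_corners_if_stable_by_local_algebras:
  assumes "ring_property P" "\<C> \<subseteq> {R. rng R}" and st: "stable_by_local_algebras \<C> P"
  shows "stable_by_corners \<C> P"
  unfolding stable_by_corners_def
proof
  fix R assume R: "R \<in> \<C>"
  then interpret R: rng R using assms by blast
  have *: "P (local_algebra R a) \<longleftrightarrow> P (corner R (a \<otimes>\<^bsub>R\<^esub> b))" and **: "a \<otimes>\<^bsub>R\<^esub> b \<in> carrier R"
    and ***: "a \<otimes>\<^bsub>R\<^esub> b = (a \<otimes>\<^bsub>R\<^esub> b) \<otimes>\<^bsub>R\<^esub> (a \<otimes>\<^bsub>R\<^esub> b)"
    if ab: "a \<in> carrier R" "b \<in> carrier R" "a = a \<otimes>\<^bsub>R\<^esub> b \<otimes>\<^bsub>R\<^esub> a" for a b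
  proof -
    show 1: "a \<otimes>\<^bsub>R\<^esub> b \<in> carrier R" using ab by (simp add: R.rng_m_closed)
    show 2: "a \<otimes>\<^bsub>R\<^esub> b = (a \<otimes>\<^bsub>R\<^esub> b) \<otimes>\<^bsub>R\<^esub> (a \<otimes>\<^bsub>R\<^esub> b)"
    proof -
      have "(a \<otimes>\<^bsub>R\<^esub> b) \<otimes>\<^bsub>R\<^esub> (a \<otimes>\<^bsub>R\<^esub> b) = (a \<otimes>\<^bsub>R\<^esub> b \<otimes>\<^bsub>R\<^esub> a) \<otimes>\<^bsub>R\<^esub> b"
        using ab(1,2) by (simp add: R.rng_m_assoc R.rng_m_closed)
      then show ?thesis unfolding ab(3)[symmetric] by (rule sym)
    qed
    show "P (local_algebra R a) \<longleftrightarrow> P (corner R (a \<otimes>\<^bsub>R\<^esub> b))"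
      using ring_propertyD[OF assms(1) R.rng_corner[OF 1 2] R.corner_isomorphic_local_algebra(2,1)[OF ab]]
      by (rule sym)
  qed
  have "(\<forall>a\<in>carrier R. von_neumann_regular R a \<longrightarrow> P (local_algebra R a)) \<longleftrightarrow>
        (\<forall>e\<in>carrier R. e = e \<otimes>\<^bsub>R\<^esub> e \<longrightarrow> P (corner R e))" (is "?l \<longleftrightarrow> ?r")
  proof
    assume l: ?l
    show ?r
    proof (intro ballI impI)
      fix e assume e: "e \<in> carrier R" "e = e \<otimes>\<^bsub>R\<^esub> e"
      have eee: "e = e \<otimes>\<^bsub>R\<^esub> e \<otimes>\<^bsub>R\<^esub> e" unfolding e(2)[symmetric] by (rule refl)
      then have "von_neumann_regular R e" unfolding von_neumann_regular_def using e(1) by blast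
      with l e(1) have "P (local_algebra R e)" by blast
      with *[OF e(1) e(1) eee] show "P (corner R e)" unfolding e(2)[symmetric] by (rule iffD1)
    qed
  next
    assume r: ?r
    show ?l
    proof (intro ballI impI)
      fix a assume a: "a \<in> carrier R" and "von_neumann_regular R a"
      then obtain b where b: "b \<in> carrier R" "a = a \<otimes>\<^bsub>R\<^esub> b \<otimes>\<^bsub>R\<^esub> a"
        unfolding von_neumann_regular_def by blast
      show "P (local_algebra R a)"
        using *[OF a b] bspec[OF r **[OF a b], THEN mp, OF ***[OF a b]] by (rule iffD2)
    qed
  qed
  then show "P R \<longleftrightarrow> (\<forall>e\<in>carrier R. e = e \<otimes>\<^bsub>R\<^esub> e \<longrightarrow> P (corner R e))"
    using st R unfolding stable_by_local_algebras_def by blast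
qed

section \<open>Unital nondegenerate modules\<close>

context left_module begin

lemma smult_r_null: "r \<in> carrier R \<Longrightarrow> r \<odot>\<^bsub>M\<^esub> \<zero>\<^bsub>M\<^esub> = \<zero>\<^bsub>M\<^esub>"
  by (metis M.add.l_cancel_one' M.l_zero M.zero_closed lm_smult_closed lm_smult_r_distr)

lemma smult_l_null: "m \<in> carrier M \<Longrightarrow> \<zero>\<^bsub>R\<^esub> \<odot>\<^bsub>M\<^esub> m = \<zero>\<^bsub>M\<^esub>"
  by (metis M.add.l_cancel_one' R.l_zero R.zero_closed lm_smult_closed lm_smult_l_distr)

lemma smult_r_minus:
  assumes "r \<in> carrier R" "m \<in> carrier M"
  shows "r \<odot>\<^bsub>M\<^esub> (\<ominus>\<^bsub>M\<^esub> m) = \<ominus>\<^bsub>M\<^esub> (r \<odot>\<^bsub>M\<^esub> m)"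
proof -
  have "r \<odot>\<^bsub>M\<^esub> (\<ominus>\<^bsub>M\<^esub> m) \<oplus>\<^bsub>M\<^esub> r \<odot>\<^bsub>M\<^esub> m = \<zero>\<^bsub>M\<^esub>"
    using assms by (simp add: lm_smult_r_distr[symmetric] M.l_neg smult_r_null)
  then show ?thesis using assms by (simp add: M.minus_equality lm_smult_closed)
qed

lemma smult_l_minus:
  assumes "r \<in> carrier R" "m \<in> carrier M"
  shows "(\<ominus>\<^bsub>R\<^esub> r) \<odot>\<^bsub>M\<^esub> m = \<ominus>\<^bsub>M\<^esub> (r \<odot>\<^bsub>M\<^esub> m)"
proof -
  have "(\<ominus>\<^bsub>R\<^esub> r) \<odot>\<^bsub>M\<^esub> m \<oplus>\<^bsub>M\<^esub> r \<odot>\<^bsub>M\<^esub> m = \<zero>\<^bsub>M\<^esub>"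
    using assms by (simp add: lm_smult_l_distr[symmetric] R.l_neg smult_l_null)
  then show ?thesis using assms by (simp add: M.minus_equality lm_smult_closed)
qed

lemma smult_finsum_r:
  assumes "finite A" "r \<in> carrier R" "f \<in> A \<rightarrow> carrier M"
  shows "r \<odot>\<^bsub>M\<^esub> finsum M f A = (\<Oplus>\<^bsub>M\<^esub>i\<in>A. r \<odot>\<^bsub>M\<^esub> f i)"
  using assms by (induction A) (auto simp: smult_r_null lm_smult_r_distr lm_smult_closed Pi_def)

lemma smult_finsum_l:
  assumes "finite A" "m \<in> carrier M" "f \<in> A \<rightarrow> carrier R"
  shows "finsum R f A \<odot>\<^bsub>M\<^esub> m = (\<Oplus>\<^bsub>M\<^esub>i\<in>A. f i \<odot>\<^bsub>M\<^esub> m)"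
  using assms by (induction A) (auto simp: smult_l_null lm_smult_l_distr lm_smult_closed Pi_def)

lemma smult_minus_distr:
  assumes "r \<in> carrier R" "x \<in> carrier M" "y \<in> carrier M"
  shows "r \<odot>\<^bsub>M\<^esub> (x \<ominus>\<^bsub>M\<^esub> y) = r \<odot>\<^bsub>M\<^esub> x \<ominus>\<^bsub>M\<^esub> r \<odot>\<^bsub>M\<^esub> y"
  using assms by (simp add: a_minus_def lm_smult_r_distr smult_r_minus)

end

lemma (in abelian_group) minus_eq_zero_iff:
  assumes "x \<in> carrier G" "y \<in> carrier G"
  shows "x \<ominus> y = \<zero> \<longleftrightarrow> x = y"
  using assms by (metis a_minus_def minus_equality minus_minus r_neg a_inv_closed)

lemma (in abelian_group) minus_swap:
  assumes "a \<in> carrier G" "b \<in> carrier G" "c \<in> carrier G" "d \<in> carrier G"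
  shows "(a \<oplus> b) \<ominus> (c \<oplus> d) = (a \<ominus> c) \<oplus> (b \<ominus> d)"
  using assms by (simp add: a_minus_def minus_add a_ac)

text \<open>
  In contrast to \<^const>\<open>module_homs\<close>, the carriers of the two modules may have different types, as
  happens for the map from a module to its quotient.
\<close>

definition linear_map ::
  "('a, 'k) ring_scheme \<Rightarrow> ('a, 'b, 'l) module_scheme \<Rightarrow> ('a, 'c, 'n) module_scheme \<Rightarrow> ('b \<Rightarrow> 'c) \<Rightarrow> bool" where
  "linear_map R M N f \<longleftrightarrow> f \<in> carrier M \<rightarrow> carrier N \<and>
     (\<forall>x\<in>carrier M. \<forall>y\<in>carrier M. f (x \<oplus>\<^bsub>M\<^esub> y) = f x \<oplus>\<^bsub>N\<^esub> f y) \<and>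
     (\<forall>r\<in>carrier R. \<forall>x\<in>carrier M. f (r \<odot>\<^bsub>M\<^esub> x) = r \<odot>\<^bsub>N\<^esub> f x)"

lemma linear_mapD:
  assumes "linear_map R M N f"
  shows "x \<in> carrier M \<Longrightarrow> f x \<in> carrier N"
    and "x \<in> carrier M \<Longrightarrow> y \<in> carrier M \<Longrightarrow> f (x \<oplus>\<^bsub>M\<^esub> y) = f x \<oplus>\<^bsub>N\<^esub> f y"
    and "r \<in> carrier R \<Longrightarrow> x \<in> carrier M \<Longrightarrow> f (r \<odot>\<^bsub>M\<^esub> x) = r \<odot>\<^bsub>N\<^esub> f x"
  using assms by (auto simp: linear_map_def)

lemma linear_map_null:
  assumes f: "linear_map R M N f" and "left_module R M" "left_module R N"
  shows "f \<zero>\<^bsub>M\<^esub> = \<zero>\<^bsub>N\<^esub>"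
proof -
  interpret M: left_module R M by fact
  interpret N: left_module R N by fact
  have "f \<zero>\<^bsub>M\<^esub> \<oplus>\<^bsub>N\<^esub> f \<zero>\<^bsub>M\<^esub> = f \<zero>\<^bsub>M\<^esub>" using linear_mapD(2)[OF f, of "\<zero>\<^bsub>M\<^esub>" "\<zero>\<^bsub>M\<^esub>"] by simp
  then show ?thesis using linear_mapD(1)[OF f, of "\<zero>\<^bsub>M\<^esub>"] N.M.add.l_cancel_one' by simp
qed

lemma linear_map_minus:
  assumes f: "linear_map R M N f" and "left_module R M" "left_module R N" and x: "x \<in> carrier M"
  shows "f (\<ominus>\<^bsub>M\<^esub> x) = \<ominus>\<^bsub>N\<^esub> f x"
proof -
  interpret M: left_module R M by fact
  interpret N: left_module R N by fact
  have "f (\<ominus>\<^bsub>M\<^esub> x) \<oplus>\<^bsub>N\<^esub> f x = \<zero>\<^bsub>N\<^esub>"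
    using x linear_mapD(2)[OF f, of "\<ominus>\<^bsub>M\<^esub> x" x] linear_map_null[OF assms(1-3)] by (simp add: M.M.l_neg)
  then show ?thesis using x linear_mapD(1)[OF f] by (simp add: N.M.minus_equality)
qed

lemma linear_map_finsum:
  assumes f: "linear_map R M N f" and "left_module R M" "left_module R N"
    and "finite A" "g \<in> A \<rightarrow> carrier M"
  shows "f (finsum M g A) = (\<Oplus>\<^bsub>N\<^esub>i\<in>A. f (g i))"
proof -
  interpret M: left_module R M by fact
  interpret N: left_module R N by fact
  show ?thesis
    using assms(4,5) by (induction A)
      (auto simp: linear_map_null[OF assms(1-3)] linear_mapD[OF f] Pi_def)
qed

lemma linear_map_restrict:
  assumes "left_module R M"
  shows "linear_map R M N (restrict f (carrier M)) \<longleftrightarrow> linear_map R M N f"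
proof -
  interpret M: left_module R M by fact
  show ?thesis by (auto simp: linear_map_def M.lm_smult_closed Pi_def)
qed

lemma module_homs_iff:
  "f \<in> module_homs R M N \<longleftrightarrow> linear_map R M N f \<and> f \<in> extensional (carrier M)"
  by (auto simp: module_homs_def linear_map_def PiE_def)

lemma module_homs_eqI:
  assumes "f \<in> module_homs R M N" "g \<in> module_homs R M N'" "\<And>x. x \<in> carrier M \<Longrightarrow> f x = g x"
  shows "f = g"
  using assms by (auto simp: module_homs_iff intro: extensionalityI)

lemma module_objD:
  assumes "M \<in> obj (module_category R)"
  shows "left_module R M" "unital_module R M" "nondegenerate_module R M"
  using assms by (auto simp: module_category_def)

lemma module_objI:
  assumes "left_module R M" "unital_module R M" "nondegenerate_module R M"
  shows "M \<in> obj (module_category R)"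
  using assms by (auto simp: module_category_def)

text \<open>
  The elements \<open>r\<close> with \<open>rx \<in> K\<close> form an additive subgroup of \<open>R\<close>, so it is enough that it
  contains all products, which generate \<open>R\<close>.
\<close>

lemma idempotent_smult_in_subgroup:
  assumes "idempotent_rng R" "left_module R M" and K: "subgroup K (add_monoid M)"
    and x: "x \<in> carrier M" and r: "r \<in> carrier R"
    and prod: "\<And>a b. a \<in> carrier R \<Longrightarrow> b \<in> carrier R \<Longrightarrow> a \<odot>\<^bsub>M\<^esub> (b \<odot>\<^bsub>M\<^esub> x) \<in> K"
  shows "r \<odot>\<^bsub>M\<^esub> x \<in> K"
proof -
  interpret left_module R M by fact
  let ?P = "{x \<otimes>\<^bsub>R\<^esub> y | x y. x \<in> carrier R \<and> y \<in> carrier R}"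
  have gen: "generate (add_monoid R) ?P = carrier R"
    using assms(1) by (simp add: idempotent_rng_def)
  have P: "h \<in> carrier R" "h \<odot>\<^bsub>M\<^esub> x \<in> K" if "h \<in> ?P" for h
    using that x prod by (auto simp: R.rng_m_closed lm_smult_assoc)
  from r have "r \<in> generate (add_monoid R) ?P" using gen by simp
  then show ?thesis
  proof (induction rule: generate.induct)
    case one
    show ?case using subgroup.one_closed[OF K] x by (simp add: smult_l_null)
  next
    case (incl h)
    then show ?case by (rule P)
  next
    case (inv h)
    have "\<ominus>\<^bsub>M\<^esub> (h \<odot>\<^bsub>M\<^esub> x) \<in> K"
      using subgroup.m_inv_closed[OF K P(2)[OF inv]] by (simp add: a_inv_def)
    then show ?case using smult_l_minus[OF P(1)[OF inv] x] by (simp add: a_inv_def)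
  next
    case (eng h k)
    then have "h \<in> carrier R" "k \<in> carrier R" using gen by auto
    then show ?case using eng subgroup.m_closed[OF K] x by (simp add: lm_smult_l_distr)
  qed
qed

text \<open>
  The quotient of a module by a submodule \<open>K\<close>, realized on a prescribed type by an injection \<open>j\<close>:
  a coset is represented by the image under \<open>j\<close> of a chosen element. The last hypothesis
  on \<open>K\<close> says that the quotient is nondegenerate.
\<close>

lemma quotient_module:
  fixes M :: "('a, 'b, 'l) module_scheme" and j :: "'b \<Rightarrow> 'm"
  assumes "left_module R M" "unital_module R M" and j: "inj_on j (carrier M)"
    and K: "subgroup K (add_monoid M)"
    and K_smult: "\<forall>r\<in>carrier R. \<forall>x\<in>K. r \<odot>\<^bsub>M\<^esub> x \<in> K"
    and K_sat: "\<forall>x\<in>carrier M. (\<forall>r\<in>carrier R. r \<odot>\<^bsub>M\<^esub> x \<in> K) \<longrightarrow> x \<in> K"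
  shows "\<exists>(N :: ('a, 'm) module) \<kappa>. N \<in> obj (module_category R) \<and> linear_map R M N \<kappa> \<and>
    \<kappa> ` carrier M = carrier N \<and> (\<forall>x\<in>carrier M. \<forall>y\<in>carrier M. \<kappa> x = \<kappa> y \<longleftrightarrow> x \<ominus>\<^bsub>M\<^esub> y \<in> K)"
proof -
  interpret left_module R M by fact
  interpret K: subgroup K "add_monoid M" by fact
  have Kc: "x \<in> carrier M" if "x \<in> K" for x using that K.subset by auto
  have K_add: "x \<oplus>\<^bsub>M\<^esub> y \<in> K" if "x \<in> K" "y \<in> K" for x y using K.m_closed[OF that] by simp
  have K_zero: "\<zero>\<^bsub>M\<^esub> \<in> K" using K.one_closed by simp
  have K_neg: "\<ominus>\<^bsub>M\<^esub> x \<in> K" if "x \<in> K" for x using K.m_inv_closed[OF that] by (simp add: a_inv_def)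
  let ?cong = "\<lambda>x y. y \<in> carrier M \<and> x \<ominus>\<^bsub>M\<^esub> y \<in> K"
  define \<kappa> where "\<kappa> x = j (SOME y. ?cong x y)" for x
  have K_refl: "x \<ominus>\<^bsub>M\<^esub> x \<in> K" if "x \<in> carrier M" for x
    using that K_zero by (simp add: a_minus_def M.r_neg)
  have K_sym: "y \<ominus>\<^bsub>M\<^esub> x \<in> K" if "x \<in> carrier M" "y \<in> carrier M" "x \<ominus>\<^bsub>M\<^esub> y \<in> K" for x y
    using K_neg[OF that(3)] that(1,2) by (simp add: a_minus_def M.minus_add M.a_comm)
  have K_trans: "x \<ominus>\<^bsub>M\<^esub> z \<in> K" if "x \<in> carrier M" "y \<in> carrier M" "z \<in> carrier M"
      "x \<ominus>\<^bsub>M\<^esub> y \<in> K" "y \<ominus>\<^bsub>M\<^esub> z \<in> K" for x y z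
  proof -
    have "(x \<ominus>\<^bsub>M\<^esub> y) \<oplus>\<^bsub>M\<^esub> (y \<ominus>\<^bsub>M\<^esub> z) = x \<ominus>\<^bsub>M\<^esub> z"
      using that(1-3) by (simp add: a_minus_def M.a_assoc) (simp add: M.a_assoc[symmetric] M.l_neg)
    then show ?thesis using K_add[OF that(4,5)] by simp
  qed
  have \<kappa>_iff: "\<kappa> x = \<kappa> y \<longleftrightarrow> x \<ominus>\<^bsub>M\<^esub> y \<in> K" if x: "x \<in> carrier M" and y: "y \<in> carrier M" for x y
  proof
    have x': "?cong x (SOME z. ?cong x z)" by (rule someI[of _ x]) (simp add: x K_refl)
    have y': "?cong y (SOME z. ?cong y z)" by (rule someI[of _ y]) (simp add: y K_refl)
    assume "\<kappa> x = \<kappa> y"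
    then have "(SOME z. ?cong x z) = (SOME z. ?cong y z)"
      using x' y' j unfolding \<kappa>_def by (auto dest: inj_onD)
    with x' y' have "?cong x (SOME z. ?cong y z)" by simp
    then show "x \<ominus>\<^bsub>M\<^esub> y \<in> K" using K_trans[OF x _ y] K_sym[OF y] y' by blast
  next
    assume "x \<ominus>\<^bsub>M\<^esub> y \<in> K"
    then have "?cong x z \<longleftrightarrow> ?cong y z" for z using K_trans[of x y z] K_trans[of y x z] K_sym[of x y] x y by blast
    then show "\<kappa> x = \<kappa> y" by (simp add: \<kappa>_def)
  qed
  define l where "l = inv_into (carrier M) \<kappa>"
  have l: "l u \<in> carrier M" "\<kappa> (l u) = u" if "u \<in> \<kappa> ` carrier M" for u
    using that by (simp_all add: l_def inv_into_into f_inv_into_f)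
  define N :: "('a, 'm) module" where "N = \<lparr>carrier = \<kappa> ` carrier M, monoid.mult = undefined,
    one = undefined, zero = \<kappa> \<zero>\<^bsub>M\<^esub>, add = (\<lambda>u v. \<kappa> (l u \<oplus>\<^bsub>M\<^esub> l v)), smult = (\<lambda>r u. \<kappa> (r \<odot>\<^bsub>M\<^esub> l u))\<rparr>"
  have Nc: "carrier N = \<kappa> ` carrier M" and Nz: "\<zero>\<^bsub>N\<^esub> = \<kappa> \<zero>\<^bsub>M\<^esub>" by (simp_all add: N_def)
  have l_cong: "l (\<kappa> x) \<in> carrier M" "l (\<kappa> x) \<ominus>\<^bsub>M\<^esub> x \<in> K" if "x \<in> carrier M" for x
    using l[of "\<kappa> x"] that \<kappa>_iff by auto
  have Na: "\<kappa> x \<oplus>\<^bsub>N\<^esub> \<kappa> y = \<kappa> (x \<oplus>\<^bsub>M\<^esub> y)" if x: "x \<in> carrier M" and y: "y \<in> carrier M" for x y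
  proof -
    have "(l (\<kappa> x) \<oplus>\<^bsub>M\<^esub> l (\<kappa> y)) \<ominus>\<^bsub>M\<^esub> (x \<oplus>\<^bsub>M\<^esub> y) \<in> K"
      using l_cong[OF x] l_cong[OF y] x y K_add by (simp add: M.minus_swap)
    then show ?thesis using \<kappa>_iff l_cong[OF x] l_cong[OF y] x y by (simp add: N_def)
  qed
  have Ns: "r \<odot>\<^bsub>N\<^esub> \<kappa> x = \<kappa> (r \<odot>\<^bsub>M\<^esub> x)" if r: "r \<in> carrier R" and x: "x \<in> carrier M" for r x
  proof -
    have "r \<odot>\<^bsub>M\<^esub> l (\<kappa> x) \<ominus>\<^bsub>M\<^esub> r \<odot>\<^bsub>M\<^esub> x \<in> K"
      using bspec[OF bspec[OF K_smult r] l_cong(2)[OF x]] l_cong[OF x] x r by (simp add: smult_minus_distr)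
    then show ?thesis using \<kappa>_iff l_cong[OF x] x r by (simp add: N_def lm_smult_closed)
  qed
  interpret N: abelian_group N
  proof (rule abelian_groupI)
    fix x assume "x \<in> carrier N"
    then obtain a where a: "x = \<kappa> a" "a \<in> carrier M" by (auto simp: Nc)
    then show "\<exists>y\<in>carrier N. y \<oplus>\<^bsub>N\<^esub> x = \<zero>\<^bsub>N\<^esub>"
      by (intro bexI[of _ "\<kappa> (\<ominus>\<^bsub>M\<^esub> a)"]) (auto simp: Nc Na Nz M.l_neg)
  next
    fix x y assume "x \<in> carrier N" "y \<in> carrier N"
    then show "x \<oplus>\<^bsub>N\<^esub> y = y \<oplus>\<^bsub>N\<^esub> x" by (auto simp: Nc Na M.a_comm)
  qed (auto simp: Nc Na Nz M.a_assoc)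
  have "left_module R N"
    by unfold_locales
      (auto simp: Nc Na Ns lm_smult_closed lm_smult_l_distr lm_smult_r_distr lm_smult_assoc R.rng_m_closed)
  moreover have "unital_module R N"
    unfolding unital_module_def
  proof -
    let ?A = "{r \<odot>\<^bsub>M\<^esub> m | r m. r \<in> carrier R \<and> m \<in> carrier M}"
    have "generate (add_monoid N) (\<kappa> ` ?A) = carrier N"
    proof (rule generate_rng_iso[OF M.abelian_group_axioms N.abelian_group_axioms])
      show "\<kappa> (x \<oplus>\<^bsub>M\<^esub> y) = \<kappa> x \<oplus>\<^bsub>N\<^esub> \<kappa> y" if "x \<in> carrier M" "y \<in> carrier M" for x y
        using Na[OF that] by (rule sym)
      show "?A \<subseteq> carrier M" by (auto simp: lm_smult_closed)
      show "generate (add_monoid M) ?A = carrier M"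
        using assms(2) unfolding unital_module_def .
    qed (rule Nc[symmetric])
    moreover have "\<kappa> ` ?A = {r \<odot>\<^bsub>N\<^esub> m | r m. r \<in> carrier R \<and> m \<in> carrier N}" (is "?L = ?R")
    proof
      show "?L \<subseteq> ?R" by (auto simp: Nc) (metis Ns imageI)
      show "?R \<subseteq> ?L" by (auto simp: Nc Ns intro!: imageI) blast
    qed
    ultimately show "generate (add_monoid N) {r \<odot>\<^bsub>N\<^esub> m | r m. r \<in> carrier R \<and> m \<in> carrier N} = carrier N"
      by simp
  qed
  moreover have "nondegenerate_module R N"
    unfolding nondegenerate_module_def
  proof (intro ballI impI)
    fix u assume u: "u \<in> carrier N" and *: "\<forall>r\<in>carrier R. r \<odot>\<^bsub>N\<^esub> u = \<zero>\<^bsub>N\<^esub>"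
    then obtain x where x: "u = \<kappa> x" "x \<in> carrier M" by (auto simp: Nc)
    have in_K: "\<kappa> y = \<kappa> \<zero>\<^bsub>M\<^esub> \<longleftrightarrow> y \<in> K" if "y \<in> carrier M" for y
    proof -
      have "\<ominus>\<^bsub>M\<^esub> \<zero>\<^bsub>M\<^esub> = \<zero>\<^bsub>M\<^esub>" by (rule M.minus_equality) simp_all
      then have "y \<ominus>\<^bsub>M\<^esub> \<zero>\<^bsub>M\<^esub> = y" using that by (simp add: a_minus_def)
      then show ?thesis using that by (simp add: \<kappa>_iff)
    qed
    have "x \<in> K"
    proof (rule K_sat[rule_format, OF x(2)])
      fix r assume r: "r \<in> carrier R"
      then have "\<kappa> (r \<odot>\<^bsub>M\<^esub> x) = \<kappa> \<zero>\<^bsub>M\<^esub>" using * x by (simp add: Ns Nz)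
      then show "r \<odot>\<^bsub>M\<^esub> x \<in> K" using in_K r x by (simp add: lm_smult_closed)
    qed
    then show "u = \<zero>\<^bsub>N\<^esub>" using in_K x by (simp add: Nz)
  qed
  ultimately show ?thesis
    using \<kappa>_iff
    by (intro exI[of _ N] exI[of _ \<kappa>] conjI module_objI) (auto simp: linear_map_def Nc Na Ns)
qed

text \<open>
  For a left ideal \<open>L = RL\<close>, let \<open>Q\<close> be the quotient of \<open>L\<close> by the elements that \<open>R\<close> annihilates.
  A nondegenerate module does not see the difference: every \<open>y \<in> N\<close> yields the linear map
  \<open>l \<mapsto> ly\<close> from \<open>L\<close> to \<open>N\<close>, and it factors through \<open>Q\<close>, as \<open>Rl = 0\<close> implies \<open>R(ly) = 0\<close>.
\<close>

lemma left_ideal_module: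
  fixes R :: "'a ring" and j :: "'a \<Rightarrow> 'm"
  assumes "idempotent_rng R" and L: "subgroup L (add_monoid R)"
    and L_ideal: "\<forall>r\<in>carrier R. \<forall>x\<in>L. r \<otimes>\<^bsub>R\<^esub> x \<in> L"
    and gen: "generate (add_monoid R) {r \<otimes>\<^bsub>R\<^esub> x | r x. r \<in> carrier R \<and> x \<in> L} = L"
    and j: "inj j"
  shows "\<exists>(Q :: ('a, 'm) module) \<kappa>. Q \<in> obj (module_category R) \<and> \<kappa> ` L = carrier Q \<and>
    (\<forall>x\<in>L. \<forall>y\<in>L. \<kappa> (x \<oplus>\<^bsub>R\<^esub> y) = \<kappa> x \<oplus>\<^bsub>Q\<^esub> \<kappa> y) \<and>
    (\<forall>r\<in>carrier R. \<forall>x\<in>L. \<kappa> (r \<otimes>\<^bsub>R\<^esub> x) = r \<odot>\<^bsub>Q\<^esub> \<kappa> x) \<and>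
    (\<forall>x\<in>L. \<forall>y\<in>L. \<kappa> x = \<kappa> y \<longleftrightarrow> (\<forall>r\<in>carrier R. r \<otimes>\<^bsub>R\<^esub> x = r \<otimes>\<^bsub>R\<^esub> y)) \<and>
    (\<forall>(N :: ('a, 'm) module)\<in>obj (module_category R). \<forall>y\<in>carrier N.
       \<exists>f\<in>module_homs R Q N. \<forall>x\<in>L. f (\<kappa> x) = x \<odot>\<^bsub>N\<^esub> y)"
proof -
  interpret R: rng R using assms(1) by (simp add: idempotent_rng_def)
  interpret L: subgroup L "add_monoid R" by fact
  note L_mult = bspec[OF bspec[OF L_ideal]]
  have Lc: "x \<in> carrier R" if "x \<in> L" for x using that L.subset by auto
  have L_add: "x \<oplus>\<^bsub>R\<^esub> y \<in> L" if "x \<in> L" "y \<in> L" for x y using L.m_closed[OF that] by simp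
  have L_zero: "\<zero>\<^bsub>R\<^esub> \<in> L" using L.one_closed by simp
  have L_neg: "\<ominus>\<^bsub>R\<^esub> x \<in> L" if "x \<in> L" for x using L.m_inv_closed[OF that] by (simp add: a_inv_def)
  define M :: "('a, 'a) module" where "M = \<lparr>carrier = L, monoid.mult = undefined, one = undefined,
    zero = \<zero>\<^bsub>R\<^esub>, add = (\<lambda>x y. x \<oplus>\<^bsub>R\<^esub> y), smult = (\<lambda>x y. x \<otimes>\<^bsub>R\<^esub> y)\<rparr>"
  have M: "carrier M = L" "\<zero>\<^bsub>M\<^esub> = \<zero>\<^bsub>R\<^esub>" "x \<oplus>\<^bsub>M\<^esub> y = x \<oplus>\<^bsub>R\<^esub> y" "x \<odot>\<^bsub>M\<^esub> y = x \<otimes>\<^bsub>R\<^esub> y" for x y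
    by (simp_all add: M_def)
  interpret MG: abelian_group M
  proof (rule abelian_groupI)
    fix x assume "x \<in> carrier M"
    then show "\<exists>y\<in>carrier M. y \<oplus>\<^bsub>M\<^esub> x = \<zero>\<^bsub>M\<^esub>"
      using L_neg Lc by (intro bexI[of _ "\<ominus>\<^bsub>R\<^esub> x"]) (auto simp: M R.l_neg)
  qed (auto simp: M L_add L_zero Lc R.a_ac)
  interpret M: left_module R M
    by unfold_locales (auto simp: M L_mult Lc R.rng_m_assoc R.rng_l_distr R.rng_r_distr)
  have Mneg: "\<ominus>\<^bsub>M\<^esub> x = \<ominus>\<^bsub>R\<^esub> x" if "x \<in> L" for x
    by (rule MG.minus_equality) (use that L_neg Lc in \<open>auto simp: M R.l_neg\<close>)
  let ?L = "R\<lparr>carrier := L\<rparr>"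
  have L_group: "abelian_group ?L"
  proof (rule abelian_groupI)
    fix x assume "x \<in> carrier ?L"
    then show "\<exists>y\<in>carrier ?L. y \<oplus>\<^bsub>?L\<^esub> x = \<zero>\<^bsub>?L\<^esub>"
      using L_neg Lc by (intro bexI[of _ "\<ominus>\<^bsub>R\<^esub> x"]) (auto simp: R.l_neg)
  qed (auto simp: L_add L_zero Lc R.a_ac)
  have sub: "{r \<otimes>\<^bsub>R\<^esub> x | r x. r \<in> carrier R \<and> x \<in> L} \<subseteq> L" using L_mult by auto
  have "generate (add_monoid ?L) {r \<otimes>\<^bsub>R\<^esub> x | r x. r \<in> carrier R \<and> x \<in> L} = L"
    using R.add.generate_consistent[OF sub L] gen by simp
  then have "generate (add_monoid M) ((\<lambda>x. x) ` {r \<otimes>\<^bsub>R\<^esub> x | r x. r \<in> carrier R \<and> x \<in> L}) = carrier M"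
    using generate_rng_iso[OF L_group MG.abelian_group_axioms, of "\<lambda>x. x"] sub by (simp add: M)
  then have "unital_module R M"
    by (simp add: unital_module_def M)
  define K where "K = {x \<in> L. \<forall>r\<in>carrier R. r \<otimes>\<^bsub>R\<^esub> x = \<zero>\<^bsub>R\<^esub>}"
  have rneg: "r \<otimes>\<^bsub>R\<^esub> (\<ominus>\<^bsub>R\<^esub> x) = \<ominus>\<^bsub>R\<^esub> (r \<otimes>\<^bsub>R\<^esub> x)" if "r \<in> carrier R" "x \<in> L" for r x
    using M.smult_r_minus[of r x] that L_mult by (simp add: M Mneg)
  have K_subgroup: "subgroup K (add_monoid M)"
  proof (rule MG.add.subgroupI)
    show "K \<subseteq> carrier M" by (auto simp: K_def M)
    show "K \<noteq> {}" using L_zero R.rng_r_null by (auto simp: K_def)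
    show "\<ominus>\<^bsub>M\<^esub> x \<in> K" if "x \<in> K" for x
      using that Mneg[of x] MG.minus_equality[of "\<zero>\<^bsub>M\<^esub>" "\<zero>\<^bsub>M\<^esub>"]
        Mneg[OF L_zero] by (simp add: K_def L_neg rneg M L_zero)
    show "x \<oplus>\<^bsub>M\<^esub> y \<in> K" if "x \<in> K" "y \<in> K" for x y
      using that by (simp add: K_def M L_add R.rng_r_distr Lc)
  qed
  have K_sat: "\<forall>x\<in>carrier M. (\<forall>r\<in>carrier R. r \<odot>\<^bsub>M\<^esub> x \<in> K) \<longrightarrow> x \<in> K"
  proof (intro ballI impI)
    fix x assume x: "x \<in> carrier M" and *: "\<forall>r\<in>carrier R. r \<odot>\<^bsub>M\<^esub> x \<in> K"
    have "r \<odot>\<^bsub>M\<^esub> x \<in> {\<zero>\<^bsub>M\<^esub>}" if r: "r \<in> carrier R" for r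
    proof (rule idempotent_smult_in_subgroup[OF assms(1) M.left_module_axioms _ x r])
      show "subgroup {\<zero>\<^bsub>M\<^esub>} (add_monoid M)" using MG.add.triv_subgroup by simp
      show "a \<odot>\<^bsub>M\<^esub> (b \<odot>\<^bsub>M\<^esub> x) \<in> {\<zero>\<^bsub>M\<^esub>}" if "a \<in> carrier R" "b \<in> carrier R" for a b
        using bspec[OF * that(2)] that(1) by (simp add: K_def M)
    qed
    then show "x \<in> K" using x by (auto simp: K_def M)
  qed
  have K_smult: "\<forall>r\<in>carrier R. \<forall>x\<in>K. r \<odot>\<^bsub>M\<^esub> x \<in> K"
    by (simp add: K_def M R.rng_r_null L_zero)
  have j': "inj_on j (carrier M)" using j by (rule inj_on_subset) simp
  obtain Q :: "('a, 'm) module" and \<kappa> where Q: "Q \<in> obj (module_category R)"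
    and lin: "linear_map R M Q \<kappa>" and im: "\<kappa> ` carrier M = carrier Q"
    and iff: "\<And>x y. x \<in> carrier M \<Longrightarrow> y \<in> carrier M \<Longrightarrow> \<kappa> x = \<kappa> y \<longleftrightarrow> x \<ominus>\<^bsub>M\<^esub> y \<in> K"
    using quotient_module[OF M.left_module_axioms \<open>unital_module R M\<close> j' K_subgroup K_smult K_sat] by blast
  have iff': "\<kappa> x = \<kappa> y \<longleftrightarrow> (\<forall>r\<in>carrier R. r \<otimes>\<^bsub>R\<^esub> x = r \<otimes>\<^bsub>R\<^esub> y)" if xy: "x \<in> L" "y \<in> L" for x y
  proof -
    have "r \<otimes>\<^bsub>R\<^esub> (x \<ominus>\<^bsub>R\<^esub> y) = \<zero>\<^bsub>R\<^esub> \<longleftrightarrow> r \<otimes>\<^bsub>R\<^esub> x = r \<otimes>\<^bsub>R\<^esub> y" if "r \<in> carrier R" for r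
      using that xy Lc rneg
      by (simp add: a_minus_def R.rng_r_distr) (simp add: R.minus_eq_zero_iff R.rng_m_closed flip: a_minus_def)
    then show ?thesis
      using iff[of x y] xy L_add L_neg by (auto simp: K_def M Mneg a_minus_def)
  qed
  have ex: "\<exists>f\<in>module_homs R Q N. \<forall>x\<in>L. f (\<kappa> x) = x \<odot>\<^bsub>N\<^esub> y"
    if N: "N \<in> obj (module_category R)" and y: "y \<in> carrier N" for N :: "('a, 'm) module" and y
  proof -
    interpret N: left_module R N using module_objD(1)[OF N] .
    have wd: "x \<odot>\<^bsub>N\<^esub> y = x' \<odot>\<^bsub>N\<^esub> y" if x: "x \<in> L" "x' \<in> L" and eq: "\<kappa> x = \<kappa> x'" for x x'
    proof -
      have cl: "x \<odot>\<^bsub>N\<^esub> y \<in> carrier N" "x' \<odot>\<^bsub>N\<^esub> y \<in> carrier N" using x y Lc N.lm_smult_closed by auto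
      have "r \<odot>\<^bsub>N\<^esub> (x \<odot>\<^bsub>N\<^esub> y \<ominus>\<^bsub>N\<^esub> x' \<odot>\<^bsub>N\<^esub> y) = \<zero>\<^bsub>N\<^esub>" if r: "r \<in> carrier R" for r
      proof -
        have "r \<odot>\<^bsub>N\<^esub> (x \<odot>\<^bsub>N\<^esub> y) = r \<odot>\<^bsub>N\<^esub> (x' \<odot>\<^bsub>N\<^esub> y)"
          using eq iff'[OF x] r x y Lc by (simp flip: N.lm_smult_assoc)
        then show ?thesis
          using r cl by (simp add: N.smult_minus_distr N.M.minus_eq_zero_iff N.lm_smult_closed)
      qed
      then have "x \<odot>\<^bsub>N\<^esub> y \<ominus>\<^bsub>N\<^esub> x' \<odot>\<^bsub>N\<^esub> y = \<zero>\<^bsub>N\<^esub>"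
        using module_objD(3)[OF N] cl unfolding nondegenerate_module_def by simp
      then show ?thesis using cl by (simp add: N.M.minus_eq_zero_iff)
    qed
    define f where "f = restrict (\<lambda>u. inv_into L \<kappa> u \<odot>\<^bsub>N\<^esub> y) (carrier Q)"
    have Qc: "carrier Q = \<kappa> ` L" using im by (simp add: M)
    have f: "f (\<kappa> x) = x \<odot>\<^bsub>N\<^esub> y" if "x \<in> L" for x
      using wd[of "inv_into L \<kappa> (\<kappa> x)" x] that by (simp add: f_def Qc inv_into_into f_inv_into_f)
    have "linear_map R Q N f"
      unfolding linear_map_def
    proof (intro conjI ballI)
      show "f \<in> carrier Q \<rightarrow> carrier N" using y Lc N.lm_smult_closed by (auto simp: Qc f)
      show "f (u \<oplus>\<^bsub>Q\<^esub> v) = f u \<oplus>\<^bsub>N\<^esub> f v" if uv: "u \<in> carrier Q" "v \<in> carrier Q" for u v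
      proof -
        obtain a b where ab: "u = \<kappa> a" "v = \<kappa> b" "a \<in> L" "b \<in> L" using uv by (auto simp: Qc)
        then have "u \<oplus>\<^bsub>Q\<^esub> v = \<kappa> (a \<oplus>\<^bsub>R\<^esub> b)" using linear_mapD(2)[OF lin] by (simp add: M)
        then show ?thesis using ab y Lc L_add by (simp add: f N.lm_smult_l_distr)
      qed
      show "f (r \<odot>\<^bsub>Q\<^esub> u) = r \<odot>\<^bsub>N\<^esub> f u" if ru: "r \<in> carrier R" "u \<in> carrier Q" for r u
      proof -
        obtain a where a: "u = \<kappa> a" "a \<in> L" using ru by (auto simp: Qc)
        then have "r \<odot>\<^bsub>Q\<^esub> u = \<kappa> (r \<otimes>\<^bsub>R\<^esub> a)" using linear_mapD(3)[OF lin] that by (simp add: M)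
        then show ?thesis using a y Lc L_mult that by (simp add: f N.lm_smult_assoc)
      qed
    qed
    then have "f \<in> module_homs R Q N" by (simp add: module_homs_iff f_def)
    then show ?thesis using f by blast
  qed
  show ?thesis
    using Q iff' ex im linear_mapD(2,3)[OF lin]
    by (intro exI[of _ Q] exI[of _ \<kappa>]) (simp add: M)
qed

section \<open>Fully faithful functors\<close>

definition is_category :: "('o, 'f) category \<Rightarrow> bool" where
  "is_category \<C> \<longleftrightarrow>
     (\<forall>X\<in>obj \<C>. ident \<C> X \<in> mor \<C> X X) \<and>
     (\<forall>X\<in>obj \<C>. \<forall>Y\<in>obj \<C>. \<forall>Z\<in>obj \<C>. \<forall>f\<in>mor \<C> X Y. \<forall>g\<in>mor \<C> Y Z.
        comp \<C> X Y Z g f \<in> mor \<C> X Z) \<and>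
     (\<forall>X\<in>obj \<C>. \<forall>Y\<in>obj \<C>. \<forall>f\<in>mor \<C> X Y.
        comp \<C> X X Y f (ident \<C> X) = f \<and> comp \<C> X Y Y (ident \<C> Y) f = f) \<and>
     (\<forall>W\<in>obj \<C>. \<forall>X\<in>obj \<C>. \<forall>Y\<in>obj \<C>. \<forall>Z\<in>obj \<C>.
        \<forall>f\<in>mor \<C> W X. \<forall>g\<in>mor \<C> X Y. \<forall>h\<in>mor \<C> Y Z.
        comp \<C> W X Z (comp \<C> X Y Z h g) f = comp \<C> W Y Z h (comp \<C> W X Y g f))"

lemma is_categoryD:
  assumes "is_category \<C>"
  shows "X \<in> obj \<C> \<Longrightarrow> ident \<C> X \<in> mor \<C> X X"
    and "X \<in> obj \<C> \<Longrightarrow> Y \<in> obj \<C> \<Longrightarrow> Z \<in> obj \<C> \<Longrightarrow> f \<in> mor \<C> X Y \<Longrightarrow> g \<in> mor \<C> Y Z \<Longrightarrow>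
      comp \<C> X Y Z g f \<in> mor \<C> X Z"
    and "X \<in> obj \<C> \<Longrightarrow> Y \<in> obj \<C> \<Longrightarrow> f \<in> mor \<C> X Y \<Longrightarrow> comp \<C> X X Y f (ident \<C> X) = f"
    and "X \<in> obj \<C> \<Longrightarrow> Y \<in> obj \<C> \<Longrightarrow> f \<in> mor \<C> X Y \<Longrightarrow> comp \<C> X Y Y (ident \<C> Y) f = f"
    and "W \<in> obj \<C> \<Longrightarrow> X \<in> obj \<C> \<Longrightarrow> Y \<in> obj \<C> \<Longrightarrow> Z \<in> obj \<C> \<Longrightarrow>
      f \<in> mor \<C> W X \<Longrightarrow> g \<in> mor \<C> X Y \<Longrightarrow> h \<in> mor \<C> Y Z \<Longrightarrow>
      comp \<C> W X Z (comp \<C> X Y Z h g) f = comp \<C> W Y Z h (comp \<C> W X Y g f)"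
  using assms unfolding is_category_def by blast+

lemma isomorphism_in_cancel_left:
  assumes C: "is_category \<C>" and ob: "X \<in> obj \<C>" "Y \<in> obj \<C>" "Z \<in> obj \<C>"
    and h: "isomorphism_in \<C> Y Z h" and f: "f \<in> mor \<C> X Y" and g: "g \<in> mor \<C> X Y"
    and eq: "comp \<C> X Y Z h f = comp \<C> X Y Z h g"
  shows "f = g"
proof -
  obtain k where k: "k \<in> mor \<C> Z Y" "comp \<C> Y Z Y k h = ident \<C> Y" and h: "h \<in> mor \<C> Y Z"
    using h by (auto simp: isomorphism_in_def)
  have "comp \<C> X Z Y k (comp \<C> X Y Z h a) = a" if "a \<in> mor \<C> X Y" for a
    using is_categoryD(5)[OF C ob(1,2,3,2) that h k(1)] is_categoryD(4)[OF C ob(1,2) that] k(2) by simp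
  then show ?thesis using f g eq by metis
qed

lemma isomorphism_in_cancel_right:
  assumes C: "is_category \<C>" and ob: "X \<in> obj \<C>" "Y \<in> obj \<C>" "Z \<in> obj \<C>"
    and h: "isomorphism_in \<C> X Y h" and f: "f \<in> mor \<C> Y Z" and g: "g \<in> mor \<C> Y Z"
    and eq: "comp \<C> X Y Z f h = comp \<C> X Y Z g h"
  shows "f = g"
proof -
  obtain k where k: "k \<in> mor \<C> Y X" "comp \<C> Y X Y h k = ident \<C> Y" and h: "h \<in> mor \<C> X Y"
    using h by (auto simp: isomorphism_in_def)
  have "comp \<C> Y X Z (comp \<C> X Y Z a h) k = a" if "a \<in> mor \<C> Y Z" for a
    using is_categoryD(5)[OF C ob(2,1,2,3) k(1) h that] is_categoryD(3)[OF C ob(2,3) that] k(2) by simp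
  then show ?thesis using f g eq by metis
qed

definition fully_faithful ::
  "('o, 'f) category \<Rightarrow> ('p, 'g) category \<Rightarrow> ('o, 'f, 'p, 'g) functor_data \<Rightarrow> bool" where
  "fully_faithful \<C> \<D> F \<longleftrightarrow> (\<forall>X\<in>obj \<C>. \<forall>Y\<in>obj \<C>.
     bij_betw (fmor F X Y) (mor \<C> X Y) (mor \<D> (fobj F X) (fobj F Y)))"

text \<open>
  Naturality of \<open>\<eta>\<close> recovers \<open>f\<close> from \<open>GFf\<close> by conjugation with \<open>\<eta>\<close>, so \<open>F\<close> is faithful, and
  so is \<open>G\<close> by the same argument. A morphism \<open>k : FX \<rightarrow> FY\<close> comes from the conjugate \<open>f\<close> of
  \<open>Gk\<close>, as \<open>GFf = Gk\<close>.
\<close>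

lemma equivalence_fully_faithful:
  assumes C: "is_category \<C>" and D: "is_category \<D>" and "equivalent_categories \<C> \<D>"
  shows "\<exists>F. is_functor \<C> \<D> F \<and> fully_faithful \<C> \<D> F \<and>
    (\<forall>Z\<in>obj \<D>. \<exists>X\<in>obj \<C>. \<exists>i. isomorphism_in \<D> (fobj F X) Z i)"
proof -
  obtain F G where F: "is_functor \<C> \<D> F" and G: "is_functor \<D> \<C> G"
    and GF: "naturally_isomorphic \<C> \<C> id_functor (comp_functor G F)"
    and FG: "naturally_isomorphic \<D> \<D> (comp_functor F G) id_functor"
    using assms(3) unfolding equivalent_categories_def by blast
  obtain \<eta> where \<eta>: "\<And>X. X \<in> obj \<C> \<Longrightarrow> isomorphism_in \<C> X (fobj G (fobj F X)) (\<eta> X)"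
    and \<eta>n: "\<And>X Y f. X \<in> obj \<C> \<Longrightarrow> Y \<in> obj \<C> \<Longrightarrow> f \<in> mor \<C> X Y \<Longrightarrow>
        comp \<C> X Y (fobj G (fobj F Y)) (\<eta> Y) f =
        comp \<C> X (fobj G (fobj F X)) (fobj G (fobj F Y))
          (fmor G (fobj F X) (fobj F Y) (fmor F X Y f)) (\<eta> X)"
    using GF unfolding naturally_isomorphic_def id_functor_def comp_functor_def functor_data.simps
    by (elim exE conjE) blast
  obtain \<epsilon> where \<epsilon>: "\<And>X. X \<in> obj \<D> \<Longrightarrow> isomorphism_in \<D> (fobj F (fobj G X)) X (\<epsilon> X)"
    and \<epsilon>n: "\<And>X Y f. X \<in> obj \<D> \<Longrightarrow> Y \<in> obj \<D> \<Longrightarrow> f \<in> mor \<D> X Y \<Longrightarrow>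
        comp \<D> (fobj F (fobj G X)) (fobj F (fobj G Y)) Y (\<epsilon> Y)
          (fmor F (fobj G X) (fobj G Y) (fmor G X Y f)) =
        comp \<D> (fobj F (fobj G X)) X Y f (\<epsilon> X)"
    using FG unfolding naturally_isomorphic_def id_functor_def comp_functor_def functor_data.simps
    by (elim exE conjE) blast
  have Fo: "fobj F X \<in> obj \<D>" if "X \<in> obj \<C>" for X
    using F that by (simp add: is_functor_def)
  have Go: "fobj G X \<in> obj \<C>" if "X \<in> obj \<D>" for X
    using G that by (simp add: is_functor_def)
  have Fm: "fmor F X Y f \<in> mor \<D> (fobj F X) (fobj F Y)" if "X \<in> obj \<C>" "Y \<in> obj \<C>" "f \<in> mor \<C> X Y" for X Y f
    using F that by (simp add: is_functor_def)
  have Gm: "fmor G X Y f \<in> mor \<C> (fobj G X) (fobj G Y)" if "X \<in> obj \<D>" "Y \<in> obj \<D>" "f \<in> mor \<D> X Y" for X Y f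
    using G that by (simp add: is_functor_def)
  have F_inj: "f = g" if X: "X \<in> obj \<C>" and Y: "Y \<in> obj \<C>" and fg: "f \<in> mor \<C> X Y" "g \<in> mor \<C> X Y"
    and eq: "fmor F X Y f = fmor F X Y g" for X Y f g
    using \<eta>n[OF X Y fg(1)] \<eta>n[OF X Y fg(2)] eq
    by (intro isomorphism_in_cancel_left[OF C X Y Go[OF Fo[OF Y]] \<eta>[OF Y] fg]) simp
  have G_inj: "f = g" if X: "X \<in> obj \<D>" and Y: "Y \<in> obj \<D>" and fg: "f \<in> mor \<D> X Y" "g \<in> mor \<D> X Y"
    and eq: "fmor G X Y f = fmor G X Y g" for X Y f g
    using \<epsilon>n[OF X Y fg(1)] \<epsilon>n[OF X Y fg(2)] eq
    by (intro isomorphism_in_cancel_right[OF D Fo[OF Go[OF X]] X Y \<epsilon>[OF X] fg]) simp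
  have F_surj: "\<exists>f\<in>mor \<C> X Y. fmor F X Y f = k"
    if X: "X \<in> obj \<C>" and Y: "Y \<in> obj \<C>" and k: "k \<in> mor \<D> (fobj F X) (fobj F Y)" for X Y k
  proof -
    let ?X = "fobj G (fobj F X)" and ?Y = "fobj G (fobj F Y)"
    let ?k = "fmor G (fobj F X) (fobj F Y) k"
    note X' = Go[OF Fo[OF X]] and Y' = Go[OF Fo[OF Y]]
    have k': "?k \<in> mor \<C> ?X ?Y" using Gm Fo X Y k by blast
    obtain \<theta> where \<theta>: "\<theta> \<in> mor \<C> ?Y Y" "comp \<C> ?Y Y ?Y (\<eta> Y) \<theta> = ident \<C> ?Y"
      and \<eta>Y: "\<eta> Y \<in> mor \<C> Y ?Y"
      using \<eta>[OF Y] by (auto simp: isomorphism_in_def)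
    have \<eta>X: "\<eta> X \<in> mor \<C> X ?X" using \<eta>[OF X] by (auto simp: isomorphism_in_def)
    define f where "f = comp \<C> X ?Y Y \<theta> (comp \<C> X ?X ?Y ?k (\<eta> X))"
    have k\<eta>: "comp \<C> X ?X ?Y ?k (\<eta> X) \<in> mor \<C> X ?Y"
      by (rule is_categoryD(2)[OF C X X' Y' \<eta>X k'])
    have f: "f \<in> mor \<C> X Y"
      unfolding f_def by (rule is_categoryD(2)[OF C X Y' Y k\<eta> \<theta>(1)])
    have "comp \<C> X Y ?Y (\<eta> Y) f = comp \<C> X ?X ?Y ?k (\<eta> X)"
      unfolding f_def
      using is_categoryD(5)[OF C X Y' Y Y' k\<eta> \<theta>(1) \<eta>Y] \<theta>(2) is_categoryD(4)[OF C X Y' k\<eta>] by simp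
    then have "fmor G (fobj F X) (fobj F Y) (fmor F X Y f) = ?k"
      using \<eta>n[OF X Y f] Gm[OF Fo[OF X] Fo[OF Y] Fm[OF X Y f]] k'
      by (intro isomorphism_in_cancel_right[OF C X X' Y' \<eta>[OF X], of _ ?k]) simp_all
    then have "fmor F X Y f = k"
      by (rule G_inj[OF Fo[OF X] Fo[OF Y] Fm[OF X Y f] k])
    with f show ?thesis by blast
  qed
  have "fully_faithful \<C> \<D> F"
    unfolding fully_faithful_def bij_betw_def inj_on_def
  proof (intro ballI conjI impI)
    fix X Y assume XY: "X \<in> obj \<C>" "Y \<in> obj \<C>"
    show "fmor F X Y ` mor \<C> X Y = mor \<D> (fobj F X) (fobj F Y)"
    proof
      show "fmor F X Y ` mor \<C> X Y \<subseteq> mor \<D> (fobj F X) (fobj F Y)" using Fm[OF XY] by blast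
      show "mor \<D> (fobj F X) (fobj F Y) \<subseteq> fmor F X Y ` mor \<C> X Y" using F_surj[OF XY] by blast
    qed
  qed (rule F_inj)
  moreover have "\<exists>X\<in>obj \<C>. \<exists>i. isomorphism_in \<D> (fobj F X) Z i" if "Z \<in> obj \<D>" for Z
    using \<epsilon>[OF that] Go[OF that] by blast
  ultimately show ?thesis using F by blast
qed

section \<open>Functors between module categories\<close>

lemma module_category_simps:
  "mor (module_category R) = module_homs R"
  "ident (module_category R) M = restrict (\<lambda>x. x) (carrier M)"
  "comp (module_category R) L M N g f = compose (carrier L) g f"
  by (simp_all add: module_category_def id_def)

lemma linear_map_compose:
  assumes "left_module R L" "linear_map R L M f" "linear_map R M N g"
  shows "linear_map R L N (compose (carrier L) g f)"
proof -
  interpret left_module R L by fact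
  show ?thesis
    using assms(2,3) by (auto simp: linear_map_def compose_def lm_smult_closed Pi_def)
qed

lemma module_homs_compose:
  assumes "L \<in> obj (module_category R)" "f \<in> module_homs R L M" "g \<in> module_homs R M N"
  shows "compose (carrier L) g f \<in> module_homs R L N"
  using linear_map_compose[OF module_objD(1)[OF assms(1)], of M f N g] assms(2,3)
  by (simp add: module_homs_iff)

lemma module_homs_id:
  assumes "M \<in> obj (module_category R)"
  shows "restrict (\<lambda>x. x) (carrier M) \<in> module_homs R M M"
  using module_objD(1)[OF assms]
  by (simp add: module_homs_iff linear_map_restrict) (simp add: linear_map_def)

lemma is_category_module_category: "is_category (module_category R)"
proof -
  have "compose (carrier X) f (restrict (\<lambda>x. x) (carrier X)) = f"
    "compose (carrier X) (restrict (\<lambda>x. x) (carrier Y)) f = f" if "f \<in> module_homs R X Y" for X Y f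
    using that
    by (auto simp: module_homs_iff linear_map_def compose_def Pi_def restrict_def extensional_def fun_eq_iff)
  moreover have "compose (carrier W) (compose (carrier X) h g) f = compose (carrier W) h (compose (carrier W) g f)"
    if "f \<in> module_homs R W X" for W X f h g
    using that by (auto simp: module_homs_iff linear_map_def compose_def Pi_def)
  ultimately show ?thesis
    unfolding is_category_def module_category_simps
    by (auto simp: module_homs_compose module_homs_id)
qed

lemma fully_faithful_modulesD:
  assumes "fully_faithful (module_category R) (module_category S) F"
    and "X \<in> obj (module_category R)" "Y \<in> obj (module_category R)"
  shows "inj_on (fmor F X Y) (module_homs R X Y)"
    and "k \<in> module_homs S (fobj F X) (fobj F Y) \<Longrightarrow> \<exists>f\<in>module_homs R X Y. fmor F X Y f = k"
proof -
  have bij: "bij_betw (fmor F X Y) (module_homs R X Y) (module_homs S (fobj F X) (fobj F Y))"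
    using assms by (simp add: fully_faithful_def module_category_simps)
  then show "inj_on (fmor F X Y) (module_homs R X Y)" by (simp add: bij_betw_def)
  show "\<exists>f\<in>module_homs R X Y. fmor F X Y f = k" if "k \<in> module_homs S (fobj F X) (fobj F Y)"
    using that unfolding bij_betw_imp_surj_on[OF bij, symmetric] by blast
qed

definition hom_add :: "('a, 'b, 'l) module_scheme \<Rightarrow> ('a, 'c, 'n) module_scheme \<Rightarrow> ('b \<Rightarrow> 'c) \<Rightarrow> ('b \<Rightarrow> 'c) \<Rightarrow> 'b \<Rightarrow> 'c" where
  "hom_add M N f g = restrict (\<lambda>x. f x \<oplus>\<^bsub>N\<^esub> g x) (carrier M)"

definition hom_zero :: "('a, 'b, 'l) module_scheme \<Rightarrow> ('a, 'c, 'n) module_scheme \<Rightarrow> 'b \<Rightarrow> 'c" where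
  "hom_zero M N = restrict (\<lambda>x. \<zero>\<^bsub>N\<^esub>) (carrier M)"

lemma hom_add_in_homs:
  assumes "M \<in> obj (module_category R)" "N \<in> obj (module_category R)"
    and "f \<in> module_homs R M N" "g \<in> module_homs R M N"
  shows "hom_add M N f g \<in> module_homs R M N"
proof -
  interpret M: left_module R M using module_objD(1)[OF assms(1)] .
  interpret N: left_module R N using module_objD(1)[OF assms(2)] .
  have f: "linear_map R M N f" and g: "linear_map R M N g" using assms by (auto simp: module_homs_iff)
  show ?thesis
    unfolding module_homs_iff hom_add_def linear_map_restrict[OF M.left_module_axioms]
    by (auto simp: linear_map_def linear_mapD[OF f] linear_mapD[OF g] N.M.a_ac N.lm_smult_r_distr)
qed

lemma hom_zero_in_homs:
  assumes "M \<in> obj (module_category R)" "N \<in> obj (module_category R)"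
  shows "hom_zero M N \<in> module_homs R M N"
proof -
  interpret M: left_module R M using module_objD(1)[OF assms(1)] .
  interpret N: left_module R N using module_objD(1)[OF assms(2)] .
  show ?thesis
    unfolding module_homs_iff hom_zero_def linear_map_restrict[OF M.left_module_axioms]
    by (auto simp: linear_map_def N.smult_r_null)
qed

text \<open>
  The module \<open>Y \<oplus> Y\<close> consists of pairs; since \<^typ>\<open>'m\<close> is infinite, it has a copy on \<^typ>\<open>'m\<close>
  itself.
\<close>

lemma biproduct:
  fixes Y :: "('a, 'm) module"
  assumes "infinite (UNIV :: 'm set)" and Y: "Y \<in> obj (module_category R)"
  obtains B :: "('a, 'm) module" and i1 i2 p1 p2 where "B \<in> obj (module_category R)"
    and "i1 \<in> module_homs R Y B" "i2 \<in> module_homs R Y B"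
    and "p1 \<in> module_homs R B Y" "p2 \<in> module_homs R B Y"
    and "\<And>y. y \<in> carrier Y \<Longrightarrow> p1 (i1 y) = y" "\<And>y. y \<in> carrier Y \<Longrightarrow> p2 (i1 y) = \<zero>\<^bsub>Y\<^esub>"
    and "\<And>y. y \<in> carrier Y \<Longrightarrow> p1 (i2 y) = \<zero>\<^bsub>Y\<^esub>" "\<And>y. y \<in> carrier Y \<Longrightarrow> p2 (i2 y) = y"
    and "\<And>b. b \<in> carrier B \<Longrightarrow> i1 (p1 b) \<oplus>\<^bsub>B\<^esub> i2 (p2 b) = b"
proof -
  interpret Y: left_module R Y using module_objD(1)[OF Y] .
  obtain j :: "'m \<times> 'm \<Rightarrow> 'm" where j: "inj j"
    using ordIso_imp_ordLeq[OF card_of_Times_same_infinite[OF assms(1)]]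
    by (auto simp: card_of_ordLeq[symmetric])
  define M :: "('a, 'm \<times> 'm) module" where "M = \<lparr>carrier = carrier Y \<times> carrier Y,
    monoid.mult = undefined, one = undefined, zero = (\<zero>\<^bsub>Y\<^esub>, \<zero>\<^bsub>Y\<^esub>),
    add = (\<lambda>u v. (fst u \<oplus>\<^bsub>Y\<^esub> fst v, snd u \<oplus>\<^bsub>Y\<^esub> snd v)),
    smult = (\<lambda>r u. (r \<odot>\<^bsub>Y\<^esub> fst u, r \<odot>\<^bsub>Y\<^esub> snd u))\<rparr>"
  have Mc: "carrier M = carrier Y \<times> carrier Y" and Mz: "\<zero>\<^bsub>M\<^esub> = (\<zero>\<^bsub>Y\<^esub>, \<zero>\<^bsub>Y\<^esub>)"
    and Ma: "(a, b) \<oplus>\<^bsub>M\<^esub> (c, d) = (a \<oplus>\<^bsub>Y\<^esub> c, b \<oplus>\<^bsub>Y\<^esub> d)"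
    and Ms: "r \<odot>\<^bsub>M\<^esub> (a, b) = (r \<odot>\<^bsub>Y\<^esub> a, r \<odot>\<^bsub>Y\<^esub> b)" for a b c d r
    by (simp_all add: M_def)
  interpret MG: abelian_group M
  proof (rule abelian_groupI)
    fix x assume "x \<in> carrier M"
    then show "\<exists>y\<in>carrier M. y \<oplus>\<^bsub>M\<^esub> x = \<zero>\<^bsub>M\<^esub>"
      by (intro bexI[of _ "(\<ominus>\<^bsub>Y\<^esub> fst x, \<ominus>\<^bsub>Y\<^esub> snd x)"]) (auto simp: Mc Ma Mz Y.M.l_neg)
  qed (auto simp: Mc Ma Mz Y.M.a_ac)
  interpret M: left_module R M
    by unfold_locales
      (auto simp: Mc Ma Ms Y.lm_smult_closed Y.lm_smult_l_distr Y.lm_smult_r_distr Y.lm_smult_assoc)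
  let ?A = "{r \<odot>\<^bsub>Y\<^esub> y | r y. r \<in> carrier R \<and> y \<in> carrier Y}"
  let ?B = "{r \<odot>\<^bsub>M\<^esub> y | r y. r \<in> carrier R \<and> y \<in> carrier M}"
  have gen: "generate (add_monoid Y) ?A = carrier Y"
    using module_objD(2)[OF Y] by (simp add: unital_module_def)
  have Asub: "?A \<subseteq> carrier (add_monoid Y)" using Y.lm_smult_closed by auto
  have Bsub: "?B \<subseteq> carrier M" using M.lm_smult_closed by auto
  have emb: "h ` carrier Y \<subseteq> generate (add_monoid M) ?B"
    if h: "h \<in> carrier Y \<rightarrow> carrier M" "\<And>x y. x \<in> carrier Y \<Longrightarrow> y \<in> carrier Y \<Longrightarrow> h (x \<oplus>\<^bsub>Y\<^esub> y) = h x \<oplus>\<^bsub>M\<^esub> h y"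
      "\<And>r y. r \<in> carrier R \<Longrightarrow> y \<in> carrier Y \<Longrightarrow> h (r \<odot>\<^bsub>Y\<^esub> y) = r \<odot>\<^bsub>M\<^esub> h y" for h
  proof -
    interpret h: group_hom "add_monoid Y" "add_monoid M" h
      using h by unfold_locales (auto simp: hom_def)
    have "h ` carrier Y = generate (add_monoid M) (h ` ?A)"
      using h.generate_img[OF Asub] gen by simp
    also have "\<dots> \<subseteq> generate (add_monoid M) ?B"
    proof (intro MG.add.mono_generate image_subsetI)
      fix x assume "x \<in> ?A"
      then obtain r y where "x = r \<odot>\<^bsub>Y\<^esub> y" "r \<in> carrier R" "y \<in> carrier Y" by blast
      then have "h x = r \<odot>\<^bsub>M\<^esub> h y" "r \<in> carrier R" "h y \<in> carrier M" using h by auto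
      then show "h x \<in> ?B" by blast
    qed
    finally show ?thesis .
  qed
  have "carrier M \<subseteq> generate (add_monoid M) ?B"
  proof
    fix u assume "u \<in> carrier M"
    then obtain a b where u: "u = (a, b)" "a \<in> carrier Y" "b \<in> carrier Y" by (auto simp: Mc)
    have "(a, \<zero>\<^bsub>Y\<^esub>) \<in> generate (add_monoid M) ?B" "(\<zero>\<^bsub>Y\<^esub>, b) \<in> generate (add_monoid M) ?B"
      using emb[of "\<lambda>a. (a, \<zero>\<^bsub>Y\<^esub>)"] emb[of "\<lambda>b. (\<zero>\<^bsub>Y\<^esub>, b)"] u by (auto simp: Mc Ma Ms Y.smult_r_null)
    from generate.eng[OF this] show "u \<in> generate (add_monoid M) ?B" using u by (simp add: Ma)
  qed
  then have "unital_module R M"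
    using MG.add.generate_incl[OF Bsub] by (auto simp: unital_module_def)
  moreover have "inj_on j (carrier M)" using j by (rule inj_on_subset) simp
  moreover have "subgroup {\<zero>\<^bsub>M\<^esub>} (add_monoid M)" using MG.add.triv_subgroup by simp
  moreover have "\<forall>r\<in>carrier R. \<forall>x\<in>{\<zero>\<^bsub>M\<^esub>}. r \<odot>\<^bsub>M\<^esub> x \<in> {\<zero>\<^bsub>M\<^esub>}"
    using M.smult_r_null by simp
  moreover have "\<forall>x\<in>carrier M. (\<forall>r\<in>carrier R. r \<odot>\<^bsub>M\<^esub> x \<in> {\<zero>\<^bsub>M\<^esub>}) \<longrightarrow> x \<in> {\<zero>\<^bsub>M\<^esub>}"
    using module_objD(3)[OF Y] by (auto simp: nondegenerate_module_def Mc Ms Mz)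
  ultimately have "\<exists>(B :: ('a, 'm) module) \<kappa>. B \<in> obj (module_category R) \<and> linear_map R M B \<kappa> \<and>
      \<kappa> ` carrier M = carrier B \<and> (\<forall>x\<in>carrier M. \<forall>y\<in>carrier M. \<kappa> x = \<kappa> y \<longleftrightarrow> x \<ominus>\<^bsub>M\<^esub> y \<in> {\<zero>\<^bsub>M\<^esub>})"
    by (rule quotient_module[OF M.left_module_axioms])
  then obtain B :: "('a, 'm) module" and \<kappa> where B: "B \<in> obj (module_category R)"
    and lin: "linear_map R M B \<kappa>" and im: "\<kappa> ` carrier M = carrier B"
    and inj: "\<And>x y. x \<in> carrier M \<Longrightarrow> y \<in> carrier M \<Longrightarrow> \<kappa> x = \<kappa> y \<longleftrightarrow> x = y"
    by (auto simp: MG.minus_eq_zero_iff)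
  interpret B: left_module R B using module_objD(1)[OF B] .
  define l where "l = inv_into (carrier M) \<kappa>"
  have l: "l (\<kappa> x) = x" if "x \<in> carrier M" for x
    using that inj unfolding l_def by (intro inv_into_f_f) (auto simp: inj_on_def)
  have lB: "l b \<in> carrier M" "\<kappa> (l b) = b" if "b \<in> carrier B" for b
    using that unfolding im[symmetric] l_def by (rule inv_into_into, rule f_inv_into_f)
  have l_add: "l (b \<oplus>\<^bsub>B\<^esub> c) = l b \<oplus>\<^bsub>M\<^esub> l c" if "b \<in> carrier B" "c \<in> carrier B" for b c
    using l[of "l b \<oplus>\<^bsub>M\<^esub> l c"] lB that linear_mapD(2)[OF lin] by simp
  have l_smult: "l (r \<odot>\<^bsub>B\<^esub> b) = r \<odot>\<^bsub>M\<^esub> l b" if "r \<in> carrier R" "b \<in> carrier B" for r b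
    using l[of "r \<odot>\<^bsub>M\<^esub> l b"] lB that linear_mapD(3)[OF lin] M.lm_smult_closed by simp
  define i1 where "i1 = restrict (\<lambda>y. \<kappa> (y, \<zero>\<^bsub>Y\<^esub>)) (carrier Y)"
  define i2 where "i2 = restrict (\<lambda>y. \<kappa> (\<zero>\<^bsub>Y\<^esub>, y)) (carrier Y)"
  define p1 where "p1 = restrict (\<lambda>b. fst (l b)) (carrier B)"
  define p2 where "p2 = restrict (\<lambda>b. snd (l b)) (carrier B)"
  have \<kappa>: "\<kappa> x \<in> carrier B" if "x \<in> carrier M" for x using im that by blast
  have \<kappa>_add: "\<kappa> (a, b) \<oplus>\<^bsub>B\<^esub> \<kappa> (c, d) = \<kappa> (a \<oplus>\<^bsub>Y\<^esub> c, b \<oplus>\<^bsub>Y\<^esub> d)"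
    if "a \<in> carrier Y" "b \<in> carrier Y" "c \<in> carrier Y" "d \<in> carrier Y" for a b c d
    using linear_mapD(2)[OF lin, of "(a, b)" "(c, d)"] that by (simp add: Mc Ma)
  have \<kappa>_smult: "r \<odot>\<^bsub>B\<^esub> \<kappa> (a, b) = \<kappa> (r \<odot>\<^bsub>Y\<^esub> a, r \<odot>\<^bsub>Y\<^esub> b)"
    if "r \<in> carrier R" "a \<in> carrier Y" "b \<in> carrier Y" for r a b
    using linear_mapD(3)[OF lin, of r "(a, b)"] that by (simp add: Mc Ms)
  have "i1 \<in> module_homs R Y B" "i2 \<in> module_homs R Y B"
    unfolding module_homs_iff i1_def i2_def linear_map_restrict[OF Y.left_module_axioms]
    by (auto simp: linear_map_def \<kappa> \<kappa>_add \<kappa>_smult Mc Y.smult_r_null)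
  moreover have "p1 \<in> module_homs R B Y" "p2 \<in> module_homs R B Y"
    unfolding module_homs_iff p1_def p2_def linear_map_restrict[OF B.left_module_axioms]
    using lB(1) by (auto simp: linear_map_def l_add l_smult Mc M_def mem_Times_iff)
  moreover have "i1 (p1 b) \<oplus>\<^bsub>B\<^esub> i2 (p2 b) = b" if b: "b \<in> carrier B" for b
    using lB[OF b] b by (auto simp: i1_def i2_def p1_def p2_def Mc \<kappa>_add mem_Times_iff)
  ultimately show ?thesis
    using B by (intro that[of B i1 i2 p1 p2]) (auto simp: i1_def i2_def p1_def p2_def \<kappa> l Mc)
qed

lemma functor_compose:
  assumes "is_functor (module_category R) (module_category S) F"
    and "X \<in> obj (module_category R)" "Y \<in> obj (module_category R)" "Z \<in> obj (module_category R)"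
    and "f \<in> module_homs R X Y" "g \<in> module_homs R Y Z"
  shows "fmor F X Z (compose (carrier X) g f) =
    compose (carrier (fobj F X)) (fmor F Y Z g) (fmor F X Y f)"
  using assms by (simp add: is_functor_def module_category_simps)

text \<open>
  A fully faithful functor preserves zero morphisms, because these are the \<open>z : X \<rightarrow> Y\<close> with
  \<open>zk = zk'\<close> for all endomorphisms \<open>k, k'\<close> of \<open>X\<close>.
\<close>

lemma fully_faithful_zero:
  assumes F: "is_functor (module_category R) (module_category S) F"
    and ff: "fully_faithful (module_category R) (module_category S) F"
    and X: "X \<in> obj (module_category R)" and Y: "Y \<in> obj (module_category R)"
  shows "fmor F X Y (hom_zero X Y) = hom_zero (fobj F X) (fobj F Y)"
proof -
  have FX: "fobj F X \<in> obj (module_category S)" and FY: "fobj F Y \<in> obj (module_category S)"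
    using F X Y by (auto simp: is_functor_def)
  let ?z = "hom_zero X Y"
  have z: "?z \<in> module_homs R X Y" by (rule hom_zero_in_homs[OF X Y])
  have Fz: "fmor F X Y ?z \<in> module_homs S (fobj F X) (fobj F Y)"
    using F X Y z by (auto simp: is_functor_def module_category_simps)
  obtain k where k: "k \<in> module_homs R X X" "fmor F X X k = hom_zero (fobj F X) (fobj F X)"
    using fully_faithful_modulesD(2)[OF ff X X hom_zero_in_homs[OF FX FX]] by blast
  have "compose (carrier X) ?z k = ?z"
    using k by (auto simp: compose_def hom_zero_def module_homs_iff linear_map_def Pi_def)
  then have "fmor F X Y ?z = compose (carrier (fobj F X)) (fmor F X Y ?z) (hom_zero (fobj F X) (fobj F X))"
    using functor_compose[OF F X X Y k(1) z] k(2) by simp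
  from fun_cong[OF this]
  have "fmor F X Y ?z x = fmor F X Y ?z \<zero>\<^bsub>fobj F X\<^esub>" if "x \<in> carrier (fobj F X)" for x
    using that by (simp add: compose_def hom_zero_def split: if_splits)
  moreover have "fmor F X Y ?z \<zero>\<^bsub>fobj F X\<^esub> = \<zero>\<^bsub>fobj F Y\<^esub>"
    using Fz linear_map_null module_objD(1)[OF FX] module_objD(1)[OF FY] by (auto simp: module_homs_iff)
  ultimately show ?thesis
    by (intro module_homs_eqI[OF Fz hom_zero_in_homs[OF FX FY]]) (auto simp: hom_zero_def)
qed

text \<open>
  Addition of morphisms \<open>X \<rightarrow> Y\<close> can be expressed by composition through the biproduct \<open>Y \<oplus> Y\<close>:
  \<open>f + g\<close> is \<open>(f, g) : X \<rightarrow> Y \<oplus> Y\<close> followed by the codiagonal. The functor sends the biproduct to a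
  biproduct, since \<open>F(i\<^sub>1)F(p\<^sub>1) + F(i\<^sub>2)F(p\<^sub>2)\<close> is \<open>F(v)\<close> for some \<open>v\<close> by fullness, and
  \<open>p\<^sub>1v = p\<^sub>1\<close> and \<open>p\<^sub>2v = p\<^sub>2\<close> by faithfulness.
\<close>

lemma fully_faithful_add:
  fixes F :: "(('a, 'm) module, 'm \<Rightarrow> 'm, ('b, 'n) module, 'n \<Rightarrow> 'n) functor_data"
  assumes inf: "infinite (UNIV :: 'm set)"
    and F: "is_functor (module_category R) (module_category S) F"
    and ff: "fully_faithful (module_category R) (module_category S) F"
    and X: "X \<in> obj (module_category R)" and Y: "Y \<in> obj (module_category R)"
    and f: "f \<in> module_homs R X Y" and g: "g \<in> module_homs R X Y"
  shows "fmor F X Y (hom_add X Y f g) = hom_add (fobj F X) (fobj F Y) (fmor F X Y f) (fmor F X Y g)"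
proof -
  have Fo: "fobj F Z \<in> obj (module_category S)" if "Z \<in> obj (module_category R)" for Z
    using F that by (auto simp: is_functor_def)
  have Fm: "fmor F Z W h \<in> module_homs S (fobj F Z) (fobj F W)"
    if "Z \<in> obj (module_category R)" "W \<in> obj (module_category R)" "h \<in> module_homs R Z W" for Z W h
    using F that by (auto simp: is_functor_def module_category_simps)
  have Fcl: "fmor F Z W h x \<in> carrier (fobj F W)"
    if "Z \<in> obj (module_category R)" "W \<in> obj (module_category R)" "h \<in> module_homs R Z W"
      "x \<in> carrier (fobj F Z)" for Z W h x
    using Fm[OF that(1-3)] that(4) linear_mapD(1) by (auto simp: module_homs_iff)
  have Fadd: "fmor F Z W h (x \<oplus>\<^bsub>fobj F Z\<^esub> y) = fmor F Z W h x \<oplus>\<^bsub>fobj F W\<^esub> fmor F Z W h y"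
    if "Z \<in> obj (module_category R)" "W \<in> obj (module_category R)" "h \<in> module_homs R Z W"
      "x \<in> carrier (fobj F Z)" "y \<in> carrier (fobj F Z)" for Z W h x y
    using Fm[OF that(1-3)] that(4,5) linear_mapD(2) by (auto simp: module_homs_iff)
  have Fcomp: "fmor F V Z (compose (carrier V) k h) x = fmor F W Z k (fmor F V W h x)"
    if "V \<in> obj (module_category R)" "W \<in> obj (module_category R)" "Z \<in> obj (module_category R)"
      "h \<in> module_homs R V W" "k \<in> module_homs R W Z" "x \<in> carrier (fobj F V)" for V W Z h k x
    using functor_compose[OF F that(1-5)] that(6) by (simp add: compose_def)
  have Fid: "fmor F Z Z (restrict (\<lambda>x. x) (carrier Z)) x = x"
    if "Z \<in> obj (module_category R)" "x \<in> carrier (fobj F Z)" for Z x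
    using F that by (auto simp: is_functor_def module_category_simps)
  have Fzero: "fmor F Z W (hom_zero Z W) x = \<zero>\<^bsub>fobj F W\<^esub>"
    if "Z \<in> obj (module_category R)" "W \<in> obj (module_category R)" "x \<in> carrier (fobj F Z)" for Z W x
    using fully_faithful_zero[OF F ff that(1,2)] that(3) by (simp add: hom_zero_def)
  have ev: "h x \<in> carrier W"
    if "h \<in> module_homs R Z W" "x \<in> carrier Z" for h x and Z W :: "('a, 'm) module"
    using that linear_mapD by (auto simp: module_homs_iff)
  have ev_add: "h (x \<oplus>\<^bsub>Z\<^esub> y) = h x \<oplus>\<^bsub>W\<^esub> h y"
    if "h \<in> module_homs R Z W" "x \<in> carrier Z" "y \<in> carrier Z" for h x y and Z W :: "('a, 'm) module"
    using that linear_mapD by (auto simp: module_homs_iff)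
  interpret X: left_module R X using module_objD(1)[OF X] .
  interpret Y: left_module R Y using module_objD(1)[OF Y] .
  interpret FY: left_module S "fobj F Y" using module_objD(1)[OF Fo[OF Y]] .
  obtain B :: "('a, 'm) module" and i1 i2 p1 p2 where B: "B \<in> obj (module_category R)"
    and i: "i1 \<in> module_homs R Y B" "i2 \<in> module_homs R Y B"
    and p: "p1 \<in> module_homs R B Y" "p2 \<in> module_homs R B Y"
    and pi: "\<And>y. y \<in> carrier Y \<Longrightarrow> p1 (i1 y) = y" "\<And>y. y \<in> carrier Y \<Longrightarrow> p2 (i1 y) = \<zero>\<^bsub>Y\<^esub>"
      "\<And>y. y \<in> carrier Y \<Longrightarrow> p1 (i2 y) = \<zero>\<^bsub>Y\<^esub>" "\<And>y. y \<in> carrier Y \<Longrightarrow> p2 (i2 y) = y"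
    and ip: "\<And>b. b \<in> carrier B \<Longrightarrow> i1 (p1 b) \<oplus>\<^bsub>B\<^esub> i2 (p2 b) = b"
    using biproduct[OF inf Y] by blast
  interpret B: left_module R B using module_objD(1)[OF B] .
  interpret FB: left_module S "fobj F B" using module_objD(1)[OF Fo[OF B]] .
  have comps: "compose (carrier Y) p1 i1 = restrict (\<lambda>x. x) (carrier Y)"
    "compose (carrier Y) p2 i1 = hom_zero Y Y" "compose (carrier Y) p1 i2 = hom_zero Y Y"
    "compose (carrier Y) p2 i2 = restrict (\<lambda>x. x) (carrier Y)"
    by (auto simp: compose_def hom_zero_def pi)
  have Fpi: "fmor F B Y p1 (fmor F Y B i1 y) = y" "fmor F B Y p2 (fmor F Y B i1 y) = \<zero>\<^bsub>fobj F Y\<^esub>"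
    "fmor F B Y p1 (fmor F Y B i2 y) = \<zero>\<^bsub>fobj F Y\<^esub>" "fmor F B Y p2 (fmor F Y B i2 y) = y"
    if y: "y \<in> carrier (fobj F Y)" for y
    using Fcomp[OF Y B Y i(1) p(1) y] Fcomp[OF Y B Y i(1) p(2) y]
      Fcomp[OF Y B Y i(2) p(1) y] Fcomp[OF Y B Y i(2) p(2) y]
    by (simp_all add: comps Fid[OF Y y] Fzero[OF Y Y y])
  define u where "u = hom_add (fobj F B) (fobj F B)
    (compose (carrier (fobj F B)) (fmor F Y B i1) (fmor F B Y p1))
    (compose (carrier (fobj F B)) (fmor F Y B i2) (fmor F B Y p2))"
  have u_hom: "u \<in> module_homs S (fobj F B) (fobj F B)"
    unfolding u_def
    by (intro hom_add_in_homs module_homs_compose[where M = "fobj F Y"] Fo Fm B Y i p)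
  obtain v where v: "v \<in> module_homs R B B" "fmor F B B v = u"
    using fully_faithful_modulesD(2)[OF ff B B u_hom] by blast
  have u: "u b = fmor F Y B i1 (fmor F B Y p1 b) \<oplus>\<^bsub>fobj F B\<^esub> fmor F Y B i2 (fmor F B Y p2 b)"
    if "b \<in> carrier (fobj F B)" for b
    using that by (simp add: u_def hom_add_def compose_def)
  have pv: "compose (carrier B) p1 v = p1" "compose (carrier B) p2 v = p2"
  proof -
    have eq: "fmor F B Y (compose (carrier B) p v) = fmor F B Y p" if p': "p = p1 \<or> p = p2" for p
    proof (rule module_homs_eqI)
      have p'': "p \<in> module_homs R B Y" using p p' by blast
      show "fmor F B Y (compose (carrier B) p v) \<in> module_homs S (fobj F B) (fobj F Y)"
        "fmor F B Y p \<in> module_homs S (fobj F B) (fobj F Y)"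
        using p'' v(1) by (auto intro!: Fm B Y module_homs_compose)
      fix b assume b: "b \<in> carrier (fobj F B)"
      have "fmor F B Y (compose (carrier B) p v) b = fmor F B Y p (u b)"
        using Fcomp[OF B B Y v(1) p'' b] v(2) by simp
      also have "\<dots> = fmor F B Y p (fmor F Y B i1 (fmor F B Y p1 b)) \<oplus>\<^bsub>fobj F Y\<^esub>
          fmor F B Y p (fmor F Y B i2 (fmor F B Y p2 b))"
        unfolding u[OF b] by (intro Fadd Fcl B Y p'' i p b)
      also have "\<dots> = fmor F B Y p b"
        using p' Fcl[OF B Y p(1) b] Fcl[OF B Y p(2) b] by (auto simp: Fpi)
      finally show "fmor F B Y (compose (carrier B) p v) b = fmor F B Y p b" .
    qed
    note inj = fully_faithful_modulesD(1)[OF ff B Y]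
    show "compose (carrier B) p1 v = p1" "compose (carrier B) p2 v = p2"
      by (rule inj_onD[OF inj eq module_homs_compose[OF B v(1)]]; simp add: p)+
  qed
  have "v = restrict (\<lambda>x. x) (carrier B)"
  proof (rule module_homs_eqI[OF v(1) module_homs_id[OF B]])
    fix b assume b: "b \<in> carrier B"
    have "p1 (v b) = p1 b" "p2 (v b) = p2 b" using pv b by (metis compose_eq)+
    then show "v b = restrict (\<lambda>x. x) (carrier B) b"
      using ip[of "v b"] ip[of b] ev[OF v(1)] b by simp
  qed
  then have u_id: "u b = b" if "b \<in> carrier (fobj F B)" for b
    using v(2) Fid[OF B that] by simp
  define d where "d = hom_add B Y p1 p2"
  have d: "d \<in> module_homs R B Y" unfolding d_def by (rule hom_add_in_homs[OF B Y p])
  define h where "h = hom_add X B (compose (carrier X) i1 f) (compose (carrier X) i2 g)"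
  have h: "h \<in> module_homs R X B"
    unfolding h_def by (intro hom_add_in_homs module_homs_compose[where M = Y] X B i f g)
  have di: "compose (carrier Y) d i1 = restrict (\<lambda>x. x) (carrier Y)"
    "compose (carrier Y) d i2 = restrict (\<lambda>x. x) (carrier Y)"
    using ev[OF i(1)] ev[OF i(2)] by (auto simp: compose_def d_def hom_add_def pi)
  have hx: "h x = i1 (f x) \<oplus>\<^bsub>B\<^esub> i2 (g x)" if "x \<in> carrier X" for x
    using that by (simp add: h_def hom_add_def compose_def)
  have ph: "p1 (h x) = f x" "p2 (h x) = g x" if x: "x \<in> carrier X" for x
    using x by (simp_all add: hx pi ev_add[OF p(1)] ev_add[OF p(2)]
      ev[OF i(1)] ev[OF i(2)] ev[OF f] ev[OF g])
  have phc: "compose (carrier X) p1 h = f" "compose (carrier X) p2 h = g"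
    by (rule module_homs_eqI[OF module_homs_compose[OF X h p(1)] f], simp add: compose_def ph)
      (rule module_homs_eqI[OF module_homs_compose[OF X h p(2)] g], simp add: compose_def ph)
  have sum: "hom_add X Y f g = compose (carrier X) d h"
    using ph ev[OF h] by (auto simp: hom_add_def compose_def d_def)
  show ?thesis
  proof (rule module_homs_eqI)
    show "fmor F X Y (hom_add X Y f g) \<in> module_homs S (fobj F X) (fobj F Y)"
      by (intro Fm X Y hom_add_in_homs f g)
    show "hom_add (fobj F X) (fobj F Y) (fmor F X Y f) (fmor F X Y g) \<in> module_homs S (fobj F X) (fobj F Y)"
      by (intro hom_add_in_homs Fm Fo X Y f g)
    fix x assume x: "x \<in> carrier (fobj F X)"
    let ?b = "fmor F X B h x"
    have b: "?b \<in> carrier (fobj F B)" using Fcl X B h x by blast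
    have pb: "fmor F B Y p1 ?b = fmor F X Y f x" "fmor F B Y p2 ?b = fmor F X Y g x"
      using Fcomp[OF X B Y h p(1) x] Fcomp[OF X B Y h p(2) x] phc by simp_all
    have Fdi: "fmor F B Y d (fmor F Y B i1 y) = y" "fmor F B Y d (fmor F Y B i2 y) = y"
      if y: "y \<in> carrier (fobj F Y)" for y
      using Fcomp[OF Y B Y i(1) d y] Fcomp[OF Y B Y i(2) d y] by (simp_all add: di Fid[OF Y y])
    have cl: "fmor F X Y f x \<in> carrier (fobj F Y)" "fmor F X Y g x \<in> carrier (fobj F Y)"
      using Fcl X Y f g x by blast+
    have "fmor F X Y (hom_add X Y f g) x = fmor F B Y d ?b"
      unfolding sum by (rule Fcomp[OF X B Y h d x])
    also have "\<dots> = fmor F B Y d (fmor F Y B i1 (fmor F X Y f x) \<oplus>\<^bsub>fobj F B\<^esub> fmor F Y B i2 (fmor F X Y g x))"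
      using u[OF b] u_id[OF b] pb by simp
    also have "\<dots> = fmor F X Y f x \<oplus>\<^bsub>fobj F Y\<^esub> fmor F X Y g x"
      using Fadd[OF B Y d Fcl[OF Y B i(1) cl(1)] Fcl[OF Y B i(2) cl(2)]] Fdi cl by simp
    finally show "fmor F X Y (hom_add X Y f g) x
        = hom_add (fobj F X) (fobj F Y) (fmor F X Y f) (fmor F X Y g) x"
      using x by (simp add: hom_add_def)
  qed
qed

section \<open>Endomorphism rings as corners of matrix rings\<close>

text \<open>
  The product of \<open>f\<close> and \<open>g\<close> is \<open>g \<circ> f\<close>, so that a ring acting on a left module by right
  multiplications maps to this ring.
\<close>

definition opposite_endomorphism_rng :: "'a ring \<Rightarrow> ('a, 'm) module \<Rightarrow> ('m \<Rightarrow> 'm) ring" where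
  "opposite_endomorphism_rng R P = \<lparr>carrier = module_homs R P P,
     monoid.mult = (\<lambda>f g. compose (carrier P) g f), one = undefined,
     zero = hom_zero P P, add = hom_add P P\<rparr>"

lemma (in abelian_monoid) finsum_swap:
  assumes "finite A" "finite B" "\<And>i j. i \<in> A \<Longrightarrow> j \<in> B \<Longrightarrow> f i j \<in> carrier G"
  shows "(\<Oplus>i\<in>A. \<Oplus>j\<in>B. f i j) = (\<Oplus>j\<in>B. \<Oplus>i\<in>A. f i j)"
  using assms(1,3)
proof (induction A)
  case (insert a A)
  then have "(\<Oplus>i\<in>insert a A. \<Oplus>j\<in>B. f i j) = (\<Oplus>j\<in>B. f a j) \<oplus> (\<Oplus>j\<in>B. \<Oplus>i\<in>A. f i j)"
    by (subst finsum_insert) (auto simp: Pi_def intro!: finsum_closed)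
  also have "\<dots> = (\<Oplus>j\<in>B. f a j \<oplus> (\<Oplus>i\<in>A. f i j))"
    using insert by (subst finsum_addf) (auto simp: Pi_def intro!: finsum_closed)
  also have "\<dots> = (\<Oplus>j\<in>B. \<Oplus>i\<in>insert a A. f i j)"
    using insert by (intro finsum_cong') (auto simp: Pi_def intro!: finsum_closed)
  finally show ?case .
qed simp

text \<open>
  The coordinate functions of \<open>P\<close> arise as morphisms from \<open>P\<close> to the nondegenerate quotient of \<open>R\<close>.
  The \<open>c\<^sub>i : P \<rightarrow> R\<close> stand for representatives of their values, which is why they are linear only up
  to elements that \<open>R\<close> annihilates from the left.
\<close>

locale dual_basis = left_module R P for R :: "'a ring" and P :: "('a, 'm) module" +
  fixes n :: nat and x :: "nat \<Rightarrow> 'm" and c :: "nat \<Rightarrow> 'm \<Rightarrow> 'a"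
  assumes nondeg: "nondegenerate_module R P"
    and x_closed: "i < n \<Longrightarrow> x i \<in> carrier P"
    and c_closed: "\<lbrakk>i < n; p \<in> carrier P\<rbrakk> \<Longrightarrow> c i p \<in> carrier R"
    and c_add: "\<lbrakk>i < n; r \<in> carrier R; p \<in> carrier P; q \<in> carrier P\<rbrakk> \<Longrightarrow>
      r \<otimes>\<^bsub>R\<^esub> c i (p \<oplus>\<^bsub>P\<^esub> q) = r \<otimes>\<^bsub>R\<^esub> (c i p \<oplus>\<^bsub>R\<^esub> c i q)"
    and c_smult: "\<lbrakk>i < n; r \<in> carrier R; s \<in> carrier R; p \<in> carrier P\<rbrakk> \<Longrightarrow>
      r \<otimes>\<^bsub>R\<^esub> c i (s \<odot>\<^bsub>P\<^esub> p) = r \<otimes>\<^bsub>R\<^esub> (s \<otimes>\<^bsub>R\<^esub> c i p)"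
    and expansion: "p \<in> carrier P \<Longrightarrow> (\<Oplus>\<^bsub>P\<^esub>i\<in>{..<n}. c i p \<odot>\<^bsub>P\<^esub> x i) = p"
begin

abbreviation "I \<equiv> {..<n} \<times> {..<n}"
abbreviation "MR \<equiv> matrix_rng n R"
abbreviation mmult (infixl "**" 70) where "A ** B \<equiv> A \<otimes>\<^bsub>MR\<^esub> B"

sublocale MR: rng MR by (rule R.matrix_rng)

lemma entry_closed: "\<lbrakk>A \<in> carrier MR; i < n; j < n\<rbrakk> \<Longrightarrow> A (i, j) \<in> carrier R"
  by (auto simp: matrix_rng_def PiE_def Pi_def)

lemma mult_entry: "\<lbrakk>i < n; k < n\<rbrakk> \<Longrightarrow> (A ** B) (i, k) = (\<Oplus>\<^bsub>R\<^esub>j\<in>{..<n}. A (i, j) \<otimes>\<^bsub>R\<^esub> B (j, k))"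
  by (simp add: matrix_rng_def)

lemma matrix_eqI:
  assumes "A \<in> carrier MR" "B \<in> carrier MR" "\<And>i j. i < n \<Longrightarrow> j < n \<Longrightarrow> A (i, j) = B (i, j)"
  shows "A = B"
  using assms unfolding matrix_rng_def by (intro PiE_ext[of A I "\<lambda>_. carrier R" B]) auto

lemma mult_cong_left:
  assumes X: "X \<in> carrier MR" and UV: "U \<in> carrier MR" "V \<in> carrier MR"
    and eq: "\<And>r i j. r \<in> carrier R \<Longrightarrow> i < n \<Longrightarrow> j < n \<Longrightarrow> r \<otimes>\<^bsub>R\<^esub> U (i, j) = r \<otimes>\<^bsub>R\<^esub> V (i, j)"
  shows "X ** U = X ** V"
proof (rule matrix_eqI)
  show "X ** U \<in> carrier MR" "X ** V \<in> carrier MR" using X UV by (simp_all add: MR.rng_m_closed)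
  show "(X ** U) (i, j) = (X ** V) (i, j)" if "i < n" "j < n" for i j
    unfolding mult_entry[OF that]
    using that X UV by (intro R.finsum_cong') (auto simp: eq entry_closed R.rng_m_closed)
qed

text \<open>
  Row \<open>i\<close> lists the coordinates of \<open>f(x\<^sub>i)\<close>. With rows instead of columns, matrices multiply in the
  order opposite to composition.
\<close>

definition L :: "('m \<Rightarrow> 'm) \<Rightarrow> nat \<times> nat \<Rightarrow> 'a" where
  "L f = restrict (\<lambda>(i, j). c j (f (x i))) I"

abbreviation "one_matrix \<equiv> L (restrict (\<lambda>p. p) (carrier P))"

lemma L_entry: "i < n \<Longrightarrow> j < n \<Longrightarrow> L f (i, j) = c j (f (x i))"
  by (simp add: L_def)

lemma L_closed:
  assumes "f \<in> module_homs R P P"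
  shows "L f \<in> carrier MR"
proof -
  have "c j (f (x i)) \<in> carrier R" if "i < n" "j < n" for i j
  proof -
    have "linear_map R P P f" using assms by (simp add: module_homs_iff)
    then show ?thesis using that c_closed x_closed by (simp add: linear_mapD(1))
  qed
  then show ?thesis unfolding L_def matrix_rng_def by auto
qed

lemma one_in_homs: "restrict (\<lambda>p. p) (carrier P) \<in> module_homs R P P"
  unfolding module_homs_iff linear_map_restrict[OF left_module_axioms]
  by (simp add: linear_map_def)

text \<open>
  Additivity and homogeneity of \<open>c\<^sub>k\<close> after left multiplication by \<open>r\<close> are enough for an induction
  on \<open>J\<close>, since the same \<open>r\<close> serves for all summands.
\<close>

lemma c_linear:
  assumes "finite J" "k < n" "r \<in> carrier R" "a \<in> J \<rightarrow> carrier R" "y \<in> J \<rightarrow> carrier P"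
  shows "r \<otimes>\<^bsub>R\<^esub> c k (\<Oplus>\<^bsub>P\<^esub>j\<in>J. a j \<odot>\<^bsub>P\<^esub> y j) = r \<otimes>\<^bsub>R\<^esub> (\<Oplus>\<^bsub>R\<^esub>j\<in>J. a j \<otimes>\<^bsub>R\<^esub> c k (y j))"
  using assms(1,4,5)
proof (induction J)
  case empty
  have "r \<otimes>\<^bsub>R\<^esub> c k (\<zero>\<^bsub>R\<^esub> \<odot>\<^bsub>P\<^esub> \<zero>\<^bsub>P\<^esub>) = r \<otimes>\<^bsub>R\<^esub> (\<zero>\<^bsub>R\<^esub> \<otimes>\<^bsub>R\<^esub> c k \<zero>\<^bsub>P\<^esub>)"
    using assms(2,3) by (intro c_smult) auto
  then show ?case using assms(2,3) by (simp add: smult_l_null R.rng_l_null c_closed)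
next
  case (insert j J)
  let ?S = "\<Oplus>\<^bsub>P\<^esub>j\<in>J. a j \<odot>\<^bsub>P\<^esub> y j" and ?T = "\<Oplus>\<^bsub>R\<^esub>j\<in>J. a j \<otimes>\<^bsub>R\<^esub> c k (y j)"
  have cl: "a j \<in> carrier R" "y j \<in> carrier P" "?S \<in> carrier P" "?T \<in> carrier R"
    "(\<lambda>j. a j \<odot>\<^bsub>P\<^esub> y j) \<in> J \<rightarrow> carrier P" "(\<lambda>j. a j \<otimes>\<^bsub>R\<^esub> c k (y j)) \<in> J \<rightarrow> carrier R"
    using insert assms(2)
    by (auto simp: Pi_def lm_smult_closed R.rng_m_closed c_closed intro!: M.finsum_closed R.finsum_closed)
  have "r \<otimes>\<^bsub>R\<^esub> c k (a j \<odot>\<^bsub>P\<^esub> y j \<oplus>\<^bsub>P\<^esub> ?S) = r \<otimes>\<^bsub>R\<^esub> (c k (a j \<odot>\<^bsub>P\<^esub> y j) \<oplus>\<^bsub>R\<^esub> c k ?S)"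
    using assms(2,3) cl by (intro c_add) (auto simp: lm_smult_closed)
  also have "\<dots> = r \<otimes>\<^bsub>R\<^esub> (a j \<otimes>\<^bsub>R\<^esub> c k (y j)) \<oplus>\<^bsub>R\<^esub> r \<otimes>\<^bsub>R\<^esub> ?T"
    using assms(2,3) cl insert by (simp add: R.rng_r_distr c_closed c_smult lm_smult_closed)
  also have "\<dots> = r \<otimes>\<^bsub>R\<^esub> (a j \<otimes>\<^bsub>R\<^esub> c k (y j) \<oplus>\<^bsub>R\<^esub> ?T)"
    using assms(2,3) cl by (simp add: R.rng_r_distr c_closed R.rng_m_closed)
  finally show ?case
    using insert cl assms(2) by (simp add: lm_smult_closed R.rng_m_closed c_closed)
qed

text \<open>
  Expanding \<open>f(x\<^sub>i)\<close> in the generators, \<open>c\<^sub>k(g(f(x\<^sub>i)))\<close> becomes \<open>\<Sum>\<^sub>j c\<^sub>j(f(x\<^sub>i)) c\<^sub>k(g(x\<^sub>j))\<close>, up to an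
  element annihilated by \<open>R\<close>. The factor \<open>X\<close> removes the difference.
\<close>

lemma mult_L_compose:
  assumes X: "X \<in> carrier MR" and f: "f \<in> module_homs R P P" and g: "g \<in> module_homs R P P"
  shows "X ** (L f ** L g) = X ** L (compose (carrier P) g f)"
proof (rule mult_cong_left[OF X])
  have lf: "linear_map R P P f" and lg: "linear_map R P P g" using f g by (auto simp: module_homs_iff)
  have gf: "compose (carrier P) g f \<in> module_homs R P P"
    using linear_map_compose[OF left_module_axioms lf lg] by (simp add: module_homs_iff)
  show "L f ** L g \<in> carrier MR" "L (compose (carrier P) g f) \<in> carrier MR"
    using L_closed f g gf by (simp_all add: MR.rng_m_closed)
  fix r i k assume r: "r \<in> carrier R" and ik: "i < n" "k < n"
  have fx: "f (x i) \<in> carrier P" using linear_mapD(1)[OF lf] x_closed ik by simp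
  have "g (f (x i)) = g (\<Oplus>\<^bsub>P\<^esub>j\<in>{..<n}. c j (f (x i)) \<odot>\<^bsub>P\<^esub> x j)"
    using expansion[OF fx] by simp
  also have "\<dots> = (\<Oplus>\<^bsub>P\<^esub>j\<in>{..<n}. g (c j (f (x i)) \<odot>\<^bsub>P\<^esub> x j))"
    using fx by (intro linear_map_finsum[OF lg left_module_axioms left_module_axioms])
      (auto simp: lm_smult_closed c_closed x_closed)
  also have "\<dots> = (\<Oplus>\<^bsub>P\<^esub>j\<in>{..<n}. c j (f (x i)) \<odot>\<^bsub>P\<^esub> g (x j))"
    using fx by (intro M.finsum_cong')
      (auto simp: linear_mapD[OF lg] c_closed x_closed lm_smult_closed)
  finally have "r \<otimes>\<^bsub>R\<^esub> c k (g (f (x i))) = r \<otimes>\<^bsub>R\<^esub> (\<Oplus>\<^bsub>R\<^esub>j\<in>{..<n}. c j (f (x i)) \<otimes>\<^bsub>R\<^esub> c k (g (x j)))"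
    using r ik fx c_linear[of "{..<n}" k r "\<lambda>j. c j (f (x i))" "\<lambda>j. g (x j)"]
    by (auto simp: c_closed linear_mapD[OF lg] x_closed)
  moreover have "(L f ** L g) (i, k) = (\<Oplus>\<^bsub>R\<^esub>j\<in>{..<n}. c j (f (x i)) \<otimes>\<^bsub>R\<^esub> c k (g (x j)))"
    unfolding mult_entry[OF ik] using ik fx
    by (intro R.finsum_cong') (auto simp: L_entry R.rng_m_closed c_closed linear_mapD[OF lg] x_closed)
  ultimately show "r \<otimes>\<^bsub>R\<^esub> (L f ** L g) (i, k) = r \<otimes>\<^bsub>R\<^esub> L (compose (carrier P) g f) (i, k)"
    using ik by (simp add: L_entry compose_def x_closed)
qed

lemma mult_L_one:
  assumes X: "X \<in> carrier MR" and f: "f \<in> module_homs R P P"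
  shows "X ** (one_matrix ** L f) = X ** L f" "X ** (L f ** one_matrix) = X ** L f"
proof -
  have "f p \<in> carrier P" if "p \<in> carrier P" for p
    using f that linear_mapD(1) by (auto simp: module_homs_iff)
  then have "L (compose (carrier P) f (restrict (\<lambda>p. p) (carrier P))) = L f"
    "L (compose (carrier P) (restrict (\<lambda>p. p) (carrier P)) f) = L f"
    by (auto simp: L_def compose_def x_closed intro!: restrict_ext)
  then show "X ** (one_matrix ** L f) = X ** L f" "X ** (L f ** one_matrix) = X ** L f"
    using mult_L_compose[OF X] f one_in_homs by simp_all
qed

lemma smult_eq_if_congruent:
  assumes "a \<in> carrier R" "b \<in> carrier R" "p \<in> carrier P"
    and eq: "\<And>r. r \<in> carrier R \<Longrightarrow> r \<otimes>\<^bsub>R\<^esub> a = r \<otimes>\<^bsub>R\<^esub> b"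
  shows "a \<odot>\<^bsub>P\<^esub> p = b \<odot>\<^bsub>P\<^esub> p"
proof -
  have "r \<odot>\<^bsub>P\<^esub> (a \<odot>\<^bsub>P\<^esub> p \<ominus>\<^bsub>P\<^esub> b \<odot>\<^bsub>P\<^esub> p) = \<zero>\<^bsub>P\<^esub>" if r: "r \<in> carrier R" for r
  proof -
    have "r \<odot>\<^bsub>P\<^esub> (a \<odot>\<^bsub>P\<^esub> p) = r \<odot>\<^bsub>P\<^esub> (b \<odot>\<^bsub>P\<^esub> p)"
      using assms(1-3) r eq by (simp flip: lm_smult_assoc)
    then show ?thesis
      using assms(1-3) r by (simp add: smult_minus_distr lm_smult_closed M.minus_eq_zero_iff)
  qed
  then have "a \<odot>\<^bsub>P\<^esub> p \<ominus>\<^bsub>P\<^esub> b \<odot>\<^bsub>P\<^esub> p = \<zero>\<^bsub>P\<^esub>"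
    using nondeg assms(1-3) by (auto simp: nondegenerate_module_def lm_smult_closed)
  then show ?thesis using assms(1-3) by (simp add: M.minus_eq_zero_iff lm_smult_closed)
qed

text \<open>
  With \<open>B\<close> the matrix of the identity, applying \<open>L(f)\<close> to the generators gives \<open>f(x\<^sub>i)\<close>, and \<open>B\<close>
  then fixes this: \<open>\<Sum>\<^sub>j c\<^sub>j(x\<^sub>i) f(x\<^sub>j) = f(\<Sum>\<^sub>j c\<^sub>j(x\<^sub>i) x\<^sub>j) = f(x\<^sub>i)\<close>. So \<open>B L(f)\<close> determines the values
  of \<open>f\<close> on the generators.
\<close>

lemma one_matrix_mult_L_inj:
  assumes f: "f \<in> module_homs R P P" and g: "g \<in> module_homs R P P"
    and eq: "one_matrix ** L f = one_matrix ** L g"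
  shows "f = g"
proof (rule module_homs_eqI[OF f g])
  have repr: "h (x i) = (\<Oplus>\<^bsub>P\<^esub>k\<in>{..<n}. (one_matrix ** L h) (i, k) \<odot>\<^bsub>P\<^esub> x k)"
    if h: "h \<in> module_homs R P P" and i: "i < n" for h i
  proof -
    have lh: "linear_map R P P h" using h by (simp add: module_homs_iff)
    note cl = linear_mapD(1)[OF lh] x_closed c_closed R.rng_m_closed lm_smult_closed
    have "h (x i) = h (\<Oplus>\<^bsub>P\<^esub>j\<in>{..<n}. c j (x i) \<odot>\<^bsub>P\<^esub> x j)"
      using expansion[OF x_closed[OF i]] by simp
    also have "\<dots> = (\<Oplus>\<^bsub>P\<^esub>j\<in>{..<n}. h (c j (x i) \<odot>\<^bsub>P\<^esub> x j))"
      using i by (intro linear_map_finsum[OF lh left_module_axioms left_module_axioms]) (auto simp: cl)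
    also have "\<dots> = (\<Oplus>\<^bsub>P\<^esub>j\<in>{..<n}. c j (x i) \<odot>\<^bsub>P\<^esub> (\<Oplus>\<^bsub>P\<^esub>k\<in>{..<n}. c k (h (x j)) \<odot>\<^bsub>P\<^esub> x k))"
      using i by (intro M.finsum_cong') (auto simp: cl linear_mapD(3)[OF lh] expansion)
    also have "\<dots> = (\<Oplus>\<^bsub>P\<^esub>j\<in>{..<n}. \<Oplus>\<^bsub>P\<^esub>k\<in>{..<n}. (c j (x i) \<otimes>\<^bsub>R\<^esub> c k (h (x j))) \<odot>\<^bsub>P\<^esub> x k)"
    proof (rule M.finsum_cong')
      fix j assume j: "j \<in> {..<n}"
      have "c j (x i) \<odot>\<^bsub>P\<^esub> (\<Oplus>\<^bsub>P\<^esub>k\<in>{..<n}. c k (h (x j)) \<odot>\<^bsub>P\<^esub> x k)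
          = (\<Oplus>\<^bsub>P\<^esub>k\<in>{..<n}. c j (x i) \<odot>\<^bsub>P\<^esub> (c k (h (x j)) \<odot>\<^bsub>P\<^esub> x k))"
        using i j by (intro smult_finsum_r) (auto simp: cl)
      also have "\<dots> = (\<Oplus>\<^bsub>P\<^esub>k\<in>{..<n}. (c j (x i) \<otimes>\<^bsub>R\<^esub> c k (h (x j))) \<odot>\<^bsub>P\<^esub> x k)"
        using i j by (intro M.finsum_cong') (auto simp: cl lm_smult_assoc)
      finally show "c j (x i) \<odot>\<^bsub>P\<^esub> (\<Oplus>\<^bsub>P\<^esub>k\<in>{..<n}. c k (h (x j)) \<odot>\<^bsub>P\<^esub> x k)
          = (\<Oplus>\<^bsub>P\<^esub>k\<in>{..<n}. (c j (x i) \<otimes>\<^bsub>R\<^esub> c k (h (x j))) \<odot>\<^bsub>P\<^esub> x k)" .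
    qed (use i in \<open>auto simp: cl intro!: M.finsum_closed\<close>)
    also have "\<dots> = (\<Oplus>\<^bsub>P\<^esub>k\<in>{..<n}. \<Oplus>\<^bsub>P\<^esub>j\<in>{..<n}. (c j (x i) \<otimes>\<^bsub>R\<^esub> c k (h (x j))) \<odot>\<^bsub>P\<^esub> x k)"
      using i by (intro M.finsum_swap) (auto simp: cl)
    also have "\<dots> = (\<Oplus>\<^bsub>P\<^esub>k\<in>{..<n}. (one_matrix ** L h) (i, k) \<odot>\<^bsub>P\<^esub> x k)"
    proof (rule M.finsum_cong')
      fix k assume k: "k \<in> {..<n}"
      have "(one_matrix ** L h) (i, k) = (\<Oplus>\<^bsub>R\<^esub>j\<in>{..<n}. c j (x i) \<otimes>\<^bsub>R\<^esub> c k (h (x j)))"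
        using i k unfolding mult_entry[OF i k[unfolded lessThan_iff]]
        by (intro R.finsum_cong') (auto simp: L_entry cl)
      then show "(\<Oplus>\<^bsub>P\<^esub>j\<in>{..<n}. (c j (x i) \<otimes>\<^bsub>R\<^esub> c k (h (x j))) \<odot>\<^bsub>P\<^esub> x k)
          = (one_matrix ** L h) (i, k) \<odot>\<^bsub>P\<^esub> x k"
        using i k by (simp add: smult_finsum_l[symmetric] cl Pi_def)
    qed (use i L_closed[OF h] L_closed[OF one_in_homs] in
        \<open>auto simp: cl entry_closed MR.rng_m_closed\<close>)
    finally show ?thesis .
  qed
  have gen: "f (x i) = g (x i)" if "i < n" for i
    unfolding repr[OF f that] repr[OF g that] eq ..
  fix p assume p: "p \<in> carrier P"
  have lin: "h p = (\<Oplus>\<^bsub>P\<^esub>i\<in>{..<n}. c i p \<odot>\<^bsub>P\<^esub> h (x i))" if h: "h \<in> module_homs R P P" for h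
  proof -
    have lh: "linear_map R P P h" using h by (simp add: module_homs_iff)
    have "h p = h (\<Oplus>\<^bsub>P\<^esub>i\<in>{..<n}. c i p \<odot>\<^bsub>P\<^esub> x i)" using expansion[OF p] by simp
    also have "\<dots> = (\<Oplus>\<^bsub>P\<^esub>i\<in>{..<n}. h (c i p \<odot>\<^bsub>P\<^esub> x i))"
      using p by (intro linear_map_finsum[OF lh left_module_axioms left_module_axioms])
        (auto simp: c_closed x_closed lm_smult_closed)
    also have "\<dots> = (\<Oplus>\<^bsub>P\<^esub>i\<in>{..<n}. c i p \<odot>\<^bsub>P\<^esub> h (x i))"
      using p by (intro M.finsum_cong')
        (auto simp: c_closed x_closed lm_smult_closed linear_mapD[OF lh])
    finally show ?thesis .
  qed
  show "f p = g p"
    unfolding lin[OF f] lin[OF g]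
    using p g by (intro M.finsum_cong') (auto simp: gen c_closed x_closed lm_smult_closed
        module_homs_iff linear_mapD(1))
qed

text \<open>
  A matrix \<open>Y\<close> maps \<open>x\<^sub>i\<close> to \<open>w\<^sub>i = \<Sum>\<^sub>j Y\<^sub>i\<^sub>j x\<^sub>j\<close>, which extends to the endomorphism
  \<open>p \<mapsto> \<Sum>\<^sub>i c\<^sub>i(p) w\<^sub>i\<close>; the maps \<open>p \<mapsto> c\<^sub>i(p) w\<^sub>i\<close> are linear, because elements annihilated
  by \<open>R\<close> from the left act as zero on \<open>P\<close>.
\<close>

lemma one_matrix_mult_L_surj:
  assumes Y: "Y \<in> carrier MR"
  shows "\<exists>f\<in>module_homs R P P. one_matrix ** L f = one_matrix ** (one_matrix ** (Y ** one_matrix))"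
proof -
  note B = L_closed[OF one_in_homs]
  define w where "w i = (\<Oplus>\<^bsub>P\<^esub>j\<in>{..<n}. Y (i, j) \<odot>\<^bsub>P\<^esub> x j)" for i
  have w: "w i \<in> carrier P" if "i < n" for i
    unfolding w_def using that Y by (auto intro!: M.finsum_closed simp: lm_smult_closed entry_closed x_closed)
  note cl = w x_closed c_closed R.rng_m_closed lm_smult_closed entry_closed[OF Y]
  define f where "f = restrict (\<lambda>p. \<Oplus>\<^bsub>P\<^esub>i\<in>{..<n}. c i p \<odot>\<^bsub>P\<^esub> w i) (carrier P)"
  have "linear_map R P P f"
    unfolding f_def linear_map_restrict[OF left_module_axioms] unfolding linear_map_def
  proof (intro conjI ballI)
    show "(\<lambda>p. \<Oplus>\<^bsub>P\<^esub>i\<in>{..<n}. c i p \<odot>\<^bsub>P\<^esub> w i) \<in> carrier P \<rightarrow> carrier P"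
      by (auto intro!: M.finsum_closed simp: cl)
  next
    fix p q assume pq: "p \<in> carrier P" "q \<in> carrier P"
    have "c i (p \<oplus>\<^bsub>P\<^esub> q) \<odot>\<^bsub>P\<^esub> w i = c i p \<odot>\<^bsub>P\<^esub> w i \<oplus>\<^bsub>P\<^esub> c i q \<odot>\<^bsub>P\<^esub> w i" if i: "i < n" for i
    proof -
      have "c i (p \<oplus>\<^bsub>P\<^esub> q) \<odot>\<^bsub>P\<^esub> w i = (c i p \<oplus>\<^bsub>R\<^esub> c i q) \<odot>\<^bsub>P\<^esub> w i"
        using pq i c_add by (intro smult_eq_if_congruent) (auto simp: cl)
      then show ?thesis using pq i by (simp add: lm_smult_l_distr cl)
    qed
    then have "(\<Oplus>\<^bsub>P\<^esub>i\<in>{..<n}. c i (p \<oplus>\<^bsub>P\<^esub> q) \<odot>\<^bsub>P\<^esub> w i)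
        = (\<Oplus>\<^bsub>P\<^esub>i\<in>{..<n}. c i p \<odot>\<^bsub>P\<^esub> w i \<oplus>\<^bsub>P\<^esub> c i q \<odot>\<^bsub>P\<^esub> w i)"
      using pq by (intro M.finsum_cong') (auto simp: cl)
    also have "\<dots> = (\<Oplus>\<^bsub>P\<^esub>i\<in>{..<n}. c i p \<odot>\<^bsub>P\<^esub> w i) \<oplus>\<^bsub>P\<^esub> (\<Oplus>\<^bsub>P\<^esub>i\<in>{..<n}. c i q \<odot>\<^bsub>P\<^esub> w i)"
      using pq by (intro M.finsum_addf) (auto simp: cl)
    finally show "(\<Oplus>\<^bsub>P\<^esub>i\<in>{..<n}. c i (p \<oplus>\<^bsub>P\<^esub> q) \<odot>\<^bsub>P\<^esub> w i)
        = (\<Oplus>\<^bsub>P\<^esub>i\<in>{..<n}. c i p \<odot>\<^bsub>P\<^esub> w i) \<oplus>\<^bsub>P\<^esub> (\<Oplus>\<^bsub>P\<^esub>i\<in>{..<n}. c i q \<odot>\<^bsub>P\<^esub> w i)" .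
  next
    fix r p assume r: "r \<in> carrier R" and p: "p \<in> carrier P"
    have "c i (r \<odot>\<^bsub>P\<^esub> p) \<odot>\<^bsub>P\<^esub> w i = r \<odot>\<^bsub>P\<^esub> (c i p \<odot>\<^bsub>P\<^esub> w i)" if i: "i < n" for i
    proof -
      have "c i (r \<odot>\<^bsub>P\<^esub> p) \<odot>\<^bsub>P\<^esub> w i = (r \<otimes>\<^bsub>R\<^esub> c i p) \<odot>\<^bsub>P\<^esub> w i"
        using r p i c_smult by (intro smult_eq_if_congruent) (auto simp: cl)
      then show ?thesis using r p i by (simp add: lm_smult_assoc cl)
    qed
    then have "(\<Oplus>\<^bsub>P\<^esub>i\<in>{..<n}. c i (r \<odot>\<^bsub>P\<^esub> p) \<odot>\<^bsub>P\<^esub> w i) = (\<Oplus>\<^bsub>P\<^esub>i\<in>{..<n}. r \<odot>\<^bsub>P\<^esub> (c i p \<odot>\<^bsub>P\<^esub> w i))"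
      using r p by (intro M.finsum_cong') (auto simp: cl)
    also have "\<dots> = r \<odot>\<^bsub>P\<^esub> (\<Oplus>\<^bsub>P\<^esub>i\<in>{..<n}. c i p \<odot>\<^bsub>P\<^esub> w i)"
      using r p by (intro smult_finsum_r[symmetric]) (auto simp: cl)
    finally show "(\<Oplus>\<^bsub>P\<^esub>i\<in>{..<n}. c i (r \<odot>\<^bsub>P\<^esub> p) \<odot>\<^bsub>P\<^esub> w i) = r \<odot>\<^bsub>P\<^esub> (\<Oplus>\<^bsub>P\<^esub>i\<in>{..<n}. c i p \<odot>\<^bsub>P\<^esub> w i)" .
  qed
  then have f: "f \<in> module_homs R P P" by (simp add: module_homs_iff f_def)
  define W where "W = restrict (\<lambda>(i, j). c j (w i)) I"
  have W: "W \<in> carrier MR" unfolding W_def matrix_rng_def by (auto simp: cl)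
  have W_entry: "W (i, j) = c j (w i)" if "i < n" "j < n" for i j using that by (simp add: W_def)
  have "one_matrix ** L f = one_matrix ** (one_matrix ** W)"
  proof (rule mult_cong_left[OF B L_closed[OF f] MR.rng_m_closed[OF B W]])
    fix r i j assume r: "r \<in> carrier R" and ij: "i < n" "j < n"
    have "r \<otimes>\<^bsub>R\<^esub> L f (i, j) = r \<otimes>\<^bsub>R\<^esub> c j (\<Oplus>\<^bsub>P\<^esub>k\<in>{..<n}. c k (x i) \<odot>\<^bsub>P\<^esub> w k)"
      using ij by (simp add: L_entry f_def cl)
    also have "\<dots> = r \<otimes>\<^bsub>R\<^esub> (\<Oplus>\<^bsub>R\<^esub>k\<in>{..<n}. c k (x i) \<otimes>\<^bsub>R\<^esub> c j (w k))"
      using r ij by (intro c_linear) (auto simp: cl)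
    also have "(\<Oplus>\<^bsub>R\<^esub>k\<in>{..<n}. c k (x i) \<otimes>\<^bsub>R\<^esub> c j (w k)) = (one_matrix ** W) (i, j)"
      unfolding mult_entry[OF ij] using ij
      by (intro R.finsum_cong') (auto simp: cl L_entry W_entry)
    finally show "r \<otimes>\<^bsub>R\<^esub> L f (i, j) = r \<otimes>\<^bsub>R\<^esub> (one_matrix ** W) (i, j)" .
  qed
  also have "one_matrix ** W = one_matrix ** (Y ** one_matrix)"
  proof (rule mult_cong_left[OF B W MR.rng_m_closed[OF Y B]])
    fix r i j assume r: "r \<in> carrier R" and ij: "i < n" "j < n"
    have "r \<otimes>\<^bsub>R\<^esub> W (i, j) = r \<otimes>\<^bsub>R\<^esub> c j (\<Oplus>\<^bsub>P\<^esub>k\<in>{..<n}. Y (i, k) \<odot>\<^bsub>P\<^esub> x k)"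
      using ij by (simp add: W_entry w_def)
    also have "\<dots> = r \<otimes>\<^bsub>R\<^esub> (\<Oplus>\<^bsub>R\<^esub>k\<in>{..<n}. Y (i, k) \<otimes>\<^bsub>R\<^esub> c j (x k))"
      using r ij by (intro c_linear) (auto simp: cl)
    also have "(\<Oplus>\<^bsub>R\<^esub>k\<in>{..<n}. Y (i, k) \<otimes>\<^bsub>R\<^esub> c j (x k)) = (Y ** one_matrix) (i, j)"
      unfolding mult_entry[OF ij] using ij
      by (intro R.finsum_cong') (auto simp: cl L_entry)
    finally show "r \<otimes>\<^bsub>R\<^esub> W (i, j) = r \<otimes>\<^bsub>R\<^esub> (Y ** one_matrix) (i, j)" .
  qed
  finally show ?thesis using f by blast
qed

text \<open>
  Write \<open>B\<close> for the matrix of the identity. Up to left multiplication by a matrix, \<open>L\<close> is an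
  antihomomorphism, so that \<open>XBB = XB\<close> for all \<open>X\<close>. Hence \<open>B\<^sup>2\<close> is idempotent, although \<open>B\<close> need not
  be, and \<open>f \<mapsto> B L(f)\<close> is the isomorphism onto the corner at \<open>B\<^sup>2\<close>.
\<close>

lemma endomorphism_rng_isomorphic_corner:
  "\<exists>A\<in>carrier MR. A ** A = A \<and>
    rng_isomorphic (opposite_endomorphism_rng R P) (corner MR A)"
proof -
  let ?B = one_matrix and ?id = "restrict (\<lambda>p. p) (carrier P)"
  note B = L_closed[OF one_in_homs]
  note assoc = MR.rng_m_assoc and closed = MR.rng_m_closed
  have XBB: "X ** (?B ** ?B) = X ** ?B" if "X \<in> carrier MR" for X
    by (rule mult_L_one(1)[OF that one_in_homs])
  define A where "A = ?B ** ?B"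
  have A: "A \<in> carrier MR" using B by (simp add: A_def closed)
  have XA: "X ** A = X ** ?B" if "X \<in> carrier MR" for X using XBB[OF that] by (simp add: A_def)
  have AA: "A ** A = A"
  proof -
    have "A ** A = A ** ?B" by (rule XA[OF A])
    also have "\<dots> = ?B ** (?B ** ?B)" unfolding A_def by (rule assoc[OF B B B])
    also have "\<dots> = A" unfolding XBB[OF B] A_def ..
    finally show ?thesis .
  qed
  have corner: "Y \<in> carrier (corner MR A) \<longleftrightarrow> Y \<in> carrier MR \<and> A ** Y = Y \<and> Y ** A = Y" for Y
    by (rule MR.corner_iff[OF A AA[symmetric]])
  define \<Phi> where "\<Phi> f = ?B ** L f" for f
  have \<Phi>: "\<Phi> f \<in> carrier (corner MR A)" if f: "f \<in> module_homs R P P" for f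
    unfolding corner
  proof (intro conjI)
    note Lf = L_closed[OF f]
    show "\<Phi> f \<in> carrier MR" using B Lf by (simp add: \<Phi>_def closed)
    have "A ** \<Phi> f = ?B ** (?B ** (?B ** L f))" unfolding A_def \<Phi>_def using B Lf by (simp add: assoc closed)
    also have "\<dots> = \<Phi> f" unfolding \<Phi>_def mult_L_one(1)[OF B f] ..
    finally show "A ** \<Phi> f = \<Phi> f" .
    have "\<Phi> f ** A = \<Phi> f ** ?B" using XA B Lf by (simp add: \<Phi>_def closed)
    also have "\<dots> = ?B ** (L f ** ?B)" unfolding \<Phi>_def by (rule assoc[OF B Lf B])
    also have "\<dots> = \<Phi> f" unfolding \<Phi>_def by (rule mult_L_one(2)[OF B f])
    finally show "\<Phi> f ** A = \<Phi> f" .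
  qed
  have "\<Phi> \<in> rng_iso (opposite_endomorphism_rng R P) (corner MR A)"
    unfolding rng_iso_def
  proof (intro CollectI conjI ballI)
    show "bij_betw \<Phi> (carrier (opposite_endomorphism_rng R P)) (carrier (corner MR A))"
      unfolding bij_betw_def
    proof
      show "inj_on \<Phi> (carrier (opposite_endomorphism_rng R P))"
        unfolding inj_on_def \<Phi>_def opposite_endomorphism_rng_def
        using one_matrix_mult_L_inj by simp
      have "Y \<in> \<Phi> ` module_homs R P P" if "Y \<in> carrier (corner MR A)" for Y
      proof -
        have Y: "Y \<in> carrier MR" "A ** Y = Y" "Y ** A = Y" using that corner by blast+
        have "Y ** ?B = Y" using XA[OF Y(1)] Y(3) by simp
        moreover have "?B ** (?B ** Y) = Y"
          using Y(2) B Y(1) by (simp add: A_def assoc)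
        ultimately show ?thesis
          using one_matrix_mult_L_surj[OF Y(1)] unfolding \<Phi>_def by (metis imageI)
      qed
      then show "\<Phi> ` carrier (opposite_endomorphism_rng R P) = carrier (corner MR A)"
        using \<Phi> by (auto simp: opposite_endomorphism_rng_def)
    qed
  next
    fix f g
    assume "f \<in> carrier (opposite_endomorphism_rng R P)" "g \<in> carrier (opposite_endomorphism_rng R P)"
    then have f: "f \<in> module_homs R P P" and g: "g \<in> module_homs R P P"
      by (simp_all add: opposite_endomorphism_rng_def)
    note Lf = L_closed[OF f] and Lg = L_closed[OF g]
    have lf: "linear_map R P P f" and lg: "linear_map R P P g" using f g by (auto simp: module_homs_iff)
    have fg: "hom_add P P f g \<in> module_homs R P P"
      unfolding module_homs_iff hom_add_def linear_map_restrict[OF left_module_axioms]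
      by (auto simp: linear_map_def linear_mapD[OF lf] linear_mapD[OF lg] M.a_ac lm_smult_r_distr)
    have "\<Phi> (hom_add P P f g) = ?B ** (L f \<oplus>\<^bsub>MR\<^esub> L g)"
      unfolding \<Phi>_def
    proof (rule mult_cong_left[OF B L_closed[OF fg] MR.a_closed[OF Lf Lg]])
      fix r i j assume r: "r \<in> carrier R" and ij: "i < n" "j < n"
      have "(L f \<oplus>\<^bsub>MR\<^esub> L g) (i, j) = c j (f (x i)) \<oplus>\<^bsub>R\<^esub> c j (g (x i))"
        using ij by (simp add: matrix_rng_def L_entry)
      then show "r \<otimes>\<^bsub>R\<^esub> L (hom_add P P f g) (i, j) = r \<otimes>\<^bsub>R\<^esub> (L f \<oplus>\<^bsub>MR\<^esub> L g) (i, j)"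
        using r ij by (simp add: L_entry hom_add_def x_closed c_add linear_mapD(1)[OF lf] linear_mapD(1)[OF lg])
    qed
    also have "\<dots> = \<Phi> f \<oplus>\<^bsub>MR\<^esub> \<Phi> g" unfolding \<Phi>_def by (rule MR.rng_r_distr[OF Lf Lg B])
    finally show "\<Phi> (f \<oplus>\<^bsub>opposite_endomorphism_rng R P\<^esub> g) = \<Phi> f \<oplus>\<^bsub>corner MR A\<^esub> \<Phi> g"
      by (simp add: opposite_endomorphism_rng_def corner_def)
    have "\<Phi> f ** \<Phi> g = ?B ** ((L f ** ?B) ** L g)"
      unfolding \<Phi>_def using B Lf Lg by (simp add: assoc closed)
    also have "\<dots> = (?B ** (L f ** ?B)) ** L g"
      using B Lf Lg by (simp add: assoc closed)
    also have "\<dots> = ?B ** (L f ** L g)"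
      unfolding mult_L_one(2)[OF B f] by (rule assoc[OF B Lf Lg])
    also have "\<dots> = \<Phi> (compose (carrier P) g f)"
      unfolding \<Phi>_def by (rule mult_L_compose[OF B f g])
    finally show "\<Phi> (f \<otimes>\<^bsub>opposite_endomorphism_rng R P\<^esub> g) = \<Phi> f \<otimes>\<^bsub>corner MR A\<^esub> \<Phi> g"
      by (simp add: opposite_endomorphism_rng_def corner_def)
  qed
  then show ?thesis using A AA by (auto simp: rng_isomorphic_def)
qed

end

section \<open>The module of an idempotent\<close>

lemma opposite_endomorphism_rng_closed:
  assumes "P \<in> obj (module_category R)"
    and "f \<in> carrier (opposite_endomorphism_rng R P)" "g \<in> carrier (opposite_endomorphism_rng R P)"
  shows "f \<oplus>\<^bsub>opposite_endomorphism_rng R P\<^esub> g \<in> carrier (opposite_endomorphism_rng R P)"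
    and "f \<otimes>\<^bsub>opposite_endomorphism_rng R P\<^esub> g \<in> carrier (opposite_endomorphism_rng R P)"
  using assms by (simp_all add: opposite_endomorphism_rng_def hom_add_in_homs module_homs_compose)

text \<open>
  For an idempotent \<open>e\<close>, the nondegenerate quotient \<open>Q\<close> of \<open>Re\<close> represents the functor
  \<open>N \<mapsto> eN\<close>; the generator \<open>q\<close> is the class of \<open>e\<close>. Elements of \<open>eRe\<close> survive in \<open>Q\<close>, as
  \<open>Rx = 0\<close> implies \<open>x = ex = 0\<close> for them, and so \<open>eRe\<close> acts faithfully on \<open>Q\<close> from the right.
\<close>

lemma idempotent_module:
  fixes R :: "'a ring" and j :: "'a \<Rightarrow> 'm"
  assumes R: "idempotent_rng R" and j: "inj j" and e: "e \<in> carrier R" "e = e \<otimes>\<^bsub>R\<^esub> e"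
  shows "\<exists>(Q :: ('a, 'm) module) q. Q \<in> obj (module_category R) \<and> q \<in> carrier Q \<and> e \<odot>\<^bsub>Q\<^esub> q = q \<and>
    (\<forall>(N :: ('a, 'm) module). \<forall>f\<in>module_homs R Q N. \<forall>g\<in>module_homs R Q N. f q = g q \<longrightarrow> f = g) \<and>
    (\<forall>(N :: ('a, 'm) module)\<in>obj (module_category R). \<forall>y\<in>carrier N. e \<odot>\<^bsub>N\<^esub> y = y \<longrightarrow>
       (\<exists>f\<in>module_homs R Q N. f q = y)) \<and>
    rng_isomorphic (corner R e) (opposite_endomorphism_rng R Q)"
proof -
  interpret R: rng R using R by (simp add: idempotent_rng_def)
  note ee = e(2)[symmetric]
  \<comment> \<open>As \<open>e\<close> is idempotent, this is \<open>Re\<close>.\<close>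
  define L where "L = {x \<in> carrier R. x \<otimes>\<^bsub>R\<^esub> e = x}"
  have Lc: "x \<in> carrier R" "x \<otimes>\<^bsub>R\<^esub> e = x" if "x \<in> L" for x using that by (auto simp: L_def)
  have eL: "e \<in> L" using e(1) ee by (simp add: L_def)
  have neg: "\<ominus>\<^bsub>R\<^esub> x \<otimes>\<^bsub>R\<^esub> e = \<ominus>\<^bsub>R\<^esub> (x \<otimes>\<^bsub>R\<^esub> e)" if x: "x \<in> carrier R" for x
  proof -
    have "\<ominus>\<^bsub>R\<^esub> x \<otimes>\<^bsub>R\<^esub> e \<oplus>\<^bsub>R\<^esub> x \<otimes>\<^bsub>R\<^esub> e = \<zero>\<^bsub>R\<^esub>"
      using x e(1) by (simp add: R.rng_l_distr[symmetric] R.l_neg R.rng_l_null)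
    then show ?thesis using x e(1) by (simp add: R.minus_equality R.rng_m_closed)
  qed
  have L_subgroup: "subgroup L (add_monoid R)"
  proof (rule R.add.subgroupI)
    show "L \<subseteq> carrier R" by (auto simp: L_def)
    show "L \<noteq> {}" using eL by blast
    show "\<ominus>\<^bsub>R\<^esub> x \<in> L" if "x \<in> L" for x using that by (simp add: L_def neg)
    show "x \<oplus>\<^bsub>R\<^esub> y \<in> L" if "x \<in> L" "y \<in> L" for x y
      using that e(1) by (simp add: L_def R.rng_l_distr)
  qed
  have L_mult: "\<forall>r\<in>carrier R. \<forall>x\<in>L. r \<otimes>\<^bsub>R\<^esub> x \<in> L"
    using e(1) by (simp add: L_def R.rng_m_assoc R.rng_m_closed)
  have gen: "generate (add_monoid R) {r \<otimes>\<^bsub>R\<^esub> x | r x. r \<in> carrier R \<and> x \<in> L} = L" (is "?G = L")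
  proof
    show "?G \<subseteq> L"
      by (rule R.add.generate_subgroup_incl[OF _ L_subgroup]) (use L_mult in auto)
    show "L \<subseteq> ?G"
    proof
      fix x assume x: "x \<in> L"
      have "x \<otimes>\<^bsub>R\<^esub> e \<in> ?G" using Lc(1)[OF x] eL by (intro generate.incl) blast
      then show "x \<in> ?G" using Lc(2)[OF x] by simp
    qed
  qed
  obtain Q :: "('a, 'm) module" and \<kappa> where Q: "Q \<in> obj (module_category R)" and im: "\<kappa> ` L = carrier Q"
    and \<kappa>_add: "\<forall>x\<in>L. \<forall>y\<in>L. \<kappa> (x \<oplus>\<^bsub>R\<^esub> y) = \<kappa> x \<oplus>\<^bsub>Q\<^esub> \<kappa> y"
    and \<kappa>_mult: "\<forall>r\<in>carrier R. \<forall>x\<in>L. \<kappa> (r \<otimes>\<^bsub>R\<^esub> x) = r \<odot>\<^bsub>Q\<^esub> \<kappa> x"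
    and \<kappa>_iff: "\<forall>x\<in>L. \<forall>y\<in>L. \<kappa> x = \<kappa> y \<longleftrightarrow> (\<forall>r\<in>carrier R. r \<otimes>\<^bsub>R\<^esub> x = r \<otimes>\<^bsub>R\<^esub> y)"
    and ext: "\<forall>(N :: ('a, 'm) module)\<in>obj (module_category R). \<forall>y\<in>carrier N.
       \<exists>f\<in>module_homs R Q N. \<forall>x\<in>L. f (\<kappa> x) = x \<odot>\<^bsub>N\<^esub> y"
    using left_ideal_module[OF R L_subgroup L_mult gen j] by (elim exE conjE) blast
  note \<kappa>_add = bspec[OF bspec[OF \<kappa>_add]] and \<kappa>_mult = bspec[OF bspec[OF \<kappa>_mult]]
    and \<kappa>_iff = bspec[OF bspec[OF \<kappa>_iff]] and ext = bspec[OF bspec[OF ext]]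
  interpret Q: left_module R Q using module_objD(1)[OF Q] .
  have \<kappa>_closed: "\<kappa> x \<in> carrier Q" if "x \<in> L" for x using im that by blast
  have \<kappa>_gen: "\<kappa> x = x \<odot>\<^bsub>Q\<^esub> \<kappa> e" if "x \<in> L" for x
    using \<kappa>_mult[OF Lc(1)[OF that] eL] Lc(2)[OF that] by simp
  have hom_\<kappa>: "f (\<kappa> x) = x \<odot>\<^bsub>N\<^esub> f (\<kappa> e)" if "f \<in> module_homs R Q N" "x \<in> L" for x f and N :: "('a, 'm) module"
  proof -
    have "linear_map R Q N f" using that(1) by (simp add: module_homs_iff)
    from linear_mapD(3)[OF this Lc(1)[OF that(2)] \<kappa>_closed[OF eL]]
    show ?thesis using \<kappa>_gen[OF that(2)] by simp
  qed
  have q: "\<kappa> e \<in> carrier Q" "e \<odot>\<^bsub>Q\<^esub> \<kappa> e = \<kappa> e"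
    using \<kappa>_closed[OF eL] \<kappa>_gen[OF eL] by simp_all
  have unique: "f = g" if "f \<in> module_homs R Q N" "g \<in> module_homs R Q N" "f (\<kappa> e) = g (\<kappa> e)"
    for f g and N :: "('a, 'm) module"
  proof (rule module_homs_eqI[OF that(1,2)])
    fix u assume "u \<in> carrier Q"
    then obtain x where "u = \<kappa> x" "x \<in> L" using im by blast
    then show "f u = g u" using hom_\<kappa>[OF that(1)] hom_\<kappa>[OF that(2)] that(3) by simp
  qed
  have exists: "\<exists>f\<in>module_homs R Q N. f (\<kappa> e) = y"
    if N: "N \<in> obj (module_category R)" "y \<in> carrier N" "e \<odot>\<^bsub>N\<^esub> y = y" for y and N :: "('a, 'm) module"
  proof -
    obtain f where "f \<in> module_homs R Q N" "\<forall>x\<in>L. f (\<kappa> x) = x \<odot>\<^bsub>N\<^esub> y"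
      using ext[OF N(1,2)] by blast
    then show ?thesis using eL N(3) by (intro bexI[of _ f]) simp_all
  qed
  have C: "s \<in> carrier (corner R e) \<longleftrightarrow> s \<in> carrier R \<and> e \<otimes>\<^bsub>R\<^esub> s = s \<and> s \<otimes>\<^bsub>R\<^esub> e = s" for s
    by (rule R.corner_iff[OF e])
  have CL: "s \<in> L" "s \<in> carrier R" "e \<otimes>\<^bsub>R\<^esub> s = s" if "s \<in> carrier (corner R e)" for s
    using that by (auto simp: C L_def)
  have "\<forall>s\<in>carrier (corner R e). \<exists>f\<in>module_homs R Q Q. \<forall>x\<in>L. f (\<kappa> x) = x \<odot>\<^bsub>Q\<^esub> \<kappa> s"
    using ext[OF Q] \<kappa>_closed CL by blast
  then obtain \<Theta> where \<Theta>: "\<And>s. s \<in> carrier (corner R e) \<Longrightarrow> \<Theta> s \<in> module_homs R Q Q"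
    and \<Theta>_\<kappa>: "\<And>s x. s \<in> carrier (corner R e) \<Longrightarrow> x \<in> L \<Longrightarrow> \<Theta> s (\<kappa> x) = x \<odot>\<^bsub>Q\<^esub> \<kappa> s"
    by metis
  have \<Theta>_e: "\<Theta> s (\<kappa> e) = \<kappa> s" if s: "s \<in> carrier (corner R e)" for s
    using \<Theta>_\<kappa>[OF s eL] \<kappa>_mult[OF e(1) CL(1)[OF s]] CL(3)[OF s] by simp
  have "\<Theta> \<in> rng_iso (corner R e) (opposite_endomorphism_rng R Q)"
    unfolding rng_iso_def
  proof (intro CollectI conjI ballI)
    show "bij_betw \<Theta> (carrier (corner R e)) (carrier (opposite_endomorphism_rng R Q))"
      unfolding bij_betw_def
    proof
      show "inj_on \<Theta> (carrier (corner R e))"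
      proof (rule inj_onI)
        fix s t assume s: "s \<in> carrier (corner R e)" and t: "t \<in> carrier (corner R e)" and eq: "\<Theta> s = \<Theta> t"
        have "\<kappa> s = \<kappa> t" using \<Theta>_e[OF s] \<Theta>_e[OF t] eq by simp
        then have "e \<otimes>\<^bsub>R\<^esub> s = e \<otimes>\<^bsub>R\<^esub> t" using \<kappa>_iff[OF CL(1)[OF s] CL(1)[OF t]] e(1) by blast
        then show "s = t" using CL(3)[OF s] CL(3)[OF t] by simp
      qed
      have "f \<in> \<Theta> ` carrier (corner R e)" if f: "f \<in> module_homs R Q Q" for f
      proof -
        have "f (\<kappa> e) \<in> carrier Q" using f q(1) linear_mapD(1) by (auto simp: module_homs_iff)
        then obtain l where l: "f (\<kappa> e) = \<kappa> l" "l \<in> L" using im by (metis imageE)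
        define s where "s = e \<otimes>\<^bsub>R\<^esub> l"
        have s: "s \<in> carrier (corner R e)"
          using Lc[OF l(2)] e(1) by (simp add: C s_def R.rng_m_closed R.rng_m_assoc)
            (simp add: R.rng_m_assoc[symmetric] ee)
        have "f (\<kappa> e) = e \<odot>\<^bsub>Q\<^esub> f (\<kappa> e)" by (rule hom_\<kappa>[OF f eL])
        also have "\<dots> = \<kappa> s" unfolding l(1) s_def by (rule \<kappa>_mult[OF e(1) l(2), symmetric])
        also have "\<dots> = \<Theta> s (\<kappa> e)" by (rule \<Theta>_e[OF s, symmetric])
        finally have "f = \<Theta> s" by (rule unique[OF f \<Theta>[OF s]])
        then show ?thesis using s by blast
      qed
      then show "\<Theta> ` carrier (corner R e) = carrier (opposite_endomorphism_rng R Q)"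
        using \<Theta> by (auto simp: opposite_endomorphism_rng_def)
    qed
  next
    fix s t assume s: "s \<in> carrier (corner R e)" and t: "t \<in> carrier (corner R e)"
    interpret C: rng "corner R e" by (rule R.rng_corner[OF e])
    have st: "s \<oplus>\<^bsub>R\<^esub> t \<in> carrier (corner R e)" "s \<otimes>\<^bsub>R\<^esub> t \<in> carrier (corner R e)"
      using C.a_closed[OF s t] C.rng_m_closed[OF s t] by (simp_all add: corner_def)
    have "\<Theta> (s \<oplus>\<^bsub>R\<^esub> t) = hom_add Q Q (\<Theta> s) (\<Theta> t)"
    proof (rule unique[OF \<Theta>[OF st(1)] hom_add_in_homs[OF Q Q \<Theta>[OF s] \<Theta>[OF t]]])
      show "\<Theta> (s \<oplus>\<^bsub>R\<^esub> t) (\<kappa> e) = hom_add Q Q (\<Theta> s) (\<Theta> t) (\<kappa> e)"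
        using q(1) CL(1) s t by (simp add: hom_add_def \<Theta>_e st \<kappa>_add)
    qed
    then show "\<Theta> (s \<oplus>\<^bsub>corner R e\<^esub> t) = \<Theta> s \<oplus>\<^bsub>opposite_endomorphism_rng R Q\<^esub> \<Theta> t"
      by (simp add: corner_def opposite_endomorphism_rng_def)
    have "\<Theta> (s \<otimes>\<^bsub>R\<^esub> t) = compose (carrier Q) (\<Theta> t) (\<Theta> s)"
    proof (rule unique[OF \<Theta>[OF st(2)] module_homs_compose[OF Q \<Theta>[OF s] \<Theta>[OF t]]])
      have "compose (carrier Q) (\<Theta> t) (\<Theta> s) (\<kappa> e) = \<Theta> t (\<kappa> s)"
        using q(1) by (simp add: compose_def \<Theta>_e[OF s])
      also have "\<dots> = \<kappa> (s \<otimes>\<^bsub>R\<^esub> t)"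
        using \<Theta>_\<kappa>[OF t CL(1)[OF s]] \<kappa>_mult[OF CL(2)[OF s] CL(1)[OF t]] by simp
      finally show "\<Theta> (s \<otimes>\<^bsub>R\<^esub> t) (\<kappa> e) = compose (carrier Q) (\<Theta> t) (\<Theta> s) (\<kappa> e)"
        using \<Theta>_e[OF st(2)] by simp
    qed
    then show "\<Theta> (s \<otimes>\<^bsub>corner R e\<^esub> t) = \<Theta> s \<otimes>\<^bsub>opposite_endomorphism_rng R Q\<^esub> \<Theta> t"
      by (simp add: corner_def opposite_endomorphism_rng_def)
  qed
  then have iso: "rng_isomorphic (corner R e) (opposite_endomorphism_rng R Q)"
    by (auto simp: rng_isomorphic_def)
  show ?thesis
    by (intro exI[of _ Q] exI[of _ "\<kappa> e"] conjI allI ballI impI Q q iso unique exists)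
qed

section \<open>Transfer along an equivalence\<close>

lemma isomorphism_in_modulesD:
  assumes "isomorphism_in (module_category R) M N i" "M \<in> obj (module_category R)" "N \<in> obj (module_category R)"
  shows "i \<in> module_homs R M N"
    and "\<exists>i'\<in>module_homs R N M. (\<forall>x\<in>carrier M. i' (i x) = x) \<and> (\<forall>y\<in>carrier N. i (i' y) = y)"
proof -
  obtain i' where i: "i \<in> module_homs R M N" "i' \<in> module_homs R N M"
    and eq: "compose (carrier M) i' i = restrict (\<lambda>x. x) (carrier M)"
      "compose (carrier N) i i' = restrict (\<lambda>x. x) (carrier N)"
    using assms(1) by (auto simp: isomorphism_in_def module_category_simps)
  have "i' (i x) = x" if "x \<in> carrier M" for x
    using fun_cong[OF eq(1), of x] that by (simp add: compose_def)
  moreover have "i (i' y) = y" if "y \<in> carrier N" for y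
    using fun_cong[OF eq(2), of y] that by (simp add: compose_def)
  ultimately show "\<exists>i'\<in>module_homs R N M. (\<forall>x\<in>carrier M. i' (i x) = x) \<and> (\<forall>y\<in>carrier N. i (i' y) = y)"
    using i(2) by blast
  show "i \<in> module_homs R M N" by (rule i(1))
qed

text \<open>
  Conjugation of \<open>F(f)\<close> by the isomorphism \<open>F(P) \<cong> Q\<close>; it respects sums because \<open>F\<close> does.
\<close>

lemma endomorphism_rng_transfer:
  fixes F :: "(('a, 'm) module, 'm \<Rightarrow> 'm, ('a, 'm) module, 'm \<Rightarrow> 'm) functor_data"
  assumes inf: "infinite (UNIV :: 'm set)"
    and F: "is_functor (module_category R) (module_category S) F"
    and ff: "fully_faithful (module_category R) (module_category S) F"
    and P: "P \<in> obj (module_category R)" and Q: "Q \<in> obj (module_category S)"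
    and iso: "isomorphism_in (module_category S) (fobj F P) Q i"
  shows "rng_isomorphic (opposite_endomorphism_rng R P) (opposite_endomorphism_rng S Q)"
proof -
  have FP: "fobj F P \<in> obj (module_category S)" using F P by (simp add: is_functor_def)
  note i = isomorphism_in_modulesD(1)[OF iso FP Q]
  obtain i' where i': "i' \<in> module_homs S Q (fobj F P)"
    and i'i: "\<forall>x\<in>carrier (fobj F P). i' (i x) = x" and ii': "\<forall>y\<in>carrier Q. i (i' y) = y"
    using isomorphism_in_modulesD(2)[OF iso FP Q] by (elim bexE conjE)
  note i'i = bspec[OF i'i] and ii' = bspec[OF ii']
  have li: "linear_map S (fobj F P) Q i" and li': "linear_map S Q (fobj F P) i'"
    using i i' by (auto simp: module_homs_iff)
  note icl = linear_mapD(1)[OF li] linear_mapD(1)[OF li']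
  have Fm: "fmor F P P f \<in> module_homs S (fobj F P) (fobj F P)" if "f \<in> module_homs R P P" for f
    using F P that by (auto simp: is_functor_def module_category_simps)
  have Fcl: "fmor F P P f x \<in> carrier (fobj F P)" if "f \<in> module_homs R P P" "x \<in> carrier (fobj F P)" for f x
  proof -
    have "linear_map S (fobj F P) (fobj F P) (fmor F P P f)" using Fm[OF that(1)] by (simp add: module_homs_iff)
    then show ?thesis using that(2) by (rule linear_mapD(1))
  qed
  define \<Psi> where "\<Psi> f = restrict (\<lambda>y. i (fmor F P P f (i' y))) (carrier Q)" for f
  have \<Psi>: "\<Psi> f \<in> module_homs S Q Q" if f: "f \<in> module_homs R P P" for f
  proof -
    have "\<Psi> f = compose (carrier Q) i (compose (carrier Q) (fmor F P P f) i')"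
      by (auto simp: \<Psi>_def compose_def)
    then show ?thesis
      using module_homs_compose[OF Q module_homs_compose[OF Q i' Fm[OF f]] i] by simp
  qed
  have "\<Psi> \<in> rng_iso (opposite_endomorphism_rng R P) (opposite_endomorphism_rng S Q)"
    unfolding rng_iso_def
  proof (intro CollectI conjI ballI)
    show "bij_betw \<Psi> (carrier (opposite_endomorphism_rng R P)) (carrier (opposite_endomorphism_rng S Q))"
      unfolding bij_betw_def
    proof
      have "f = g" if f: "f \<in> module_homs R P P" and g: "g \<in> module_homs R P P" and eq: "\<Psi> f = \<Psi> g" for f g
      proof (rule inj_onD[OF fully_faithful_modulesD(1)[OF ff P P] _ f g])
        show "fmor F P P f = fmor F P P g"
        proof (rule module_homs_eqI[OF Fm[OF f] Fm[OF g]])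
          fix x assume x: "x \<in> carrier (fobj F P)"
          have "i (fmor F P P f x) = i (fmor F P P g x)"
            using fun_cong[OF eq, of "i x"] x by (simp add: \<Psi>_def icl i'i)
          from arg_cong[OF this, of i'] show "fmor F P P f x = fmor F P P g x"
            unfolding i'i[OF Fcl[OF f x]] i'i[OF Fcl[OF g x]] .
        qed
      qed
      then show "inj_on \<Psi> (carrier (opposite_endomorphism_rng R P))"
        by (auto simp: inj_on_def opposite_endomorphism_rng_def)
      have "k \<in> \<Psi> ` module_homs R P P" if k: "k \<in> module_homs S Q Q" for k
      proof -
        have lk: "linear_map S Q Q k" using k by (simp add: module_homs_iff)
        have "compose (carrier (fobj F P)) i' (compose (carrier (fobj F P)) k i) \<in> module_homs S (fobj F P) (fobj F P)"
          by (rule module_homs_compose[OF FP module_homs_compose[OF FP i k] i'])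
        then obtain f where f: "f \<in> module_homs R P P"
          and Ff: "fmor F P P f = compose (carrier (fobj F P)) i' (compose (carrier (fobj F P)) k i)"
          using fully_faithful_modulesD(2)[OF ff P P] by blast
        have "\<Psi> f = k"
          by (rule module_homs_eqI[OF \<Psi>[OF f] k])
            (simp add: \<Psi>_def Ff compose_def icl ii' linear_mapD(1)[OF lk])
        then show ?thesis using f by blast
      qed
      then show "\<Psi> ` carrier (opposite_endomorphism_rng R P) = carrier (opposite_endomorphism_rng S Q)"
        using \<Psi> by (auto simp: opposite_endomorphism_rng_def)
    qed
  next
    fix f g
    assume "f \<in> carrier (opposite_endomorphism_rng R P)" "g \<in> carrier (opposite_endomorphism_rng R P)"
    then have f: "f \<in> module_homs R P P" and g: "g \<in> module_homs R P P"
      by (simp_all add: opposite_endomorphism_rng_def)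
    have "\<Psi> (hom_add P P f g) = hom_add Q Q (\<Psi> f) (\<Psi> g)"
      unfolding \<Psi>_def fully_faithful_add[OF inf F ff P P f g] unfolding hom_add_def
      by (rule restrict_ext) (simp add: icl linear_mapD(2)[OF li] Fcl[OF f] Fcl[OF g])
    then show "\<Psi> (f \<oplus>\<^bsub>opposite_endomorphism_rng R P\<^esub> g) = \<Psi> f \<oplus>\<^bsub>opposite_endomorphism_rng S Q\<^esub> \<Psi> g"
      by (simp add: opposite_endomorphism_rng_def)
    have "\<Psi> (compose (carrier P) g f) = compose (carrier Q) (\<Psi> g) (\<Psi> f)"
      unfolding \<Psi>_def functor_compose[OF F P P P f g] unfolding compose_def
      by (rule restrict_ext) (simp add: icl i'i Fcl[OF f] Fcl[OF g])
    then show "\<Psi> (f \<otimes>\<^bsub>opposite_endomorphism_rng R P\<^esub> g) = \<Psi> f \<otimes>\<^bsub>opposite_endomorphism_rng S Q\<^esub> \<Psi> g"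
      by (simp add: opposite_endomorphism_rng_def)
  qed
  then show ?thesis by (auto simp: rng_isomorphic_def)
qed

text \<open>
  The family \<open>\<rho>\<close> is jointly epic: if \<open>h\<close> vanishes on its images, then \<open>rh(x) = h(rx) = 0\<close> for all
  \<open>r\<close> and \<open>x\<close>, so \<open>h = 0\<close> by nondegeneracy of the codomain. A fully faithful and essentially surjective
  functor preserves this. If the images of the transferred family generated a proper subgroup \<open>T\<close> of
  \<open>Q \<cong> FP\<close>, which is a submodule, then \<open>K = {q. Sq \<subseteq> T}\<close> would be proper as well, because
  \<open>Q = SQ\<close>. The projection of \<open>Q\<close> onto the nondegenerate module \<open>Q/K\<close> would be a nonzero
  morphism that vanishes on the whole family.
\<close>

lemma generating_family_transfer:
  fixes F :: "(('a, 'm) module, 'm \<Rightarrow> 'm, ('a, 'm) module, 'm \<Rightarrow> 'm) functor_data"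
  assumes S: "idempotent_rng S"
    and F: "is_functor (module_category R) (module_category S) F"
    and ff: "fully_faithful (module_category R) (module_category S) F"
    and ess: "\<And>Z. Z \<in> obj (module_category S) \<Longrightarrow>
      \<exists>X\<in>obj (module_category R). \<exists>i. isomorphism_in (module_category S) (fobj F X) Z i"
    and P: "P \<in> obj (module_category R)" and Q: "Q \<in> obj (module_category S)"
    and U: "U \<in> obj (module_category R)"
    and iso: "isomorphism_in (module_category S) (fobj F P) Q i"
    and \<rho>: "\<And>x. x \<in> carrier P \<Longrightarrow> \<rho> x \<in> module_homs R U P"
    and \<rho>_gen: "\<And>r x. r \<in> carrier R \<Longrightarrow> x \<in> carrier P \<Longrightarrow> \<exists>u\<in>carrier U. \<rho> x u = r \<odot>\<^bsub>P\<^esub> x"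
  shows "generate (add_monoid Q) {i (fmor F U P (\<rho> x) u) | x u. x \<in> carrier P \<and> u \<in> carrier (fobj F U)} = carrier Q"
proof -
  interpret P: left_module R P using module_objD(1)[OF P] .
  interpret Q: left_module S Q using module_objD(1)[OF Q] .
  have FP: "fobj F P \<in> obj (module_category S)" and FU: "fobj F U \<in> obj (module_category S)"
    using F P U by (simp_all add: is_functor_def)
  interpret FU: left_module S "fobj F U" using module_objD(1)[OF FU] .
  note i = isomorphism_in_modulesD(1)[OF iso FP Q]
  obtain i' where i': "i' \<in> module_homs S Q (fobj F P)"
    and i'i: "\<forall>x\<in>carrier (fobj F P). i' (i x) = x" and ii': "\<forall>y\<in>carrier Q. i (i' y) = y"
    using isomorphism_in_modulesD(2)[OF iso FP Q] by (elim bexE conjE)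
  note i'i = bspec[OF i'i] and ii' = bspec[OF ii']
  have li: "linear_map S (fobj F P) Q i" and li': "linear_map S Q (fobj F P) i'"
    using i i' by (auto simp: module_homs_iff)
  have F\<rho>: "fmor F U P (\<rho> x) \<in> module_homs S (fobj F U) (fobj F P)" if "x \<in> carrier P" for x
    using F P U \<rho>[OF that] by (auto simp: is_functor_def module_category_simps)
  have lF\<rho>: "linear_map S (fobj F U) (fobj F P) (fmor F U P (\<rho> x))" if "x \<in> carrier P" for x
    using F\<rho>[OF that] by (simp add: module_homs_iff)
  define G where "G = {i (fmor F U P (\<rho> x) u) | x u. x \<in> carrier P \<and> u \<in> carrier (fobj F U)}"
  have G: "i (fmor F U P (\<rho> x) u) \<in> G" if "x \<in> carrier P" "u \<in> carrier (fobj F U)" for x u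
    unfolding G_def using that by blast
  define T where "T = generate (add_monoid Q) G"
  have G_closed: "G \<subseteq> carrier Q"
    unfolding G_def using linear_mapD(1)[OF li] linear_mapD(1)[OF lF\<rho>] by blast
  have G_T: "h \<in> T" if "h \<in> G" for h
    unfolding T_def using that by (rule generate.incl)
  have T_subgroup: "subgroup T (add_monoid Q)"
    unfolding T_def by (rule Q.M.add.generate_is_subgroup[OF G_closed])
  have T_closed: "t \<in> carrier Q" if "t \<in> T" for t
    using subgroup.mem_carrier[OF T_subgroup that] by simp
  have T_add: "t \<oplus>\<^bsub>Q\<^esub> t' \<in> T" if "t \<in> T" "t' \<in> T" for t t'
    using subgroup.m_closed[OF T_subgroup that] by simp
  have T_neg: "\<ominus>\<^bsub>Q\<^esub> t \<in> T" if "t \<in> T" for t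
    using subgroup.m_inv_closed[OF T_subgroup that] by (simp add: a_inv_def)
  have T_zero: "\<zero>\<^bsub>Q\<^esub> \<in> T" using subgroup.one_closed[OF T_subgroup] by simp
  have G_smult: "s \<odot>\<^bsub>Q\<^esub> h \<in> G" if s: "s \<in> carrier S" and h: "h \<in> G" for s h
  proof -
    obtain x u where h: "h = i (fmor F U P (\<rho> x) u)" "x \<in> carrier P" "u \<in> carrier (fobj F U)"
      using h unfolding G_def by blast
    have "s \<odot>\<^bsub>Q\<^esub> h = i (fmor F U P (\<rho> x) (s \<odot>\<^bsub>fobj F U\<^esub> u))"
      using h s by (simp add: linear_mapD(3)[OF li] linear_mapD[OF lF\<rho>])
    then show ?thesis using G[OF h(2) FU.lm_smult_closed[OF s h(3)]] by simp
  qed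
  have T_smult: "s \<odot>\<^bsub>Q\<^esub> t \<in> T" if s: "s \<in> carrier S" and "t \<in> T" for s t
    using that(2) unfolding T_def
  proof (induction rule: generate.induct)
    case one
    then show ?case using T_zero s by (simp add: Q.smult_r_null T_def)
  next
    case (incl h)
    then show ?case using G_T[OF G_smult[OF s]] by (simp only: T_def)
  next
    case (inv h)
    have h: "h \<in> carrier Q" using inv G_closed by blast
    have "\<ominus>\<^bsub>Q\<^esub> (s \<odot>\<^bsub>Q\<^esub> h) \<in> T"
      by (rule T_neg[OF G_T[OF G_smult[OF s inv]]])
    then show ?case using Q.smult_r_minus[OF s h] by (simp add: a_inv_def T_def)
  next
    case (eng t t')
    then show ?case using s T_add T_closed by (simp add: Q.lm_smult_r_distr T_def)
  qed
  define K where "K = {q \<in> carrier Q. \<forall>s\<in>carrier S. s \<odot>\<^bsub>Q\<^esub> q \<in> T}"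
  have K_subgroup: "subgroup K (add_monoid Q)"
  proof (rule Q.M.add.subgroupI)
    show "K \<subseteq> carrier Q" by (auto simp: K_def)
    show "K \<noteq> {}" using T_zero Q.smult_r_null by (auto simp: K_def)
    show "\<ominus>\<^bsub>Q\<^esub> q \<in> K" if "q \<in> K" for q using that T_neg by (simp add: K_def Q.smult_r_minus)
    show "q \<oplus>\<^bsub>Q\<^esub> q' \<in> K" if "q \<in> K" "q' \<in> K" for q q'
      using that T_add by (simp add: K_def Q.lm_smult_r_distr)
  qed
  have T_K: "T \<subseteq> K" using T_smult T_closed by (auto simp: K_def)
  have K_smult: "\<forall>s\<in>carrier S. \<forall>q\<in>K. s \<odot>\<^bsub>Q\<^esub> q \<in> K"
    using T_K by (auto simp: K_def)
  have K_sat: "\<forall>q\<in>carrier Q. (\<forall>s\<in>carrier S. s \<odot>\<^bsub>Q\<^esub> q \<in> K) \<longrightarrow> q \<in> K"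
  proof (intro ballI impI)
    fix q assume q: "q \<in> carrier Q" and *: "\<forall>s\<in>carrier S. s \<odot>\<^bsub>Q\<^esub> q \<in> K"
    have "s \<odot>\<^bsub>Q\<^esub> q \<in> T" if "s \<in> carrier S" for s
      by (rule idempotent_smult_in_subgroup[OF S Q.left_module_axioms T_subgroup q that])
        (use * in \<open>auto simp: K_def\<close>)
    then show "q \<in> K" using q by (simp add: K_def)
  qed
  obtain N :: "('a, 'm) module" and \<pi> where N: "N \<in> obj (module_category S)"
    and l\<pi>: "linear_map S Q N \<pi>"
    and \<pi>_iff: "\<forall>q\<in>carrier Q. \<forall>q'\<in>carrier Q. \<pi> q = \<pi> q' \<longleftrightarrow> q \<ominus>\<^bsub>Q\<^esub> q' \<in> K"
    using quotient_module[OF Q.left_module_axioms module_objD(2)[OF Q] inj_on_id K_subgroup K_smult K_sat]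
    by (elim exE conjE)
  note \<pi>_iff = bspec[OF bspec[OF \<pi>_iff]]
  interpret N: left_module S N using module_objD(1)[OF N] .
  have \<pi>_zero: "\<pi> q = \<zero>\<^bsub>N\<^esub> \<longleftrightarrow> q \<in> K" if q: "q \<in> carrier Q" for q
  proof -
    have "\<ominus>\<^bsub>Q\<^esub> \<zero>\<^bsub>Q\<^esub> = \<zero>\<^bsub>Q\<^esub>" by (rule Q.M.minus_equality) simp_all
    then have "q \<ominus>\<^bsub>Q\<^esub> \<zero>\<^bsub>Q\<^esub> = q" using q by (simp add: a_minus_def)
    then show ?thesis
      using \<pi>_iff[OF q Q.M.zero_closed] linear_map_null[OF l\<pi> Q.left_module_axioms N.left_module_axioms] by simp
  qed
  obtain P' j where P': "P' \<in> obj (module_category R)" and jiso: "isomorphism_in (module_category S) (fobj F P') N j"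
    using ess[OF N] by blast
  interpret P': left_module R P' using module_objD(1)[OF P'] .
  have FP': "fobj F P' \<in> obj (module_category S)" using F P' by (simp add: is_functor_def)
  note j = isomorphism_in_modulesD(1)[OF jiso FP' N]
  obtain j' where j': "j' \<in> module_homs S N (fobj F P')" and jj': "\<forall>y\<in>carrier N. j (j' y) = y"
    using isomorphism_in_modulesD(2)[OF jiso FP' N] by (elim bexE conjE)
  note jj' = bspec[OF jj']
  have lj: "linear_map S (fobj F P') N j" and lj': "linear_map S N (fobj F P') j'"
    using j j' by (auto simp: module_homs_iff)
  interpret FP': left_module S "fobj F P'" using module_objD(1)[OF FP'] .
  \<comment> \<open>The projection \<open>\<pi>\<close> comes from a morphism \<open>h\<close> on \<open>P\<close> that vanishes on the images of the \<open>\<rho> x\<close>.\<close>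
  define k where "k = compose (carrier (fobj F P)) j' (compose (carrier (fobj F P)) (restrict \<pi> (carrier Q)) i)"
  have "restrict \<pi> (carrier Q) \<in> module_homs S Q N"
    using l\<pi> by (simp add: module_homs_iff linear_map_restrict[OF Q.left_module_axioms])
  then have "k \<in> module_homs S (fobj F P) (fobj F P')"
    unfolding k_def by (intro module_homs_compose[OF FP _ j'] module_homs_compose[OF FP i])
  then obtain h where h: "h \<in> module_homs R P P'" and Fh: "fmor F P P' h = k"
    using fully_faithful_modulesD(2)[OF ff P P'] by blast
  have lh: "linear_map R P P' h" using h by (simp add: module_homs_iff)
  have k: "k p = j' (\<pi> (i p))" if "p \<in> carrier (fobj F P)" for p
    using that linear_mapD(1)[OF li] by (simp add: k_def compose_def)
  have h\<rho>: "compose (carrier U) h (\<rho> x) = hom_zero U P'" if x: "x \<in> carrier P" for x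
  proof (rule inj_onD[OF fully_faithful_modulesD(1)[OF ff U P']])
    show "compose (carrier U) h (\<rho> x) \<in> module_homs R U P'" by (rule module_homs_compose[OF U \<rho>[OF x] h])
    show "hom_zero U P' \<in> module_homs R U P'" by (rule hom_zero_in_homs[OF U P'])
    have "compose (carrier (fobj F U)) k (fmor F U P (\<rho> x)) = hom_zero (fobj F U) (fobj F P')"
    proof
      fix u
      show "compose (carrier (fobj F U)) k (fmor F U P (\<rho> x)) u = hom_zero (fobj F U) (fobj F P') u"
      proof (cases "u \<in> carrier (fobj F U)")
        case True
        have p: "fmor F U P (\<rho> x) u \<in> carrier (fobj F P)" by (rule linear_mapD(1)[OF lF\<rho>[OF x] True])
        have "i (fmor F U P (\<rho> x) u) \<in> K" using G_T[OF G[OF x True]] T_K by blast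
        then have "\<pi> (i (fmor F U P (\<rho> x) u)) = \<zero>\<^bsub>N\<^esub>"
          using \<pi>_zero linear_mapD(1)[OF li p] by blast
        then show ?thesis
          using True k[OF p] linear_map_null[OF lj' N.left_module_axioms FP'.left_module_axioms]
          by (simp add: compose_def hom_zero_def)
      qed (simp add: compose_def hom_zero_def)
    qed
    then show "fmor F U P' (compose (carrier U) h (\<rho> x)) = fmor F U P' (hom_zero U P')"
      using functor_compose[OF F U P P' \<rho>[OF x] h] fully_faithful_zero[OF F ff U P'] Fh by simp
  qed
  have "h x = \<zero>\<^bsub>P'\<^esub>" if x: "x \<in> carrier P" for x
  proof -
    have "r \<odot>\<^bsub>P'\<^esub> h x = \<zero>\<^bsub>P'\<^esub>" if r: "r \<in> carrier R" for r
    proof -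
      obtain u where u: "u \<in> carrier U" "\<rho> x u = r \<odot>\<^bsub>P\<^esub> x" using \<rho>_gen[OF r x] by blast
      then have "h (r \<odot>\<^bsub>P\<^esub> x) = \<zero>\<^bsub>P'\<^esub>"
        using fun_cong[OF h\<rho>[OF x], of u] by (simp add: compose_def hom_zero_def)
      then show ?thesis using linear_mapD(3)[OF lh r x] by simp
    qed
    then show ?thesis
      using module_objD(3)[OF P'] linear_mapD(1)[OF lh x] by (simp add: nondegenerate_module_def)
  qed
  then have "h = hom_zero P P'"
    by (intro module_homs_eqI[OF h hom_zero_in_homs[OF P P']]) (simp add: hom_zero_def)
  then have k_zero: "k = hom_zero (fobj F P) (fobj F P')"
    using fully_faithful_zero[OF F ff P P'] Fh by simp
  have "q \<in> K" if q: "q \<in> carrier Q" for q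
  proof -
    have p: "i' q \<in> carrier (fobj F P)" by (rule linear_mapD(1)[OF li' q])
    have "j' (\<pi> q) = \<zero>\<^bsub>fobj F P'\<^esub>" using k[OF p] p ii'[OF q] k_zero by (simp add: hom_zero_def)
    then have "\<pi> q = j \<zero>\<^bsub>fobj F P'\<^esub>" using jj'[OF linear_mapD(1)[OF l\<pi> q]] by simp
    then show ?thesis
      using \<pi>_zero[OF q] linear_map_null[OF lj FP'.left_module_axioms N.left_module_axioms] by simp
  qed
  then have "{s \<odot>\<^bsub>Q\<^esub> q | s q. s \<in> carrier S \<and> q \<in> carrier Q} \<subseteq> T" by (auto simp: K_def)
  then have "generate (add_monoid Q) {s \<odot>\<^bsub>Q\<^esub> q | s q. s \<in> carrier S \<and> q \<in> carrier Q} \<subseteq> T"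
    by (rule Q.M.add.generate_subgroup_incl[OF _ T_subgroup])
  then have "carrier Q \<subseteq> T" using module_objD(2)[OF Q] by (simp add: unital_module_def)
  then show ?thesis using T_closed unfolding T_def G_def by blast
qed

lemma (in abelian_monoid) finsum_append:
  fixes n m :: nat
  assumes "f \<in> {..<n} \<rightarrow> carrier G" "g \<in> {..<m} \<rightarrow> carrier G"
  shows "(\<Oplus>k\<in>{..<n + m}. if k < n then f k else g (k - n)) = (\<Oplus>k\<in>{..<n}. f k) \<oplus> (\<Oplus>k\<in>{..<m}. g k)"
  using assms(2)
proof (induction m)
  case 0
  have "(\<Oplus>k\<in>{..<n}. if k < n then f k else g (k - n)) = (\<Oplus>k\<in>{..<n}. f k)"
    using assms(1) by (intro finsum_cong') auto
  then show ?case using assms(1) by simp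
next
  case (Suc m)
  have cl: "(if k < n then f k else g (k - n)) \<in> carrier G" if "k < n + m" for k
    using assms(1) Suc.prems that by (auto simp: Pi_def)
  have g: "g \<in> {..<m} \<rightarrow> carrier G" "g m \<in> carrier G" using Suc.prems by auto
  have "(\<Oplus>k\<in>{..<n + Suc m}. if k < n then f k else g (k - n))
      = g m \<oplus> (\<Oplus>k\<in>{..<n + m}. if k < n then f k else g (k - n))"
    unfolding add_Suc_right lessThan_Suc using cl g(2) by (subst finsum_insert) auto
  also have "\<dots> = (\<Oplus>k\<in>{..<n}. f k) \<oplus> (g m \<oplus> (\<Oplus>k\<in>{..<m}. g k))"
    using Suc.IH[OF g(1)] assms(1) g by (simp add: a_lcomm)
  also have "g m \<oplus> (\<Oplus>k\<in>{..<m}. g k) = (\<Oplus>k\<in>{..<Suc m}. g k)"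
    unfolding lessThan_Suc using g by (subst finsum_insert) auto
  finally show ?case .
qed

text \<open>
  For every \<open>z\<close> in the submodule generated by the family, \<open>q \<mapsto> ez\<close> defines an endomorphism of \<open>Q\<close>
  which is a finite sum of morphisms that factor through \<open>FU\<close>, where \<open>U\<close> is the nondegenerate
  quotient of \<open>R\<close>. For \<open>z = q\<close> this is the identity. Pulled back to \<open>P\<close>, it says
  that \<open>p = \<Sum> \<rho>\<^sub>x\<^sub>k(g\<^sub>k(p))\<close> for suitable \<open>x\<^sub>k \<in> P\<close> and \<open>g\<^sub>k : P \<rightarrow> U\<close>; the coordinates \<open>c\<^sub>k\<close> are
  representatives of the \<open>g\<^sub>k\<close> in \<open>R\<close>.
\<close>

lemma dual_basis_exists:
  fixes F :: "(('a, 'm) module, 'm \<Rightarrow> 'm, ('a, 'm) module, 'm \<Rightarrow> 'm) functor_data"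
  assumes R: "idempotent_rng R" and S: "idempotent_rng S"
    and inf: "infinite (UNIV :: 'm set)" and j: "inj (j :: 'a \<Rightarrow> 'm)"
    and F: "is_functor (module_category R) (module_category S) F"
    and ff: "fully_faithful (module_category R) (module_category S) F"
    and ess: "\<forall>Z\<in>obj (module_category S).
      \<exists>X\<in>obj (module_category R). \<exists>i. isomorphism_in (module_category S) (fobj F X) Z i"
    and P: "P \<in> obj (module_category R)" and Q: "Q \<in> obj (module_category S)"
    and iso: "isomorphism_in (module_category S) (fobj F P) Q i"
    and e: "e \<in> carrier S" "e = e \<otimes>\<^bsub>S\<^esub> e" and q: "q \<in> carrier Q" "e \<odot>\<^bsub>Q\<^esub> q = q"
    and unique: "\<forall>(N :: ('a, 'm) module). \<forall>f\<in>module_homs S Q N. \<forall>g\<in>module_homs S Q N.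
      f q = g q \<longrightarrow> f = g"
    and exists: "\<forall>(N :: ('a, 'm) module)\<in>obj (module_category S). \<forall>y\<in>carrier N.
      e \<odot>\<^bsub>N\<^esub> y = y \<longrightarrow> (\<exists>f\<in>module_homs S Q N. f q = y)"
  shows "\<exists>n\<ge>1. \<exists>x c. dual_basis R P n x c"
proof -
  interpret R: rng R using R by (simp add: idempotent_rng_def)
  interpret P: left_module R P using module_objD(1)[OF P] .
  interpret Q: left_module S Q using module_objD(1)[OF Q] .
  have R_gen: "generate (add_monoid R) {r \<otimes>\<^bsub>R\<^esub> x | r x. r \<in> carrier R \<and> x \<in> carrier R} = carrier R"
    using R by (simp add: idempotent_rng_def)
  have R_subgroup: "subgroup (carrier R) (add_monoid R)" using R.add.subgroup_self by simp
  have R_ideal: "\<forall>r\<in>carrier R. \<forall>x\<in>carrier R. r \<otimes>\<^bsub>R\<^esub> x \<in> carrier R" by (simp add: R.rng_m_closed)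
  obtain U :: "('a, 'm) module" and \<kappa> where U: "U \<in> obj (module_category R)"
    and im: "\<kappa> ` carrier R = carrier U"
    and \<kappa>_add: "\<forall>x\<in>carrier R. \<forall>y\<in>carrier R. \<kappa> (x \<oplus>\<^bsub>R\<^esub> y) = \<kappa> x \<oplus>\<^bsub>U\<^esub> \<kappa> y"
    and \<kappa>_mult: "\<forall>r\<in>carrier R. \<forall>x\<in>carrier R. \<kappa> (r \<otimes>\<^bsub>R\<^esub> x) = r \<odot>\<^bsub>U\<^esub> \<kappa> x"
    and \<kappa>_iff: "\<forall>x\<in>carrier R. \<forall>y\<in>carrier R.
      \<kappa> x = \<kappa> y \<longleftrightarrow> (\<forall>r\<in>carrier R. r \<otimes>\<^bsub>R\<^esub> x = r \<otimes>\<^bsub>R\<^esub> y)"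
    and ext: "\<forall>(N :: ('a, 'm) module)\<in>obj (module_category R). \<forall>y\<in>carrier N.
       \<exists>f\<in>module_homs R U N. \<forall>x\<in>carrier R. f (\<kappa> x) = x \<odot>\<^bsub>N\<^esub> y"
    using left_ideal_module[OF R R_subgroup R_ideal R_gen j] by (elim exE conjE)
  note \<kappa>_add = bspec[OF bspec[OF \<kappa>_add]] and \<kappa>_mult = bspec[OF bspec[OF \<kappa>_mult]]
    and \<kappa>_iff = bspec[OF bspec[OF \<kappa>_iff]]
  have \<kappa>_closed: "\<kappa> r \<in> carrier U" if "r \<in> carrier R" for r using im that by blast
  obtain \<rho> where "\<forall>x\<in>carrier P. \<rho> x \<in> module_homs R U P \<and> (\<forall>r\<in>carrier R. \<rho> x (\<kappa> r) = r \<odot>\<^bsub>P\<^esub> x)"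
    using bchoice[OF bspec[OF ext P, unfolded Bex_def]] by (elim exE)
  then have \<rho>: "\<And>x. x \<in> carrier P \<Longrightarrow> \<rho> x \<in> module_homs R U P"
    and \<rho>_\<kappa>: "\<And>x r. x \<in> carrier P \<Longrightarrow> r \<in> carrier R \<Longrightarrow> \<rho> x (\<kappa> r) = r \<odot>\<^bsub>P\<^esub> x"
    by simp_all
  have l\<rho>: "linear_map R U P (\<rho> x)" if "x \<in> carrier P" for x
    using \<rho>[OF that] by (simp add: module_homs_iff)
  have FP: "fobj F P \<in> obj (module_category S)" and FU: "fobj F U \<in> obj (module_category S)"
    using F P U by (simp_all add: is_functor_def)
  interpret FP: left_module S "fobj F P" using module_objD(1)[OF FP] .
  interpret FU: left_module S "fobj F U" using module_objD(1)[OF FU] .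
  note i = isomorphism_in_modulesD(1)[OF iso FP Q]
  obtain i' where i': "i' \<in> module_homs S Q (fobj F P)"
    and i'i: "\<forall>x\<in>carrier (fobj F P). i' (i x) = x" and ii': "\<forall>y\<in>carrier Q. i (i' y) = y"
    using isomorphism_in_modulesD(2)[OF iso FP Q] by (elim bexE conjE)
  note i'i = bspec[OF i'i] and ii' = bspec[OF ii']
  have li: "linear_map S (fobj F P) Q i" and li': "linear_map S Q (fobj F P) i'"
    using i i' by (simp_all add: module_homs_iff)
  have i'q: "i' q \<in> carrier (fobj F P)" by (rule linear_mapD(1)[OF li' q(1)])
  have lF: "linear_map S (fobj F X) (fobj F Y) (fmor F X Y f)"
    if "X \<in> obj (module_category R)" "Y \<in> obj (module_category R)" "f \<in> module_homs R X Y" for X Y f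
    using F that by (simp add: is_functor_def module_category_simps module_homs_iff)
  define G where "G = {i (fmor F U P (\<rho> x) u) | x u. x \<in> carrier P \<and> u \<in> carrier (fobj F U)}"
  have T: "generate (add_monoid Q) G = carrier Q"
    unfolding G_def
  proof (rule generating_family_transfer[OF S F ff bspec[OF ess] P Q U iso])
    show "\<exists>u\<in>carrier U. \<rho> x u = r \<odot>\<^bsub>P\<^esub> x" if "r \<in> carrier R" "x \<in> carrier P" for r x
      using \<rho>_\<kappa>[OF that(2,1)] \<kappa>_closed[OF that(1)] by blast
  qed (use \<rho> in auto)
  \<comment> \<open>The bound \<open>n \<ge> 1\<close> excludes the empty matrix ring in the case \<open>P = 0\<close>.\<close>
  define finite_rank where "finite_rank h \<longleftrightarrow> h \<in> module_homs R P P \<and>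
    (\<exists>n\<ge>1::nat. \<exists>x g. (\<forall>k<n. x k \<in> carrier P \<and> g k \<in> module_homs R P U) \<and>
       (\<forall>p\<in>carrier P. h p = (\<Oplus>\<^bsub>P\<^esub>k\<in>{..<n}. \<rho> (x k) (g k p))))" for h
  have gU: "g p \<in> carrier U" if "g \<in> module_homs R P U" "p \<in> carrier P" for g p
    using that linear_mapD(1)[of R P U g] by (simp add: module_homs_iff)
  have single: "finite_rank (compose (carrier P) (\<rho> x) g)"
    if x: "x \<in> carrier P" and g: "g \<in> module_homs R P U" for x g
  proof -
    have "compose (carrier P) (\<rho> x) g p = (\<Oplus>\<^bsub>P\<^esub>k\<in>{..<1::nat}. \<rho> x (g p))" if p: "p \<in> carrier P" for p
      using p linear_mapD(1)[OF l\<rho>[OF x] gU[OF g p]] by (simp add: compose_def lessThan_Suc)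
    then have "\<exists>x' g'. (\<forall>k<1::nat. x' k \<in> carrier P \<and> g' k \<in> module_homs R P U) \<and>
        (\<forall>p\<in>carrier P. compose (carrier P) (\<rho> x) g p = (\<Oplus>\<^bsub>P\<^esub>k\<in>{..<1::nat}. \<rho> (x' k) (g' k p)))"
      using x g by (intro exI[of _ "\<lambda>_. x"] exI[of _ "\<lambda>_. g"]) simp
    then show ?thesis
      unfolding finite_rank_def using module_homs_compose[OF P g \<rho>[OF x]]
      by (intro conjI exI[of _ 1]) simp_all
  qed
  have sum: "finite_rank (hom_add P P h h')" if h: "finite_rank h" and h': "finite_rank h'" for h h'
  proof -
    obtain n :: nat and x g where n: "n \<ge> 1" and xg: "\<forall>k<n. x k \<in> carrier P \<and> g k \<in> module_homs R P U"
      and hp: "\<forall>p\<in>carrier P. h p = (\<Oplus>\<^bsub>P\<^esub>k\<in>{..<n}. \<rho> (x k) (g k p))"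
      using h unfolding finite_rank_def by (elim conjE exE)
    obtain n' :: nat and x' g' where xg': "\<forall>k<n'. x' k \<in> carrier P \<and> g' k \<in> module_homs R P U"
      and hp': "\<forall>p\<in>carrier P. h' p = (\<Oplus>\<^bsub>P\<^esub>k\<in>{..<n'}. \<rho> (x' k) (g' k p))"
      using h' unfolding finite_rank_def by (elim conjE exE)
    define x'' where "x'' k = (if k < n then x k else x' (k - n))" for k
    define g'' where "g'' k = (if k < n then g k else g' (k - n))" for k
    have "hom_add P P h h' p = (\<Oplus>\<^bsub>P\<^esub>k\<in>{..<n + n'}. \<rho> (x'' k) (g'' k p))" if p: "p \<in> carrier P" for p
    proof -
      have "(\<Oplus>\<^bsub>P\<^esub>k\<in>{..<n + n'}. \<rho> (x'' k) (g'' k p))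
          = (\<Oplus>\<^bsub>P\<^esub>k\<in>{..<n + n'}. if k < n then \<rho> (x k) (g k p) else \<rho> (x' (k - n)) (g' (k - n) p))"
        by (rule arg_cong[where f = "\<lambda>f. finsum P f {..<n + n'}"]) (auto simp: x''_def g''_def)
      also have "\<dots> = (\<Oplus>\<^bsub>P\<^esub>k\<in>{..<n}. \<rho> (x k) (g k p)) \<oplus>\<^bsub>P\<^esub> (\<Oplus>\<^bsub>P\<^esub>k\<in>{..<n'}. \<rho> (x' k) (g' k p))"
        using p xg xg' by (intro P.M.finsum_append) (auto simp: gU linear_mapD(1)[OF l\<rho>])
      finally show ?thesis using p hp hp' by (simp add: hom_add_def)
    qed
    moreover have "\<forall>k<n + n'. x'' k \<in> carrier P \<and> g'' k \<in> module_homs R P U"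
      using xg xg' by (auto simp: x''_def g''_def)
    moreover have "hom_add P P h h' \<in> module_homs R P P"
      using hom_add_in_homs[OF P P] h h' by (simp add: finite_rank_def)
    moreover have "n + n' \<ge> 1" using n by simp
    ultimately show ?thesis
      unfolding finite_rank_def by (intro conjI exI[of _ "n + n'"] exI[of _ x''] exI[of _ g'']) simp_all
  qed
  have generator: "\<exists>h. finite_rank h \<and> i (fmor F P P h (i' q)) = e \<odot>\<^bsub>Q\<^esub> i (fmor F U P (\<rho> x) u)"
    if x: "x \<in> carrier P" and u: "u \<in> carrier (fobj F U)" for x u
  proof -
    have eu: "e \<odot>\<^bsub>fobj F U\<^esub> u \<in> carrier (fobj F U)"
      "e \<odot>\<^bsub>fobj F U\<^esub> (e \<odot>\<^bsub>fobj F U\<^esub> u) = e \<odot>\<^bsub>fobj F U\<^esub> u"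
      using e(1) u FU.lm_smult_assoc[OF e(1) e(1) u] e(2)[symmetric] by (simp_all add: FU.lm_smult_closed)
    obtain f where f: "f \<in> module_homs S Q (fobj F U)" "f q = e \<odot>\<^bsub>fobj F U\<^esub> u"
      using exists[rule_format, OF FU eu] by blast
    obtain g where g: "g \<in> module_homs R P U" and Fg: "fmor F P U g = compose (carrier (fobj F P)) f i"
      using fully_faithful_modulesD(2)[OF ff P U module_homs_compose[OF FP i f(1)]] by blast
    have "fmor F P P (compose (carrier P) (\<rho> x) g) (i' q) = fmor F U P (\<rho> x) (f q)"
      unfolding functor_compose[OF F P U P g \<rho>[OF x]] Fg
      using i'q ii'[OF q(1)] by (simp add: compose_def)
    also have "\<dots> = e \<odot>\<^bsub>fobj F P\<^esub> fmor F U P (\<rho> x) u"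
      unfolding f(2) by (rule linear_mapD(3)[OF lF[OF U P \<rho>[OF x]] e(1) u])
    finally have "i (fmor F P P (compose (carrier P) (\<rho> x) g) (i' q)) = e \<odot>\<^bsub>Q\<^esub> i (fmor F U P (\<rho> x) u)"
      using linear_mapD(3)[OF li e(1) linear_mapD(1)[OF lF[OF U P \<rho>[OF x]] u]] by simp
    then show ?thesis using single[OF x g] by blast
  qed
  have "\<exists>h. finite_rank h \<and> i (fmor F P P h (i' q)) = e \<odot>\<^bsub>Q\<^esub> z"
    if "z \<in> generate (add_monoid Q) G" for z
    using that
  proof (induction rule: generate.induct)
    case one
    have "fmor F U P (\<rho> \<zero>\<^bsub>P\<^esub>) \<zero>\<^bsub>fobj F U\<^esub> = \<zero>\<^bsub>fobj F P\<^esub>"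
      by (rule linear_map_null[OF lF[OF U P \<rho>[OF P.M.zero_closed]] FU.left_module_axioms FP.left_module_axioms])
    then show ?case
      using generator[OF P.M.zero_closed FU.M.zero_closed]
        linear_map_null[OF li FP.left_module_axioms Q.left_module_axioms] by simp
  next
    case (incl z)
    then show ?case unfolding G_def using generator by blast
  next
    case (inv z)
    then obtain x u where z: "z = i (fmor F U P (\<rho> x) u)" and x: "x \<in> carrier P" and u: "u \<in> carrier (fobj F U)"
      unfolding G_def by blast
    have "i (fmor F U P (\<rho> x) (\<ominus>\<^bsub>fobj F U\<^esub> u)) = \<ominus>\<^bsub>Q\<^esub> z"
      unfolding z linear_map_minus[OF lF[OF U P \<rho>[OF x]] FU.left_module_axioms FP.left_module_axioms u]
      by (rule linear_map_minus[OF li FP.left_module_axioms Q.left_module_axioms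
            linear_mapD(1)[OF lF[OF U P \<rho>[OF x]] u]])
    then show ?case using generator[OF x FU.M.a_inv_closed[OF u]] by (simp add: a_inv_def)
  next
    case (eng z z')
    then obtain h h' where h: "finite_rank h" "i (fmor F P P h (i' q)) = e \<odot>\<^bsub>Q\<^esub> z"
      and h': "finite_rank h'" "i (fmor F P P h' (i' q)) = e \<odot>\<^bsub>Q\<^esub> z'" by blast
    have hom: "h \<in> module_homs R P P" "h' \<in> module_homs R P P"
      using h(1) h'(1) by (simp_all add: finite_rank_def)
    have zz': "z \<in> carrier Q" "z' \<in> carrier Q" using eng.hyps unfolding T by simp_all
    have "i (fmor F P P (hom_add P P h h') (i' q)) = i (fmor F P P h (i' q)) \<oplus>\<^bsub>Q\<^esub> i (fmor F P P h' (i' q))"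
      unfolding fully_faithful_add[OF inf F ff P P hom] unfolding hom_add_def
      using i'q linear_mapD(1)[OF lF[OF P P hom(1)] i'q] linear_mapD(1)[OF lF[OF P P hom(2)] i'q]
      by (simp add: linear_mapD(2)[OF li])
    also have "\<dots> = e \<odot>\<^bsub>Q\<^esub> (z \<oplus>\<^bsub>Q\<^esub> z')"
      unfolding h(2) h'(2) by (rule Q.lm_smult_r_distr[OF e(1) zz', symmetric])
    finally show ?case using sum[OF h(1) h'(1)] by auto
  qed
  from this[unfolded T, OF q(1)] obtain h where h: "finite_rank h" and hq: "i (fmor F P P h (i' q)) = q"
    using q(2) by auto
  have h_hom: "h \<in> module_homs R P P" using h by (simp add: finite_rank_def)
  have Fh: "fmor F P P h \<in> module_homs S (fobj F P) (fobj F P)"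
    using F P h_hom by (simp add: is_functor_def module_category_simps)
  \<comment> \<open>A morphism on \<open>Q\<close> is determined by its value at \<open>q\<close>, so \<open>F(h)\<close> is conjugate to the identity.\<close>
  have conj_id: "compose (carrier Q) i (compose (carrier Q) (fmor F P P h) i') = restrict (\<lambda>x. x) (carrier Q)"
    by (rule unique[rule_format, OF module_homs_compose[OF Q module_homs_compose[OF Q i' Fh] i] module_homs_id[OF Q]])
      (simp add: compose_def q(1) hq)
  have "fmor F P P h = restrict (\<lambda>x. x) (carrier (fobj F P))"
  proof (rule module_homs_eqI[OF Fh module_homs_id[OF FP]])
    fix x assume x: "x \<in> carrier (fobj F P)"
    have ix: "i x \<in> carrier Q" by (rule linear_mapD(1)[OF li x])
    have "i (fmor F P P h x) = i x"
      using fun_cong[OF conj_id, of "i x"] ix by (simp add: compose_def i'i[OF x])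
    from arg_cong[OF this, of i'] have "fmor F P P h x = x"
      unfolding i'i[OF x] i'i[OF linear_mapD(1)[OF lF[OF P P h_hom] x]] .
    then show "fmor F P P h x = restrict (\<lambda>x. x) (carrier (fobj F P)) x" using x by simp
  qed
  also have "\<dots> = fmor F P P (restrict (\<lambda>x. x) (carrier P))"
    using F P by (simp add: is_functor_def module_category_simps)
  finally have h_id: "h = restrict (\<lambda>x. x) (carrier P)"
    by (rule inj_onD[OF fully_faithful_modulesD(1)[OF ff P P] _ h_hom module_homs_id[OF P]])
  obtain n :: nat and x g where n: "n \<ge> 1" and xg: "\<forall>k<n. x k \<in> carrier P \<and> g k \<in> module_homs R P U"
    and hp: "\<forall>p\<in>carrier P. h p = (\<Oplus>\<^bsub>P\<^esub>k\<in>{..<n}. \<rho> (x k) (g k p))"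
    using h unfolding finite_rank_def by (elim conjE exE)
  define c where "c k p = inv_into (carrier R) \<kappa> (g k p)" for k p
  have c: "c k p \<in> carrier R" "\<kappa> (c k p) = g k p" if "k < n" "p \<in> carrier P" for k p
  proof -
    have "g k p \<in> \<kappa> ` carrier R" unfolding im using gU xg that by blast
    then show "c k p \<in> carrier R" "\<kappa> (c k p) = g k p"
      unfolding c_def by (rule inv_into_into, rule f_inv_into_f)
  qed
  have lg: "linear_map R P U (g k)" if "k < n" for k using xg that by (simp add: module_homs_iff)
  have "dual_basis R P n x c"
  proof
    show "nondegenerate_module R P" by (rule module_objD(3)[OF P])
  next
    fix k assume "k < n"
    then show "x k \<in> carrier P" using xg by blast
  next
    fix k p assume "k < n" "p \<in> carrier P"
    then show "c k p \<in> carrier R" by (rule c(1))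
  next
    fix k r p p' assume k: "k < n" and r: "r \<in> carrier R" and p: "p \<in> carrier P" "p' \<in> carrier P"
    have "\<kappa> (c k (p \<oplus>\<^bsub>P\<^esub> p')) = \<kappa> (c k p \<oplus>\<^bsub>R\<^esub> c k p')"
      using k p by (simp add: c \<kappa>_add linear_mapD(2)[OF lg])
    then show "r \<otimes>\<^bsub>R\<^esub> c k (p \<oplus>\<^bsub>P\<^esub> p') = r \<otimes>\<^bsub>R\<^esub> (c k p \<oplus>\<^bsub>R\<^esub> c k p')"
      using \<kappa>_iff[of "c k (p \<oplus>\<^bsub>P\<^esub> p')" "c k p \<oplus>\<^bsub>R\<^esub> c k p'"] k p r c(1) by simp
  next
    fix k r s p assume k: "k < n" and r: "r \<in> carrier R" and s: "s \<in> carrier R" and p: "p \<in> carrier P"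
    have "\<kappa> (c k (s \<odot>\<^bsub>P\<^esub> p)) = \<kappa> (s \<otimes>\<^bsub>R\<^esub> c k p)"
      using k p s by (simp add: c \<kappa>_mult linear_mapD(3)[OF lg] P.lm_smult_closed)
    then show "r \<otimes>\<^bsub>R\<^esub> c k (s \<odot>\<^bsub>P\<^esub> p) = r \<otimes>\<^bsub>R\<^esub> (s \<otimes>\<^bsub>R\<^esub> c k p)"
      using \<kappa>_iff[of "c k (s \<odot>\<^bsub>P\<^esub> p)" "s \<otimes>\<^bsub>R\<^esub> c k p"] k p r s c(1)
      by (simp add: P.lm_smult_closed R.rng_m_closed)
  next
    fix p assume p: "p \<in> carrier P"
    have "(\<Oplus>\<^bsub>P\<^esub>k\<in>{..<n}. c k p \<odot>\<^bsub>P\<^esub> x k) = (\<Oplus>\<^bsub>P\<^esub>k\<in>{..<n}. \<rho> (x k) (g k p))"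
    proof (rule P.M.finsum_cong')
      show "(\<lambda>k. \<rho> (x k) (g k p)) \<in> {..<n} \<rightarrow> carrier P"
        using xg p gU linear_mapD(1)[OF l\<rho>] by auto
      fix k assume k: "k \<in> {..<n}"
      then have "\<rho> (x k) (\<kappa> (c k p)) = c k p \<odot>\<^bsub>P\<^esub> x k" using xg p c(1) by (intro \<rho>_\<kappa>) auto
      then show "c k p \<odot>\<^bsub>P\<^esub> x k = \<rho> (x k) (g k p)" using c(2) k p by simp
    qed simp
    also have "\<dots> = p" using hp p h_id by simp
    finally show "(\<Oplus>\<^bsub>P\<^esub>k\<in>{..<n}. c k p \<odot>\<^bsub>P\<^esub> x k) = p" .
  qed
  then show ?thesis using n by blast
qed

section \<open>Morita invariance\<close>

text \<open>
  Both corners are opposite to endomorphism rings of modules that correspond to each other under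
  the equivalence: \<open>eSe\<close> to that of \<open>Q\<close>, and \<open>A M\<^sub>n(R) A\<close> to that of \<open>P\<close>.
\<close>

lemma corner_isomorphic_matrix_corner:
  fixes R S :: "'a ring"
  assumes R: "idempotent_rng R" and S: "idempotent_rng S"
    and inf: "infinite (UNIV :: 'm set)" and j: "inj (j :: 'a \<Rightarrow> 'm)"
    and eqv: "morita_equivalent TYPE('m) R S"
    and e: "e \<in> carrier S" "e = e \<otimes>\<^bsub>S\<^esub> e"
  obtains n A where "n \<ge> 1" "A \<in> carrier (matrix_rng n R)" "A = A \<otimes>\<^bsub>matrix_rng n R\<^esub> A"
    and "rng_isomorphic (corner (matrix_rng n R) A) (corner S e)"
proof -
  interpret S: rng S using S by (simp add: idempotent_rng_def)
  obtain F :: "(('a, 'm) module, 'm \<Rightarrow> 'm, ('a, 'm) module, 'm \<Rightarrow> 'm) functor_data"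
    where F: "is_functor (module_category R) (module_category S) F"
      and ff: "fully_faithful (module_category R) (module_category S) F"
      and ess: "\<forall>Z\<in>obj (module_category S).
        \<exists>X\<in>obj (module_category R). \<exists>i. isomorphism_in (module_category S) (fobj F X) Z i"
    using equivalence_fully_faithful[OF is_category_module_category is_category_module_category
        eqv[unfolded morita_equivalent_def]] by (elim exE conjE)
  obtain Q :: "('a, 'm) module" and q where Q: "Q \<in> obj (module_category S)"
    and q: "q \<in> carrier Q" "e \<odot>\<^bsub>Q\<^esub> q = q"
    and unique: "\<forall>(N :: ('a, 'm) module). \<forall>f\<in>module_homs S Q N. \<forall>g\<in>module_homs S Q N.
      f q = g q \<longrightarrow> f = g"
    and exists: "\<forall>(N :: ('a, 'm) module)\<in>obj (module_category S). \<forall>y\<in>carrier N.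
      e \<odot>\<^bsub>N\<^esub> y = y \<longrightarrow> (\<exists>f\<in>module_homs S Q N. f q = y)"
    and eSe: "rng_isomorphic (corner S e) (opposite_endomorphism_rng S Q)"
    using idempotent_module[OF S j e] by (elim exE conjE)
  obtain P i where P: "P \<in> obj (module_category R)"
    and iso: "isomorphism_in (module_category S) (fobj F P) Q i"
    using bspec[OF ess Q] by (elim bexE exE)
  have "\<exists>n\<ge>1. \<exists>x c. dual_basis R P n x c"
    by (rule dual_basis_exists[OF R S inf j F ff ess P Q iso e q unique exists])
  then obtain n x c where n: "n \<ge> 1" and "dual_basis R P n x c" by blast
  then interpret dual_basis R P n x c by blast
  obtain A where A: "A \<in> carrier (matrix_rng n R)" "A \<otimes>\<^bsub>matrix_rng n R\<^esub> A = A"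
    and AP: "rng_isomorphic (opposite_endomorphism_rng R P) (corner (matrix_rng n R) A)"
    using endomorphism_rng_isomorphic_corner by blast
  have PA: "rng_isomorphic (corner (matrix_rng n R) A) (opposite_endomorphism_rng R P)"
    by (rule rng_isomorphic_sym[OF AP opposite_endomorphism_rng_closed[OF P]])
  have PQ: "rng_isomorphic (opposite_endomorphism_rng R P) (opposite_endomorphism_rng S Q)"
    by (rule endomorphism_rng_transfer[OF inf F ff P Q iso])
  interpret C: rng "corner S e" by (rule S.rng_corner[OF e])
  have "rng_isomorphic (opposite_endomorphism_rng S Q) (corner S e)"
    by (rule rng_isomorphic_sym[OF eSe C.a_closed C.rng_m_closed])
  then have "rng_isomorphic (corner (matrix_rng n R) A) (corner S e)"
    by (rule rng_isomorphic_trans[OF rng_isomorphic_trans[OF PA PQ]])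
  then show ?thesis using that[OF n A(1) A(2)[symmetric]] by blast
qed

text \<open>
  If \<open>R\<close> satisfies \<open>P\<close>, so do its matrix rings, up to isomorphism members of \<open>\<C>\<close>, and so do the
  corners of these. Every corner of a Morita equivalent \<open>S\<close> is among them, so \<open>S\<close> satisfies \<open>P\<close>.
\<close>

lemma morita_invariant_if_stable_by_corners:
  fixes \<C> :: "'a ring set" and P :: "'a ring \<Rightarrow> bool"
  assumes inf: "infinite (UNIV :: 'a set)" and j: "inj (j :: 'a \<Rightarrow> 'm)"
    and \<C>: "\<C> \<subseteq> {R. idempotent_rng R}" and cl: "closed_under_matrices \<C>" and P: "ring_property P"
    and corners: "stable_by_corners \<C> P" and matrices: "stable_under_matrices \<C> P"
  shows "morita_invariant TYPE('m) \<C> P"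
  unfolding morita_invariant_def
proof (intro ballI impI)
  fix R S assume R: "R \<in> \<C>" and S: "S \<in> \<C>" and PR: "P R" and eqv: "morita_equivalent TYPE('m) R S"
  have Ri: "idempotent_rng R" and Si: "idempotent_rng S" using \<C> R S by auto
  interpret R: rng R using Ri by (simp add: idempotent_rng_def)
  interpret S: rng S using Si by (simp add: idempotent_rng_def)
  have inf': "infinite (UNIV :: 'm set)"
    using inf finite_imageD[OF finite_subset[OF subset_UNIV], of j UNIV] j by blast
  have "P (corner S e)" if e: "e \<in> carrier S" "e = e \<otimes>\<^bsub>S\<^esub> e" for e
  proof -
    obtain n A where n: "n \<ge> 1" and A: "A \<in> carrier (matrix_rng n R)" "A = A \<otimes>\<^bsub>matrix_rng n R\<^esub> A"
      and iso: "rng_isomorphic (corner (matrix_rng n R) A) (corner S e)"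
      using corner_isomorphic_matrix_corner[OF Ri Si inf' j eqv e] .
    interpret MR: rng "matrix_rng n R" by (rule R.matrix_rng)
    obtain M where M: "M \<in> \<C>" and MMR: "rng_isomorphic M (matrix_rng n R)"
      using cl R n unfolding closed_under_matrices_def by blast
    interpret M: rng M using \<C> M by (auto simp: idempotent_rng_def)
    have MRM: "rng_isomorphic (matrix_rng n R) M"
      by (rule rng_isomorphic_sym[OF MMR M.a_closed M.rng_m_closed])
    have "satisfies P (matrix_rng n R)"
      using matrices R PR n unfolding stable_under_matrices_def by blast
    then obtain X where X: "rng X" "rng_isomorphic X (matrix_rng n R)" "P X"
      unfolding satisfies_def by blast
    have PM: "P M"
      using ring_propertyD[OF P X(1) M.rng_axioms rng_isomorphic_trans[OF X(2) MRM]] X(3) by (rule iffD1)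
    obtain \<psi> where \<psi>: "\<psi> \<in> rng_iso (matrix_rng n R) M" using MRM by (auto simp: rng_isomorphic_def)
    have \<psi>A: "\<psi> A \<in> carrier M" by (rule rng_isoD(2)[OF \<psi> A(1)])
    have \<psi>AA: "\<psi> A = \<psi> A \<otimes>\<^bsub>M\<^esub> \<psi> A" using rng_isoD(4)[OF \<psi> A(1) A(1)] unfolding A(2)[symmetric] .
    have PC: "P (corner M (\<psi> A))"
      using corners M PM \<psi>A \<psi>AA unfolding stable_by_corners_def by blast
    interpret MA: rng "corner (matrix_rng n R) A" by (rule MR.rng_corner[OF A])
    have "rng_isomorphic (corner M (\<psi> A)) (corner (matrix_rng n R) A)"
      by (rule rng_isomorphic_sym[OF MR.corner_isomorphic[OF \<psi> A(1)] MA.a_closed MA.rng_m_closed])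
    then have "rng_isomorphic (corner M (\<psi> A)) (corner S e)" using iso by (rule rng_isomorphic_trans)
    from ring_propertyD[OF P M.rng_corner[OF \<psi>A \<psi>AA] S.rng_corner[OF e] this] PC
    show ?thesis by (rule iffD1)
  qed
  then show "P S" using corners S unfolding stable_by_corners_def by blast
qed

theorem theorem2p2:
  fixes \<C> :: "'a ring set" and P :: "'a ring \<Rightarrow> bool"
  assumes "infinite (UNIV :: 'a set)"
    and "\<exists>\<iota> :: 'a \<Rightarrow> 'm. inj \<iota>"
    and "\<C> \<subseteq> {R. idempotent_rng R}"
    and "closed_under_matrices \<C>"
    and "ring_property P"
  shows "(stable_by_local_algebras \<C> P \<and> stable_under_matrices \<C> P
            \<longrightarrow> morita_invariant TYPE('m) \<C> P) \<and>
         (stable_by_corners \<C> P \<and> stable_under_matrices \<C> P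
            \<longrightarrow> morita_invariant TYPE('m) \<C> P)"
proof -
  obtain j :: "'a \<Rightarrow> 'm" where j: "inj j" using assms(2) by blast
  have "\<C> \<subseteq> {R. rng R}" using assms(3) by (auto simp: idempotent_rng_def)
  then have "stable_by_corners \<C> P" if "stable_by_local_algebras \<C> P"
    using stable_by_corners_if_stable_by_local_algebras[OF assms(5) _ that] by blast
  then show ?thesis
    using morita_invariant_if_stable_by_corners[OF assms(1) j assms(3-5)] by blast
qed

end
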